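(* In the presence of a speculator, provided that $\Pi^\star(v)<0$ for all $v\in(0,r]$, the first-price auction (FPA) is better for the auctioneer and for efficiency but worse for the sellers than the second-price auction (SPA).
   Context: Setting. $N\ge2$ risk-neutral sellers each own one item; their private values $v_i$ are drawn independently from a CDF $F$ on $[0,1]$ with a density $f$, and $F(0)=0<F(v)$ for all $v\in(0,1]$. An auctioneer buys one item by a reverse auction with reserve price $r\in(0,1]$ (SPA: the lowest bid not exceeding $r$ wins and is paid the minimum of $r$ and the lowest competing bid; FPA: the lowest bid not exceeding $r$ wins and is paid its bid). A seller selling at price $t$ gets $t-v_i$, and gets $0$ without a transaction. A risk-neutral speculator has value $0$ for items. Stage 1: he offers every seller a price $p\in[0,r]$, chosen to maximize his expected profit (auction revenue minus acquisition payments); sellers simultaneously accept or reject. Stage 2: the number of sellers in the auction and whether the speculator participates are announced, and the auction is held among the sellers who rejected and the speculator (if he acquired at least one item; he withholds all but one item, and unsold items are worth $0$ to him). SPA equilibrium: in the auction sellers bid truthfully and the speculator bids $0$ for one item; seller $i$ accepts if and only if $v_i<v^*(p)$, where $v^*(p)=0$ for $p\le\pi_0:=\int_0^r[1-F(x)]^{N-1}dx$ and otherwise $v^*(p)$ is the unique solution $v$ of $p-v=\int_v^r[1-F(x)]^{N-1}dx$. FPA equilibrium: symmetric perfect Bayesian equilibrium in which nobody bids below his value; sellers accept if and only if their value is below a cutoff $v\in[0,r]$. With $G(b;v)=\frac{F(b)-F(v)}{1-F(v)}$ and $\underline b(m,v)=\max_{v\le b\le r}b[1-G(b;v)]^m$,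 cutoff $v$ is induced by the offer $$p^\star(v)=v+\int_v^r[1-F(x)]^{N-1}dx+\sum_{m=0}^{N-2}\binom{N-1}{m}[1-F(v)]^m[F(v)]^{N-1-m}\big[\underline b(m+1,v)-v\big],$$ offers $p\le p^\star(0)=\pi_0$ give cutoff $0$ (no seller accepts), and the speculator's expected profit at cutoff $v$ is $$\Pi^\star(v)=\sum_{m=1}^{N-1}\binom Nm[1-F(v)]^m[F(v)]^{N-m}\,\underline b(m,v)+[F(v)]^N r-N F(v)\,p^\star(v).$$ *)

theory Defs
  imports "HOL-Probability.Probability"
begin

section \<open>Players and types\<close>

text \<open>
  Sellers are the players \<open>0, \<dots>, N - 1\<close>; the speculator is player \<open>N\<close>. The type of a player is a
  pair of his private value and a uniform randomization device, so that a bid which is a function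
  of the type is a behavioural (possibly mixed) strategy.
\<close>

definition value_dist :: "(real \<Rightarrow> real) \<Rightarrow> real measure" where
  "value_dist f = density lborel (\<lambda>x. ennreal (f x))"

abbreviation F :: "(real \<Rightarrow> real) \<Rightarrow> real \<Rightarrow> real" where
  "F f \<equiv> cdf (value_dist f)"

definition randomizer :: "real measure" where
  "randomizer = uniform_measure lborel {0..1}"

definition type_dist :: "real measure \<Rightarrow> nat \<Rightarrow> nat set \<Rightarrow> (nat \<Rightarrow> real \<times> real) measure" where
  "type_dist V N I = (\<Pi>\<^sub>M i\<in>I. (if i < N then V else return borel 0) \<Otimes>\<^sub>M randomizer)"

section \<open>Reverse auctions with a reserve price\<close>

text \<open>\<open>I\<close> is the set of bidders and \<open>b\<close> the bid profile. Ties are broken uniformly.\<close>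

definition lowest_bidders :: "real \<Rightarrow> nat set \<Rightarrow> (nat \<Rightarrow> real) \<Rightarrow> nat set" where
  "lowest_bidders r I b = {i \<in> I. b i \<le> r \<and> (\<forall>j\<in>I. b i \<le> b j)}"

definition win_prob :: "real \<Rightarrow> nat set \<Rightarrow> (nat \<Rightarrow> real) \<Rightarrow> nat \<Rightarrow> real" where
  "win_prob r I b i =
     (if i \<in> lowest_bidders r I b then 1 / real (card (lowest_bidders r I b)) else 0)"

type_synonym price_rule = "real \<Rightarrow> nat set \<Rightarrow> (nat \<Rightarrow> real) \<Rightarrow> nat \<Rightarrow> real"

definition first_price :: price_rule where
  "first_price r I b i = b i"

definition second_price :: price_rule where
  "second_price r I b i = Min (insert r (b ` (I - {i})))"

section \<open>Play of the two-stage game and payoffs\<close>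

text \<open>
  A play records the offer, the cutoff below which sellers accept it, and the bids. Bids may depend
  on the announced number \<open>m\<close> of sellers in the auction. The announcement whether the speculator
  participates carries no further information: he does if and only if \<open>m < N\<close>.
\<close>

record play =
  pricing :: price_rule
  offer :: real
  cutoff :: real
  seller_bid :: "nat \<Rightarrow> real \<Rightarrow> real \<Rightarrow> real"
  speculator_bid :: "nat \<Rightarrow> real \<Rightarrow> real"

definition bidders :: "nat \<Rightarrow> nat set \<Rightarrow> nat set" where
  "bidders N R = R \<union> (if card R < N then {N} else {})"

definition bids :: "nat \<Rightarrow> play \<Rightarrow> nat \<Rightarrow> (nat \<Rightarrow> real \<times> real) \<Rightarrow> nat \<Rightarrow> real" where
  "bids N P m \<omega> i =
     (if i < N then seller_bid P m (fst (\<omega> i)) (snd (\<omega> i)) else speculator_bid P m (snd (\<omega> i)))"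

definition rejecting :: "nat \<Rightarrow> play \<Rightarrow> (nat \<Rightarrow> real \<times> real) \<Rightarrow> nat set" where
  "rejecting N P \<omega> = {i. i < N \<and> \<not> fst (\<omega> i) < cutoff P}"

definition wins :: "nat \<Rightarrow> real \<Rightarrow> play \<Rightarrow> (nat \<Rightarrow> real \<times> real) \<Rightarrow> nat \<Rightarrow> real" where
  "wins N r P \<omega> i =
     (let R = rejecting N P \<omega> in win_prob r (bidders N R) (bids N P (card R) \<omega>) i)"

definition price :: "nat \<Rightarrow> real \<Rightarrow> play \<Rightarrow> (nat \<Rightarrow> real \<times> real) \<Rightarrow> nat \<Rightarrow> real" where
  "price N r P \<omega> i =
     (let R = rejecting N P \<omega> in pricing P r (bidders N R) (bids N P (card R) \<omega>) i)"

text \<open>\<open>w\<close> is the auctioneer's value for the item.\<close>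

definition auctioneer_payoff :: "(real \<Rightarrow> real) \<Rightarrow> nat \<Rightarrow> real \<Rightarrow> real \<Rightarrow> play \<Rightarrow> real" where
  "auctioneer_payoff f N r w P =
     (\<integral>\<omega>. (\<Sum>i\<in>{..N}. wins N r P \<omega> i * (w - price N r P \<omega> i)) \<partial>type_dist (value_dist f) N {..N})"

definition seller_payoff :: "(real \<Rightarrow> real) \<Rightarrow> nat \<Rightarrow> real \<Rightarrow> play \<Rightarrow> nat \<Rightarrow> real" where
  "seller_payoff f N r P i =
     (\<integral>\<omega>. (if fst (\<omega> i) < cutoff P then offer P - fst (\<omega> i)
           else wins N r P \<omega> i * (price N r P \<omega> i - fst (\<omega> i))) \<partial>type_dist (value_dist f) N {..N})"

definition speculator_payoff :: "(real \<Rightarrow> real) \<Rightarrow> nat \<Rightarrow> real \<Rightarrow> play \<Rightarrow> real" where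
  "speculator_payoff f N r P =
     (\<integral>\<omega>. (wins N r P \<omega> N * price N r P \<omega> N
           - real (N - card (rejecting N P \<omega>)) * offer P) \<partial>type_dist (value_dist f) N {..N})"

text \<open>
  Seller payoffs are net of the value of the item given up and the speculator derives no value from
  withheld items, so the sum of all payoffs accounts for the private values destroyed.
\<close>

definition total_surplus :: "(real \<Rightarrow> real) \<Rightarrow> nat \<Rightarrow> real \<Rightarrow> real \<Rightarrow> play \<Rightarrow> real" where
  "total_surplus f N r w P =
     auctioneer_payoff f N r w P + (\<Sum>i<N. seller_payoff f N r P i) + speculator_payoff f N r P"

section \<open>Second-price auction\<close>

text \<open>
  A seller whose value equals the cutoff is indifferent: rejecting earns him the truthful-bidding
  rent against the \<open>N - 1\<close> other sellers, since the speculator, bidding \<open>0\<close>, always beats him and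
  enters precisely if some other value lies below the cutoff.
\<close>

definition no_sale_offer :: "(real \<Rightarrow> real) \<Rightarrow> nat \<Rightarrow> real \<Rightarrow> real" where
  "no_sale_offer f N r = integral {0..r} (\<lambda>x. (1 - F f x) ^ (N - 1))"

definition spa_cutoff :: "(real \<Rightarrow> real) \<Rightarrow> nat \<Rightarrow> real \<Rightarrow> real \<Rightarrow> real" where
  "spa_cutoff f N r p =
     (if p \<le> no_sale_offer f N r then 0
      else (THE v. v \<in> {0..r} \<and> p - v = integral {v..r} (\<lambda>x. (1 - F f x) ^ (N - 1))))"

definition spa_play :: "(real \<Rightarrow> real) \<Rightarrow> nat \<Rightarrow> real \<Rightarrow> real \<Rightarrow> play" where
  "spa_play f N r p =
     \<lparr>pricing = second_price, offer = p, cutoff = spa_cutoff f N r p,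
      seller_bid = (\<lambda>m v u. v), speculator_bid = (\<lambda>m u. 0)\<rparr>"

definition spa_equilibrium :: "(real \<Rightarrow> real) \<Rightarrow> nat \<Rightarrow> real \<Rightarrow> play \<Rightarrow> bool" where
  "spa_equilibrium f N r P \<longleftrightarrow>
     (\<exists>p\<in>{0..r}. P = spa_play f N r p \<and>
       (\<forall>q\<in>{0..r}. speculator_payoff f N r (spa_play f N r q)
                  \<le> speculator_payoff f N r (spa_play f N r p)))"

section \<open>First-price auction\<close>

text \<open>
  \<open>b_low f r m v\<close> is the payoff the speculator secures against \<open>m\<close> sellers with values of at least
  \<open>v\<close>; it is also the lowest equilibrium bid. Hence \<open>fpa_offer\<close> is the offer making the cutoff
  seller indifferent (\<open>m\<close> counts the other rejecting sellers; with all \<open>N - 1\<close> of them rejecting the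
  speculator is absent, which is the integral), and \<open>fpa_profit\<close> is the resulting expected profit.
  If \<open>F f v = 1\<close>, then \<open>G f b v = 0\<close> by division by zero, which gives \<open>b_low f r m v = r\<close>.
\<close>

definition G :: "(real \<Rightarrow> real) \<Rightarrow> real \<Rightarrow> real \<Rightarrow> real" where
  "G f b v = (F f b - F f v) / (1 - F f v)"

definition b_low :: "(real \<Rightarrow> real) \<Rightarrow> real \<Rightarrow> nat \<Rightarrow> real \<Rightarrow> real" where
  "b_low f r m v = (SUP b\<in>{v..r}. b * (1 - G f b v) ^ m)"

definition fpa_offer :: "(real \<Rightarrow> real) \<Rightarrow> nat \<Rightarrow> real \<Rightarrow> real \<Rightarrow> real" where
  "fpa_offer f N r v =
     v + integral {v..r} (\<lambda>x. (1 - F f x) ^ (N - 1))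
     + (\<Sum>m=0..N-2. real ((N - 1) choose m) * (1 - F f v) ^ m * F f v ^ (N - 1 - m)
          * (b_low f r (m + 1) v - v))"

definition fpa_profit :: "(real \<Rightarrow> real) \<Rightarrow> nat \<Rightarrow> real \<Rightarrow> real \<Rightarrow> real" where
  "fpa_profit f N r v =
     (\<Sum>m=1..N-1. real (N choose m) * (1 - F f v) ^ m * F f v ^ (N - m) * b_low f r m v)
     + F f v ^ N * r - real N * F f v * fpa_offer f N r v"

text \<open>
  Offers and the cutoffs they induce are related rather than given by a function: if \<open>F\<close> reaches \<open>1\<close>
  below \<open>r\<close>, some wasteful offers are not of the form \<open>fpa_offer f N r v\<close>.
\<close>

definition fpa_induces :: "(real \<Rightarrow> real) \<Rightarrow> nat \<Rightarrow> real \<Rightarrow> real \<Rightarrow> real \<Rightarrow> bool" where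
  "fpa_induces f N r p v \<longleftrightarrow>
     p \<in> {0..r} \<and>
     ((p \<le> fpa_offer f N r 0 \<and> v = 0) \<or> (v \<in> {0<..r} \<and> p = fpa_offer f N r v))"

text \<open>
  Equilibrium of the auction after \<open>m\<close> sellers have rejected; by symmetry these are the sellers
  \<open>0, \<dots>, m - 1\<close>. The belief about their values is the prior conditioned on values of at least the
  cutoff. If the cutoff is at the top of the value distribution, the belief is the null measure
  and imposes no restriction on the bids of sellers who reject with probability zero.
\<close>

definition belief :: "(real \<Rightarrow> real) \<Rightarrow> play \<Rightarrow> real measure" where
  "belief f P = uniform_measure (value_dist f) {cutoff P..}"

definition fpa_seller_interim ::
    "(real \<Rightarrow> real) \<Rightarrow> nat \<Rightarrow> real \<Rightarrow> play \<Rightarrow> nat \<Rightarrow> real \<Rightarrow> real \<Rightarrow> real" where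
  "fpa_seller_interim f N r P m v b =
     (let I = bidders N {..<m} in
      \<integral>\<omega>. win_prob r I ((bids N P m \<omega>)(0 := b)) 0 * (b - v) \<partial>type_dist (belief f P) N I)"

definition fpa_speculator_interim ::
    "(real \<Rightarrow> real) \<Rightarrow> nat \<Rightarrow> real \<Rightarrow> play \<Rightarrow> nat \<Rightarrow> real \<Rightarrow> real" where
  "fpa_speculator_interim f N r P m b =
     (let I = bidders N {..<m} in
      \<integral>\<omega>. win_prob r I ((bids N P m \<omega>)(N := b)) N * b \<partial>type_dist (belief f P) N I)"

definition fpa_bidding_equilibrium :: "(real \<Rightarrow> real) \<Rightarrow> nat \<Rightarrow> real \<Rightarrow> play \<Rightarrow> bool" where
  "fpa_bidding_equilibrium f N r P \<longleftrightarrow>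
     (\<forall>m\<in>{1..N}.
        case_prod (seller_bid P m) \<in> borel_measurable (borel \<Otimes>\<^sub>M borel) \<and>
        (AE (v, u) in belief f P \<Otimes>\<^sub>M randomizer.
           v \<le> seller_bid P m v u \<and>
           (\<forall>b. fpa_seller_interim f N r P m v b
               \<le> fpa_seller_interim f N r P m v (seller_bid P m v u)))) \<and>
     (\<forall>m\<in>{0..<N}.
        speculator_bid P m \<in> borel_measurable borel \<and>
        (AE u in randomizer.
           0 \<le> speculator_bid P m u \<and>
           (\<forall>b. fpa_speculator_interim f N r P m b
               \<le> fpa_speculator_interim f N r P m (speculator_bid P m u))))"

definition fpa_equilibrium :: "(real \<Rightarrow> real) \<Rightarrow> nat \<Rightarrow> real \<Rightarrow> play \<Rightarrow> bool" where
  "fpa_equilibrium f N r P \<longleftrightarrow>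
     pricing P = first_price \<and>
     fpa_induces f N r (offer P) (cutoff P) \<and>
     (\<forall>p v. fpa_induces f N r p v \<longrightarrow> fpa_profit f N r v \<le> fpa_profit f N r (cutoff P)) \<and>
     fpa_bidding_equilibrium f N r P"

end

theory Submission
  imports Defs
begin

text \<open>
  No offer with a positive cutoff is profitable against the first-price auction, so there every
  seller takes part. Best responses are then increasing in the value and free of ties: the lowest
  value not exceeding the reserve sells, and by the envelope argument a seller of value \<open>v\<close> earns at
  most \<open>rent v = (\<integral>\<^bsub>v\<^esub>\<^bsup>r\<^esup> (1 - F)^(N - 1))\<close>, which is also his payoff from a second-price auction without
  speculation.

  In the second-price auction a small positive cutoff is profitable: the speculator breaks even when
  a single seller accepts, and gains when two do and the others have high values. So the cutoff \<open>c\<close>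
  is positive. Sellers with values below \<open>c\<close> are then paid more than their rent, and whenever two
  sellers accept, an item is withheld and the auctioneer pays more than the second lowest value.
\<close>

section \<open>Deterministic properties of the auctions\<close>

text \<open>Both auctions are compared with one benchmark: expected \<open>efficient_surplus\<close>
  less N times the mean rent, the auctioneer's payoff in a second-price auction without a
  speculator. Against it an upper bound on the sellers' first-price payoffs suffices, so the
  equilibrium bid function is never computed. Bids may be randomized and are optimal only for almost
  every type, and F may be flat on intervals or reach 1 below r, so no derivative of a bid function
  is available. The envelope step works instead with the convex value function \<open>U\<close>,
  whose decrements are bounded by winning probabilities of lower types. That a small cutoff c pays
  in the second-price auction is delicate: indifference of the cutoff seller makes revenue and
  acquisition cost cancel at first order in F(c). What remains is of order F(c)^2: a revenue of at
  least d when two sellers accept and the others lie above a fixed d, against costs proportional to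
  c. Shrinking c with d fixed decides the sign.\<close>

lemma lowest_bidders_cong:
  "(\<And>i. i \<in> I \<Longrightarrow> b i = b' i) \<Longrightarrow> lowest_bidders r I b = lowest_bidders r I b'"
  unfolding lowest_bidders_def by auto

lemma win_prob_cong:
  "(\<And>i. i \<in> I \<Longrightarrow> b i = b' i) \<Longrightarrow> win_prob r I b = win_prob r I b'"
  unfolding win_prob_def using lowest_bidders_cong[of I b b' r] by auto

lemma win_prob_nonneg: "0 \<le> win_prob r I b i"
  by (simp add: win_prob_def)

lemma win_prob_outside: "i \<notin> I \<Longrightarrow> win_prob r I b i = 0"
  by (simp add: win_prob_def lowest_bidders_def)

lemma finite_lowest_bidders: "finite I \<Longrightarrow> finite (lowest_bidders r I b)"
  by (simp add: lowest_bidders_def)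

lemma win_prob_le_1: "win_prob r I b i \<le> 1"
  by (cases "card (lowest_bidders r I b)") (auto simp: win_prob_def)

lemma win_prob_sole: "lowest_bidders r I b = {k} \<Longrightarrow> win_prob r I b i = of_bool (i = k)"
  by (simp add: win_prob_def)

lemma sum_win_prob:
  assumes "finite I"
  shows "(\<Sum>i\<in>I. win_prob r I b i) = of_bool (lowest_bidders r I b \<noteq> {})"
proof -
  have sub: "lowest_bidders r I b \<subseteq> I" by (auto simp: lowest_bidders_def)
  have "(\<Sum>i\<in>I. win_prob r I b i) = (\<Sum>i\<in>lowest_bidders r I b. win_prob r I b i)"
    using assms sub by (intro sum.mono_neutral_right) (auto simp: win_prob_def)
  also have "\<dots> = (\<Sum>i\<in>lowest_bidders r I b. 1 / real (card (lowest_bidders r I b)))"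
    by (simp add: win_prob_def)
  also have "\<dots> = of_bool (lowest_bidders r I b \<noteq> {})"
    using finite_lowest_bidders[OF assms, of r b] by simp
  finally show ?thesis .
qed

text \<open>The price a truthful bidder \<open>i\<close> collects in the second-price auction among all sellers, net of
  his value: it vanishes unless he is the unique lowest bidder.\<close>

definition gain :: "nat \<Rightarrow> real \<Rightarrow> (nat \<Rightarrow> real) \<Rightarrow> nat \<Rightarrow> real" where
  "gain N r x i = max 0 (Min (insert r (x ` ({..<N} - {i}))) - x i)"

lemma gain_nonneg: "0 \<le> gain N r x i"
  by (simp add: gain_def)

lemma gain_eq_0: "j < N \<Longrightarrow> j \<noteq> i \<Longrightarrow> x j \<le> x i \<Longrightarrow> gain N r x i = 0"
proof -
  assume "j < N" "j \<noteq> i" "x j \<le> x i"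
  moreover from this have "Min (insert r (x ` ({..<N} - {i}))) \<le> x j" by (intro Min_le) auto
  ultimately show ?thesis unfolding gain_def by linarith
qed

lemma gain_eq_0_reserve: "r \<le> x i \<Longrightarrow> gain N r x i = 0"
proof -
  assume "r \<le> x i"
  moreover have "Min (insert r (x ` ({..<N} - {i}))) \<le> r" by (intro Min_le) auto
  ultimately show ?thesis unfolding gain_def by linarith
qed

text \<open>A tied winner is paid exactly his own value, so the tie-breaking weight multiplies zero
  and truthful profits need no further treatment of ties.\<close>

lemma second_price_gain:
  assumes "i < N"
  shows "win_prob r {..<N} x i * (second_price r {..<N} x i - x i) = gain N r x i"
proof (cases "i \<in> lowest_bidders r {..<N} x")
  case True
  then have le: "x i \<le> r" "\<And>j. j < N \<Longrightarrow> x i \<le> x j"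
    by (auto simp: lowest_bidders_def)
  show ?thesis
  proof (cases "\<exists>j<N. j \<noteq> i \<and> x j = x i")
    case True
    then obtain j where j: "j < N" "j \<noteq> i" "x j = x i" by blast
    have "second_price r {..<N} x i = x i"
      unfolding second_price_def using j le imageI[of j "{..<N} - {i}" x] by (intro Min_eqI) auto
    then show ?thesis using j gain_eq_0[of j N i x r] by simp
  next
    case False
    then have "lowest_bidders r {..<N} x = {i}"
      using assms le \<open>i \<in> lowest_bidders r {..<N} x\<close>
      by (auto simp: lowest_bidders_def intro: antisym)
    moreover have "x i \<le> second_price r {..<N} x i"
      unfolding second_price_def using le by (intro Min.boundedI) auto
    ultimately show ?thesis
      by (simp add: win_prob_sole gain_def second_price_def)
  qed
next
  case False
  then have "r \<le> x i \<or> (\<exists>j<N. j \<noteq> i \<and> x j \<le> x i)"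
    using assms by (auto simp: lowest_bidders_def not_le)
  then have "gain N r x i = 0"
    using gain_eq_0[of _ N i x r] gain_eq_0_reserve[of r x i N] by blast
  with False show ?thesis by (simp add: win_prob_def)
qed

text \<open>All lowest bidders share the same value, and their tie-breaking weights sum to
  one.\<close>

lemma sum_win_prob_value:
  assumes "N > 0"
  shows "(\<Sum>i<N. win_prob r {..<N} x i * (w - x i))
    = of_bool (Min (x ` {..<N}) \<le> r) * (w - Min (x ` {..<N}))"
proof -
  let ?m = "Min (x ` {..<N})" and ?L = "lowest_bidders r {..<N} x"
  have ne: "{..<N} \<noteq> {}" using assms by auto
  have m: "x i = ?m" if "i \<in> ?L" for i
  proof -
    have "?m = x i" using that by (intro Min_eqI) (auto simp: lowest_bidders_def)
    then show ?thesis by simp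
  qed
  have "?L \<noteq> {} \<longleftrightarrow> ?m \<le> r"
  proof
    assume "?L \<noteq> {}"
    then obtain i where "i \<in> ?L" by blast
    moreover from this have "x i \<le> r" by (simp add: lowest_bidders_def)
    ultimately show "?m \<le> r" using m by metis
  next
    assume "?m \<le> r"
    moreover have "?m \<in> x ` {..<N}" using ne by (intro Min_in) auto
    then obtain i where "i < N" "x i = ?m" by (metis imageE lessThan_iff)
    moreover have "?m \<le> x j" if "j < N" for j using that by (intro Min_le) auto
    ultimately have "i \<in> ?L" by (auto simp: lowest_bidders_def simp del: Min_le_iff)
    then show "?L \<noteq> {}" by blast
  qed
  then have "(\<Sum>i<N. win_prob r {..<N} x i) = of_bool (?m \<le> r)"
    by (simp add: sum_win_prob)
  moreover have "(\<Sum>i<N. win_prob r {..<N} x i * (w - x i)) = (\<Sum>i<N. win_prob r {..<N} x i * (w - ?m))"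
  proof (intro sum.cong refl)
    fix i show "win_prob r {..<N} x i * (w - x i) = win_prob r {..<N} x i * (w - ?m)"
    proof (cases "i \<in> ?L")
      case True
      then show ?thesis by (simp only: m)
    qed (simp add: win_prob_def)
  qed
  ultimately show ?thesis by (simp add: sum_distrib_right[symmetric])
qed

text \<open>Only the seller with the lowest value can have a positive gain. Adding it to his value
  gives the second lowest value capped at the reserve, which is what the auctioneer pays without
  speculation.\<close>

lemma min_plus_gains:
  assumes "N > 0" "Min (x ` {..<N}) \<le> r"
  obtains i where "i < N" "x i = Min (x ` {..<N})"
    "Min (x ` {..<N}) + (\<Sum>j<N. gain N r x j) = Min (insert r (x ` ({..<N} - {i})))"
proof -
  let ?m = "Min (x ` {..<N})"
  have ne: "{..<N} \<noteq> {}" using assms by auto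
  then have "?m \<in> x ` {..<N}" by (intro Min_in) auto
  then obtain i where i: "i < N" "x i = ?m" by (metis imageE lessThan_iff)
  have le: "x i \<le> x j" if "j < N" for j unfolding i(2) using that by (intro Min_le) auto
  have "(\<Sum>j<N. gain N r x j) = (\<Sum>j\<in>{i}. gain N r x j)"
    using i by (intro sum.mono_neutral_right) (auto intro!: gain_eq_0[of i N] le)
  moreover have "?m \<le> Min (insert r (x ` ({..<N} - {i})))"
    using assms by (intro Min.boundedI) auto
  ultimately have "?m + (\<Sum>j<N. gain N r x j) = Min (insert r (x ` ({..<N} - {i})))"
    using i by (simp add: gain_def)
  with i that show thesis by blast
qed

text \<open>The lowest value is itself below the cutoff, so the rejecting sellers are among the
  competitors of the lowest one. Fewer competitors mean a higher price: speculation cannot lower the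
  auctioneer's payment.\<close>

lemma min_plus_gains_le:
  assumes a: "a < N" "x a < c" and "c \<le> r"
  shows "Min (x ` {..<N}) + (\<Sum>j<N. gain N r x j) \<le> Min (insert r (x ` {i. i < N \<and> \<not> x i < c}))"
proof -
  have "Min (x ` {..<N}) \<le> x a" using a by (intro Min_le) auto
  then have m: "Min (x ` {..<N}) < c" using a by linarith
  then have "Min (x ` {..<N}) \<le> r" "N > 0" using assms by linarith+
  then obtain i where i: "i < N" "x i = Min (x ` {..<N})"
    "Min (x ` {..<N}) + (\<Sum>j<N. gain N r x j) = Min (insert r (x ` ({..<N} - {i})))"
    by (metis min_plus_gains)
  show ?thesis unfolding i(3) using i(2) m by (intro Min_antimono) auto
qed

lemma min_plus_gains_less:
  assumes "a < N" "x a < c" "b < N" "x b < c" "a \<noteq> b" and "c \<le> r"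
  shows "Min (x ` {..<N}) + (\<Sum>j<N. gain N r x j) < Min (insert r (x ` {i. i < N \<and> \<not> x i < c}))"
proof -
  have "Min (x ` {..<N}) \<le> x a" using assms by (intro Min_le) auto
  then have m: "Min (x ` {..<N}) < c" using assms by linarith
  then have "Min (x ` {..<N}) \<le> r" "N > 0" using assms by linarith+
  then obtain i where i: "i < N" "x i = Min (x ` {..<N})"
    "Min (x ` {..<N}) + (\<Sum>j<N. gain N r x j) = Min (insert r (x ` ({..<N} - {i})))"
    by (metis min_plus_gains)
  \<comment> \<open>Of the two accepting sellers at least one differs from the lowest seller
    \<open>i\<close>. He would set a price below \<open>c\<close> as a competitor, but his item is
    withheld.\<close>
  obtain k where k: "k < N" "k \<noteq> i" "x k < c" using assms by metis
  have "Min (insert r (x ` ({..<N} - {i}))) \<le> x k" using k by (intro Min_le) auto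
  also have "x k < c" by fact
  also have "c \<le> Min (insert r (x ` {i. i < N \<and> \<not> x i < c}))"
    using assms by (intro Min.boundedI) auto
  finally show ?thesis using i by simp
qed

section \<open>Outcomes and ex post payoffs under truthful bidding\<close>

definition truthful_play :: "real \<Rightarrow> real \<Rightarrow> play" where
  "truthful_play c p =
     \<lparr>pricing = second_price, offer = p, cutoff = c,
      seller_bid = (\<lambda>m v u. v), speculator_bid = (\<lambda>m u. 0)\<rparr>"

text \<open>Treating cutoff and offer as separate parameters keeps the description operator in
  \<open>spa_cutoff\<close> out of all payoff computations; it is resolved once, in
  \<open>spa_cutoff_offer\<close>.\<close>

lemma spa_play_truthful: "spa_play f N r p = truthful_play (spa_cutoff f N r p) p"
  by (simp add: spa_play_def truthful_play_def)

lemma truthful_play_sel[simp]: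
  "pricing (truthful_play c p) = second_price" "offer (truthful_play c p) = p"
  "cutoff (truthful_play c p) = c"
  by (simp_all add: truthful_play_def)

lemma bids_truthful: "bids N (truthful_play c p) m \<tau> i = (if i < N then fst (\<tau> i) else 0)"
  by (simp add: bids_def truthful_play_def)

lemma bidders_all: "bidders N {..<N} = {..<N}"
  by (simp add: bidders_def)

lemma rejecting_all:
  assumes "\<And>i. i < N \<Longrightarrow> cutoff P \<le> fst (\<tau> i)"
  shows "rejecting N P \<tau> = {..<N}"
  using assms by (auto simp: rejecting_def not_less)

lemma card_rejecting_less:
  assumes "i < N" "fst (\<tau> i) < cutoff P"
  shows "card (rejecting N P \<tau>) < N"
proof -
  have "rejecting N P \<tau> \<subset> {..<N}" using assms by (auto simp: rejecting_def)
  from psubset_card_mono[OF _ this] show ?thesis by simp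
qed

lemma truthful_none:
  assumes "\<And>i. i < N \<Longrightarrow> c \<le> fst (\<tau> i)"
  shows "wins N r (truthful_play c p) \<tau> i = win_prob r {..<N} (\<lambda>i. fst (\<tau> i)) i"
    and "i < N \<Longrightarrow> price N r (truthful_play c p) \<tau> i = second_price r {..<N} (\<lambda>i. fst (\<tau> i)) i"
proof -
  have R: "rejecting N (truthful_play c p) \<tau> = {..<N}"
    using assms by (intro rejecting_all) simp
  show "wins N r (truthful_play c p) \<tau> i = win_prob r {..<N} (\<lambda>i. fst (\<tau> i)) i"
    unfolding wins_def R Let_def bidders_all
    by (rule fun_cong[OF win_prob_cong]) (simp add: bids_truthful)
  show "price N r (truthful_play c p) \<tau> i = second_price r {..<N} (\<lambda>i. fst (\<tau> i)) i"
    unfolding price_def R Let_def bidders_all second_price_def truthful_play_sel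
    by (intro arg_cong[where f = Min] arg_cong[where f = "insert r"] image_cong) (auto simp: bids_truthful)
qed

text \<open>A rejecting seller bids at least \<open>c\<close>, which is positive, so the
  speculator's zero bid wins without a tie and collects the lowest rejecting value or the
  reserve.\<close>

lemma truthful_some:
  assumes "a < N" "fst (\<tau> a) < c" "0 < c" "0 < r"
  shows "wins N r (truthful_play c p) \<tau> i = of_bool (i = N)"
    and "price N r (truthful_play c p) \<tau> N
      = Min (insert r ((\<lambda>i. fst (\<tau> i)) ` {i. i < N \<and> \<not> fst (\<tau> i) < c}))"
proof -
  let ?R = "rejecting N (truthful_play c p) \<tau>"
  have R: "?R = {i. i < N \<and> \<not> fst (\<tau> i) < c}" by (simp add: rejecting_def)
  have b: "bidders N ?R = insert N ?R"
    using card_rejecting_less[of a N \<tau> "truthful_play c p"] assms by (simp add: bidders_def)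
  have "lowest_bidders r (insert N ?R) (bids N (truthful_play c p) (card ?R) \<tau>) = {N}"
    using assms by (auto simp: lowest_bidders_def bids_truthful R)
  then show "wins N r (truthful_play c p) \<tau> i = of_bool (i = N)"
    by (simp add: wins_def Let_def b win_prob_sole)
  have "bids N (truthful_play c p) (card ?R) \<tau> ` (insert N ?R - {N}) = (\<lambda>i. fst (\<tau> i)) ` ?R"
    by (intro image_cong) (auto simp: R bids_truthful)
  then show "price N r (truthful_play c p) \<tau> N
      = Min (insert r ((\<lambda>i. fst (\<tau> i)) ` {i. i < N \<and> \<not> fst (\<tau> i) < c}))"
    unfolding price_def Let_def b second_price_def truthful_play_sel by (simp add: R)
qed

text \<open>A rejecting seller who loses to the speculator would also have lost to the accepting
  seller below him, so his \<open>gain\<close> among all sellers is zero as well. One formula thus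
  covers auctions with and without the speculator.\<close>

lemma truthful_seller:
  assumes "i < N" "0 < r" "c > 0"
  shows "(if fst (\<tau> i) < c then p - fst (\<tau> i)
     else wins N r (truthful_play c p) \<tau> i * (price N r (truthful_play c p) \<tau> i - fst (\<tau> i)))
    = (if fst (\<tau> i) < c then p - fst (\<tau> i) else gain N r (\<lambda>i. fst (\<tau> i)) i)"
proof (cases "\<exists>a<N. fst (\<tau> a) < c")
  case True
  then obtain a where a: "a < N" "fst (\<tau> a) < c" by blast
  show ?thesis
  proof (cases "fst (\<tau> i) < c")
    case False
    then have "gain N r (\<lambda>i. fst (\<tau> i)) i = 0"
      using a by (intro gain_eq_0[of a]) auto
    with False a assms show ?thesis by (simp add: truthful_some(1)[where a = a])
  qed simp
next
  case False
  then have "\<And>i. i < N \<Longrightarrow> c \<le> fst (\<tau> i)" by (meson not_less)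
  note none = truthful_none[of N c \<tau>, OF this]
  from False assms show ?thesis
    by (auto simp: none second_price_gain[of _ N r "\<lambda>i. fst (\<tau> i)"])
qed

lemma truthful_auctioneer:
  assumes "0 < r" "c > 0" "N > 0"
  shows "(\<Sum>i\<in>{..N}. wins N r (truthful_play c p) \<tau> i * (w - price N r (truthful_play c p) \<tau> i))
    = (let x = \<lambda>i. fst (\<tau> i) in
       if \<exists>a<N. x a < c then w - Min (insert r (x ` {i. i < N \<and> \<not> x i < c}))
       else of_bool (Min (x ` {..<N}) \<le> r) * (w - Min (x ` {..<N})) - (\<Sum>i<N. gain N r x i))"
proof (cases "\<exists>a<N. fst (\<tau> a) < c")
  case True
  then obtain a where a: "a < N" "fst (\<tau> a) < c" by blast
  have "(\<Sum>i\<in>{..N}. wins N r (truthful_play c p) \<tau> i * (w - price N r (truthful_play c p) \<tau> i))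
    = (\<Sum>i\<in>{..N}. if i = N then w - price N r (truthful_play c p) \<tau> N else 0)"
    by (intro sum.cong) (use a assms in \<open>auto simp: truthful_some(1)[where a = a]\<close>)
  then show ?thesis using True a assms by (simp add: truthful_some(2))
next
  case False
  then have "\<And>i. i < N \<Longrightarrow> c \<le> fst (\<tau> i)" by (meson not_less)
  note none = truthful_none[of N c \<tau>, OF this]
  let ?x = "\<lambda>i. fst (\<tau> i)"
  have "(\<Sum>i\<in>{..N}. wins N r (truthful_play c p) \<tau> i * (w - price N r (truthful_play c p) \<tau> i))
    = (\<Sum>i<N. wins N r (truthful_play c p) \<tau> i * (w - price N r (truthful_play c p) \<tau> i))"
    by (simp add: lessThan_Suc_atMost[symmetric] none win_prob_outside)
  also have "\<dots> = (\<Sum>i<N. win_prob r {..<N} ?x i * (w - ?x i)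
      - win_prob r {..<N} ?x i * (second_price r {..<N} ?x i - ?x i))"
    by (intro sum.cong) (auto simp: none algebra_simps)
  also have "\<dots> = (\<Sum>i<N. win_prob r {..<N} ?x i * (w - ?x i)) - (\<Sum>i<N. gain N r ?x i)"
    by (simp add: sum_subtractf second_price_gain[of _ N r ?x])
  finally show ?thesis using False assms by (auto simp: sum_win_prob_value Let_def)
qed

lemma truthful_speculator:
  assumes "0 < r" "c > 0"
  shows "wins N r (truthful_play c p) \<tau> N * price N r (truthful_play c p) \<tau> N
      - real (N - card (rejecting N (truthful_play c p) \<tau>)) * offer (truthful_play c p)
    = (let x = \<lambda>i. fst (\<tau> i) in
       if \<exists>a<N. x a < c then Min (insert r (x ` {i. i < N \<and> \<not> x i < c})) - (\<Sum>i<N. of_bool (x i < c) * p)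
       else 0)"
proof (cases "\<exists>a<N. fst (\<tau> a) < c")
  case True
  then obtain a where a: "a < N" "fst (\<tau> a) < c" by blast
  have "rejecting N (truthful_play c p) \<tau> = {..<N} - {i. i < N \<and> fst (\<tau> i) < c}"
    by (auto simp: rejecting_def)
  moreover have "{i. i < N \<and> fst (\<tau> i) < c} \<subseteq> {..<N}" by auto
  ultimately have "N - card (rejecting N (truthful_play c p) \<tau>) = card {i. i < N \<and> fst (\<tau> i) < c}"
    using card_mono[of "{..<N}" "{i. i < N \<and> fst (\<tau> i) < c}"] by (simp add: card_Diff_subset finite_subset)
  moreover have "(\<Sum>i<N. of_bool (fst (\<tau> i) < c) * p) = real (card {i. i < N \<and> fst (\<tau> i) < c}) * p"
  proof -
    have "(\<Sum>i<N. of_bool (fst (\<tau> i) < c) * p) = (\<Sum>i\<in>{i. i < N \<and> fst (\<tau> i) < c}. p)"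
      by (intro sum.mono_neutral_cong_right) auto
    then show ?thesis by simp
  qed
  ultimately show ?thesis using True a assms by (simp add: truthful_some del: sum_mult_of_bool_eq sum_of_bool_mult_eq)
next
  case False
  then have "\<And>i. i < N \<Longrightarrow> c \<le> fst (\<tau> i)" by (meson not_less)
  note none = truthful_none[of N c \<tau>, OF this]
  have "rejecting N (truthful_play c p) \<tau> = {..<N}"
    using False by (intro rejecting_all) (simp, meson not_less)
  with False show ?thesis by (auto simp: none win_prob_outside)
qed

section \<open>Winning probability as a function of the own bid\<close>

lemma win_prob_raise:
  assumes "finite I" "i \<in> I" "b < b'"
  shows "win_prob r I (x(i := b')) i \<le> win_prob r I (x(i := b)) i"
proof (cases "i \<in> lowest_bidders r I (x(i := b'))")
  case True
  then have "b' \<le> r" "\<And>j. j \<in> I \<Longrightarrow> j \<noteq> i \<Longrightarrow> b' \<le> x j"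
    by (auto simp: lowest_bidders_def)
  then have "lowest_bidders r I (x(i := b)) = {i}"
    using assms(2,3) by (force simp: lowest_bidders_def)
  then show ?thesis by (simp only: win_prob_sole) (simp add: win_prob_le_1)
next
  case False
  then show ?thesis by (simp add: win_prob_def)
qed

lemma win_prob_lowest:
  assumes "i \<in> I" "b \<le> r" "\<And>j. j \<in> I \<Longrightarrow> j \<noteq> i \<Longrightarrow> b < x j"
  shows "win_prob r I (x(i := b)) i = 1"
proof -
  have "lowest_bidders r I (x(i := b)) = {i}"
    using assms by (force simp: lowest_bidders_def)
  then show ?thesis by (simp only: win_prob_sole) simp
qed

lemma win_prob_beaten:
  assumes "j \<in> I" "j \<noteq> i" "x j < b"
  shows "win_prob r I (x(i := b)) i = 0"
  using assms by (force simp: win_prob_def lowest_bidders_def)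

lemma win_prob_above_reserve: "r < b \<Longrightarrow> win_prob r I (x(i := b)) i = 0"
  by (simp add: win_prob_def lowest_bidders_def)

lemma win_prob_tie:
  assumes "finite I" "j \<in> I" "j \<noteq> i" "x j = c"
  shows "win_prob r I (x(i := c)) i \<le> 1 / 2"
proof (cases "i \<in> lowest_bidders r I (x(i := c))")
  case True
  then have "{i, j} \<subseteq> lowest_bidders r I (x(i := c))"
    using assms by (auto simp: lowest_bidders_def)
  then have "card {i, j} \<le> card (lowest_bidders r I (x(i := c)))"
    using assms(1) by (intro card_mono finite_lowest_bidders)
  then have "2 \<le> card (lowest_bidders r I (x(i := c)))" using assms(3) by simp
  then have "1 / real (card (lowest_bidders r I (x(i := c)))) \<le> 1 / 2"
    by (intro divide_left_mono) auto
  then show ?thesis using True by (simp add: win_prob_def)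
next
  case False
  then show ?thesis by (simp add: win_prob_def)
qed

lemma win_prob_measurable:
  assumes "finite I" "\<And>k. k \<in> I \<Longrightarrow> g k \<in> borel_measurable M"
  shows "(\<lambda>x. win_prob r I (\<lambda>k. g k x) i) \<in> borel_measurable M"
proof (cases "i \<in> I")
  case False
  then show ?thesis by (simp add: win_prob_outside)
next
  case True
  have low: "Measurable.pred M (\<lambda>x. g k x \<le> r \<and> (\<forall>j\<in>I. g k x \<le> g j x))" if "k \<in> I" for k
  proof -
    note [measurable] = assms(2)[OF that]
    have "Measurable.pred M (\<lambda>x. g k x \<le> g j x)" if "j \<in> I" for j
    proof -
      note [measurable] = assms(2)[OF that]
      show ?thesis by measurable
    qed
    then have [measurable]: "Measurable.pred M (\<lambda>x. \<forall>j\<in>I. g k x \<le> g j x)"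
      using assms(1) by (intro pred_intros_finite)
    show ?thesis by measurable
  qed
  \<comment> \<open>The cardinality of a random set is rewritten as a finite sum of indicators,
    whose measurability is immediate.\<close>
  have eq: "win_prob r I (\<lambda>k. g k x) i
    = (if g i x \<le> r \<and> (\<forall>j\<in>I. g i x \<le> g j x)
       then 1 / (\<Sum>k\<in>I. of_bool (g k x \<le> r \<and> (\<forall>j\<in>I. g k x \<le> g j x))) else 0)" for x
  proof -
    have "(\<Sum>k\<in>I. of_bool (g k x \<le> r \<and> (\<forall>j\<in>I. g k x \<le> g j x)))
      = (\<Sum>k\<in>lowest_bidders r I (\<lambda>k. g k x). 1 :: real)"
      using assms(1) by (intro sum.mono_neutral_cong_right) (auto simp: lowest_bidders_def)
    then show ?thesis using True by (auto simp: win_prob_def lowest_bidders_def)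
  qed
  note [measurable] = low[OF True]
  have [measurable]: "(\<lambda>x. of_bool (g k x \<le> r \<and> (\<forall>j\<in>I. g k x \<le> g j x)) :: real) \<in> borel_measurable M"
    if "k \<in> I" for k
  proof -
    note [measurable] = low[OF that]
    show ?thesis by measurable
  qed
  show ?thesis unfolding eq by measurable
qed

section \<open>Analytic preliminaries\<close>

text \<open>Refine the interval into \<open>n\<close> equal steps and let \<open>n\<close> tend to infinity.\<close>

lemma le_if_decrements_le:
  fixes g h :: "real \<Rightarrow> real"
  assumes "a \<le> b" and step: "\<And>x y. a \<le> x \<Longrightarrow> x \<le> y \<Longrightarrow> y \<le> b \<Longrightarrow> g x - g y \<le> (h x - h y) * (y - x)"
  shows "g a \<le> g b"
proof -
  have bound: "g a - g b \<le> (h a - h b) * (b - a) * (1 / real (Suc n))" for n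
  proof -
    define x where "x k = a + real k * ((b - a) / real (Suc n))" for k
    have x: "x 0 = a" "x (Suc n) = b" by (simp_all add: x_def)
    have diff: "x (Suc k) - x k = (b - a) / real (Suc n)" for k
      by (simp add: x_def algebra_simps add_divide_distrib[symmetric] diff_divide_distrib[symmetric])
    have mono: "x i \<le> x j" if "i \<le> j" for i j
      unfolding x_def using that assms(1) by (intro add_left_mono mult_right_mono) auto
    have "g a - g b = (\<Sum>k<Suc n. g (x k) - g (x (Suc k)))"
      by (subst sum_lessThan_telescope') (simp only: x)
    also have "\<dots> \<le> (\<Sum>k<Suc n. (h (x k) - h (x (Suc k))) * ((b - a) / real (Suc n)))"
    proof (rule sum_mono)
      fix k assume "k \<in> {..<Suc n}"
      then have "a \<le> x k" "x k \<le> x (Suc k)" "x (Suc k) \<le> b"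
        using mono[of 0 k] mono[of k "Suc k"] mono[of "Suc k" "Suc n"] by (simp_all add: x)
      from step[OF this] show "g (x k) - g (x (Suc k)) \<le> (h (x k) - h (x (Suc k))) * ((b - a) / real (Suc n))"
        by (simp only: diff)
    qed
    also have "\<dots> = (h a - h b) * ((b - a) / real (Suc n))"
      unfolding sum_distrib_right[symmetric] by (subst sum_lessThan_telescope') (simp only: x)
    finally show ?thesis by simp
  qed
  have "(\<lambda>n. (h a - h b) * (b - a) * (1 / real (Suc n))) \<longlonglongrightarrow> (h a - h b) * (b - a) * 0"
    by (intro tendsto_mult tendsto_const LIMSEQ_Suc[OF lim_1_over_n])
  then have "g a - g b \<le> (h a - h b) * (b - a) * 0"
    by (rule LIMSEQ_le_const) (use bound in blast)
  then show ?thesis by simp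
qed

lemma integrable_if:
  assumes "Measurable.pred M E" "integrable M g" "integrable M h"
  shows "integrable M (\<lambda>x. if E x then g x else h x :: real)"
proof -
  have [measurable]: "Measurable.pred M E" "g \<in> borel_measurable M" "h \<in> borel_measurable M"
    using assms by auto
  have "integrable M (\<lambda>x. \<bar>g x\<bar> + \<bar>h x\<bar>)" using assms by auto
  then show ?thesis by (rule Bochner_Integration.integrable_bound) auto
qed

text \<open>The preimage of a box constrains the fresh draw by \<open>A i\<close> and the old
  profile only on \<open>J - {i}\<close>, so its mass is again the full product. Overwriting
  coordinate \<open>i\<close> instead of splitting it off allows conditioning on one player's type
  while keeping the index set.\<close>

lemma (in product_prob_space) distr_resample:
  assumes "finite J" "i \<in> J"
  shows "distr (M i \<Otimes>\<^sub>M PiM J M) (PiM J M) (\<lambda>(t, \<tau>). \<tau>(i := t)) = PiM J M"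
proof (rule PiM_eqI)
  have meas[measurable]: "(\<lambda>(t, \<tau>). \<tau>(i := t)) \<in> M i \<Otimes>\<^sub>M PiM J M \<rightarrow>\<^sub>M PiM J M"
    using assms measurable_add_dim[of i J M] 
    by (auto simp: insert_absorb split_beta' intro!: measurable_fun_upd[where J = J])
  interpret J: prob_space "PiM J M" by (intro prob_space_PiM M.prob_space_axioms)
  fix A assume A: "\<And>j. j \<in> J \<Longrightarrow> A j \<in> sets (M j)"
  have "(\<lambda>(t, \<tau>). \<tau>(i := t)) -` Pi\<^sub>E J A \<inter> space (M i \<Otimes>\<^sub>M PiM J M)
      = A i \<times> {\<tau> \<in> space (PiM J M). \<forall>j\<in>J - {i}. \<tau> j \<in> A j}"
    using assms(2) A[THEN sets.sets_into_space]
    by (auto simp: space_pair_measure space_PiM PiE_iff extensional_def fun_upd_def split: if_splits)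
  moreover have "{\<tau> \<in> space (PiM J M). \<forall>j\<in>J - {i}. \<tau> j \<in> A j} \<in> sets (PiM J M)"
    using assms A
    by (intro sets.sets_Collect_finite_All) (auto intro!: measurable_sets_Collect[OF measurable_component_singleton])
  moreover have "emeasure (PiM J M) {\<tau> \<in> space (PiM J M). \<forall>j\<in>J - {i}. \<tau> j \<in> A j}
      = (\<Prod>j\<in>J - {i}. emeasure (M j) (A j))"
  proof -
    interpret PJ: product_prob_space M J by standard
    show ?thesis using assms A by (intro PJ.emeasure_PiM_Collect) auto
  qed
  ultimately show "emeasure (distr (M i \<Otimes>\<^sub>M PiM J M) (PiM J M) (\<lambda>(t, \<tau>). \<tau>(i := t))) (Pi\<^sub>E J A)
      = (\<Prod>j\<in>J. emeasure (M j) (A j))"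
    using assms A by (subst emeasure_distr) (auto simp: J.emeasure_pair_measure_Times prod.remove)
qed (use assms in auto)

section \<open>Random types\<close>

locale private_values =
  fixes f :: "real \<Rightarrow> real" and N :: nat and r :: real
  assumes N2: "N \<ge> 2" and r_pos: "0 < r"
    and f_meas: "f \<in> borel_measurable borel"
    and V_prob: "prob_space (value_dist f)"
    and F0: "F f 0 = 0" and F1: "F f 1 = 1"
    and F_pos_unit: "\<And>v. v \<in> {0<..1} \<Longrightarrow> 0 < F f v"
begin

abbreviation V :: "real measure" where "V \<equiv> value_dist f"
abbreviation T :: "(real \<times> real) measure" where "T \<equiv> V \<Otimes>\<^sub>M randomizer"
abbreviation tp :: "nat \<Rightarrow> (real \<times> real) measure" where
  "tp i \<equiv> (if i < N then V else return borel 0) \<Otimes>\<^sub>M randomizer"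
abbreviation D :: "nat set \<Rightarrow> (nat \<Rightarrow> real \<times> real) measure" where "D I \<equiv> type_dist V N I"

lemma sets_V[measurable_cong, simp]: "sets V = sets borel"
  by (simp add: value_dist_def)

lemma space_V[simp]: "space V = UNIV"
  by (simp add: value_dist_def)

lemma sets_randomizer[measurable_cong, simp]: "sets randomizer = sets borel"
  by (simp add: randomizer_def)

lemma space_randomizer[simp]: "space randomizer = UNIV"
  by (simp add: randomizer_def)

sublocale V: prob_space V by (rule V_prob)
sublocale V: real_distribution V
  by (intro real_distribution.intro V_prob real_distribution_axioms.intro) simp
sublocale R: prob_space randomizer
  unfolding randomizer_def by (rule prob_space_uniform_measure) auto
sublocale T: pair_prob_space V randomizer ..

lemma prob_space_tp: "prob_space (tp i)"
proof -
  interpret A: prob_space "if i < N then V else return borel 0"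
    using V_prob by (auto intro: prob_space_return)
  interpret pair_prob_space "if i < N then V else return borel 0" randomizer ..
  show ?thesis by (rule P.prob_space_axioms)
qed

sublocale tp: product_prob_space tp UNIV
  by (simp add: product_prob_space_def product_prob_space_axioms_def product_sigma_finite_def
      prob_space_tp prob_space_imp_sigma_finite)

sublocale D: prob_space "D I" for I
  unfolding type_dist_def by (intro prob_space_PiM prob_space_tp)

lemma tp_seller: "i < N \<Longrightarrow> tp i = T"
  by simp

lemma sets_tp: "sets (tp i) = sets (borel \<Otimes>\<^sub>M borel)"
  by (intro sets_pair_measure_cong) auto

lemma sets_D[measurable_cong]: "sets (D I) = sets (PiM I (\<lambda>_. borel \<Otimes>\<^sub>M borel))"
  unfolding type_dist_def by (intro sets_PiM_cong sets_tp refl)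

text \<open>Null-set form of Fubini: a property may be checked for almost every type of player
  \<open>i\<close>, then for almost every profile of the others.\<close>

lemma AE_resample:
  assumes "finite I" "i \<in> I" and P: "Measurable.pred (D I) P"
    and AE: "AE t in tp i. AE \<tau> in D I. P (\<tau>(i := t))"
  shows "AE \<tau> in D I. P \<tau>"
proof -
  interpret pair_prob_space "tp i" "D I"
    by (simp add: pair_prob_space_def pair_sigma_finite_def prob_space_tp prob_space_imp_sigma_finite
        D.prob_space_axioms)
  note eq = tp.distr_resample[OF assms(1,2), folded type_dist_def]
  have meas[measurable]: "(\<lambda>(t, \<tau>). \<tau>(i := t)) \<in> tp i \<Otimes>\<^sub>M D I \<rightarrow>\<^sub>M D I"
    unfolding type_dist_def using assms by (auto simp: split_beta' intro!: measurable_fun_upd[where J = I])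
  have "AE z in tp i \<Otimes>\<^sub>M D I. P ((\<lambda>(t, \<tau>). \<tau>(i := t)) z)"
    using AE predE[OF measurable_compose[OF meas P]] by (intro AE_pair_measure) auto
  then have "AE \<tau> in distr (tp i \<Otimes>\<^sub>M D I) (D I) (\<lambda>(t, \<tau>). \<tau>(i := t)). P \<tau>"
    by (subst AE_distr_iff) (use P in \<open>auto simp: pred_def\<close>)
  then show ?thesis by (simp only: eq)
qed

text \<open>Conditioning on the type of player \<open>i\<close>; this is how ex ante payoffs become
  integrals of interim payoffs.\<close>

lemma integral_resample:
  fixes h :: "(nat \<Rightarrow> real \<times> real) \<Rightarrow> real"
  assumes "finite I" "i \<in> I" and h: "integrable (D I) h"
  shows "(\<integral>\<tau>. h \<tau> \<partial>D I) = (\<integral>t. (\<integral>\<tau>. h (\<tau>(i := t)) \<partial>D I) \<partial>tp i)"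
proof -
  interpret pair_prob_space "tp i" "D I"
    by (simp add: pair_prob_space_def pair_sigma_finite_def prob_space_tp prob_space_imp_sigma_finite
        D.prob_space_axioms)
  note eq = tp.distr_resample[OF assms(1,2), folded type_dist_def]
  have meas[measurable]: "(\<lambda>(t, \<tau>). \<tau>(i := t)) \<in> tp i \<Otimes>\<^sub>M D I \<rightarrow>\<^sub>M D I"
    unfolding type_dist_def using assms by (auto simp: split_beta' intro!: measurable_fun_upd[where J = I])
  have [measurable]: "h \<in> borel_measurable (D I)" using h by auto
  have "integrable (distr (tp i \<Otimes>\<^sub>M D I) (D I) (\<lambda>(t, \<tau>). \<tau>(i := t))) h"
    using h by (simp add: eq)
  then have int: "integrable (tp i \<Otimes>\<^sub>M D I) (\<lambda>z. h ((\<lambda>(t, \<tau>). \<tau>(i := t)) z))"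
    by (subst (asm) integrable_distr_eq) auto
  have "(\<integral>\<tau>. h \<tau> \<partial>D I) = (\<integral>\<tau>. h \<tau> \<partial>distr (tp i \<Otimes>\<^sub>M D I) (D I) (\<lambda>(t, \<tau>). \<tau>(i := t)))"
    by (simp only: eq)
  also have "\<dots> = (\<integral>z. h ((\<lambda>(t, \<tau>). \<tau>(i := t)) z) \<partial>(tp i \<Otimes>\<^sub>M D I))"
    by (rule integral_distr) auto
  also have "\<dots> = (\<integral>t. (\<integral>\<tau>. h (\<tau>(i := t)) \<partial>D I) \<partial>tp i)"
    using int by (subst integral_fst'[symmetric]) auto
  finally show ?thesis .
qed

lemma prob_sellers:
  assumes "A \<subseteq> I" "A \<subseteq> {..<N}" "\<And>j. j \<in> A \<Longrightarrow> B j \<in> sets T"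
  shows "measure (D I) {\<tau> \<in> space (D I). \<forall>j\<in>A. \<tau> j \<in> B j} = (\<Prod>j\<in>A. measure T (B j))"
proof -
  interpret PI: product_prob_space tp I by standard
  have "finite A" using assms(2) finite_subset by blast
  then have "emeasure (D I) {\<tau> \<in> space (D I). \<forall>j\<in>A. \<tau> j \<in> B j} = (\<Prod>j\<in>A. emeasure (tp j) (B j))"
    unfolding type_dist_def using assms by (intro PI.emeasure_PiM_Collect) (auto split: if_splits)
  also have "\<dots> = (\<Prod>j\<in>A. ennreal (measure T (B j)))"
    using assms(2) by (intro prod.cong refl) (auto simp: T.P.emeasure_eq_measure)
  finally show ?thesis
    by (simp add: D.emeasure_eq_measure prod_ennreal measure_nonneg prod_nonneg)
qed

lemma AE_seller:
  assumes "i < N" "i \<in> I" "AE t in T. P t"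
  shows "AE \<tau> in D I. P (\<tau> i)"
  unfolding type_dist_def using assms by (intro AE_PiM_component prob_space_tp) auto

lemma AE_value: 
  assumes "AE v in V. P v"
  shows "AE t in T. P (fst t)"
proof -
  have "distr T V fst = V" by (simp add: T.P.prob_space_axioms R.distr_pair_fst R.emeasure_space_1)
  then have "AE v in distr T V fst. P v" using assms by metis
  then show ?thesis by (rule AE_distrD[rotated]) simp
qed

lemma prob_value:
  assumes "B \<in> sets borel"
  shows "measure T {t. fst t \<in> B} = measure V B"
proof -
  have eq: "{t. fst t \<in> B} = B \<times> UNIV" by auto
  have "emeasure T {t. fst t \<in> B} = emeasure V B * emeasure randomizer UNIV"
    unfolding eq using assms by (intro R.emeasure_pair_measure_Times) auto
  then show ?thesis using R.emeasure_space_1 by (simp add: measure_def)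
qed

subsection \<open>The value distribution\<close>

lemma V_singleton: "measure V {x} = 0"
proof -
  have "{x} \<in> null_sets V"
  proof -
    have "AE y in lborel. y \<in> {x} \<longrightarrow> ennreal (f y) = 0"
      using AE_lborel_singleton[of x] by eventually_elim simp
    then show ?thesis
      unfolding value_dist_def using f_meas by (subst null_sets_density_iff) auto
  qed
  then show ?thesis by (simp add: measure_eq_0_null_sets)
qed

lemma AE_V_neq: "AE v in V. v \<noteq> x"
  using V_singleton[of x] by (subst AE_iff_measurable[of "{x}"]) (auto simp: V.emeasure_eq_measure)

lemma F_isCont: "isCont (F f) x"
  by (simp add: V.isCont_cdf V_singleton)

lemma F_cont: "continuous_on A (F f)"
  using F_isCont continuous_at_imp_continuous_on by blast

lemma F_mono: "x \<le> y \<Longrightarrow> F f x \<le> F f y"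
  by (rule V.cdf_nondecreasing)

lemma F_nonneg[simp]: "0 \<le> F f x"
  by (rule V.cdf_nonneg)

lemma F_le_1[simp]: "F f x \<le> 1"
  by (rule V.cdf_bounded_prob)

lemma F_pos: "0 < v \<Longrightarrow> 0 < F f v"
  using F_pos_unit[of v] F1 F_mono[of 1 v] by (cases "v \<le> 1") auto

lemma F_measurable[measurable]: "F f \<in> borel_measurable borel"
  by (intro borel_measurable_continuous_onI F_cont)

lemma prob_le: "measure V {..x} = F f x"
  by (simp add: cdf_def)

lemma prob_less: "measure V {..<x} = F f x"
proof -
  have "{..x} = {..<x} \<union> {x}" by auto
  then have "measure V {..x} = measure V {..<x} + measure V {x}"
    by (metis V.finite_measure_Union[of "{..<x}" "{x}"] borel_closed closed_singleton disjoint_insert(1) 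
       inf_bot_right lessThan_borel lessThan_iff less_irrefl sets_V)
  then show ?thesis by (simp add: V_singleton prob_le)
qed

lemma prob_greater: "measure V {x<..} = 1 - F f x"
proof -
  have "{x<..} = space V - {..x}" by auto
  then show ?thesis by (metis V.prob_compl atMost_borel prob_le sets_V)
qed

lemma prob_ge: "measure V {x..} = 1 - F f x"
proof -
  have "{x..} = space V - {..<x}" by auto
  then show ?thesis by (metis V.prob_compl lessThan_borel prob_less sets_V)
qed

lemma AE_V_pos: "AE v in V. 0 < v"
  using prob_le[of 0] F0 by (subst AE_iff_measurable[of "{..0}"]) (auto simp: V.emeasure_eq_measure)

lemma AE_V_le_1: "AE v in V. v \<le> 1"
  using prob_greater[of 1] F1 by (subst AE_iff_measurable[of "{1<..}"]) (auto simp: V.emeasure_eq_measure)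

text \<open>F may reach 1 inside the support interval. By continuity the set where it equals 1 is
  closed, so it contains its infimum, and the mass from there upwards is
  \<open>1 - F f (Inf S)\<close>, which is zero.\<close>

lemma AE_V_F_less_1: "AE v in V. F f v < 1"
proof -
  define S where "S = {v. 1 \<le> F f v}"
  have "closed S" unfolding S_def by (intro closed_Collect_le F_cont continuous_on_const)
  moreover have "1 \<in> S" using F1 by (simp add: S_def)
  moreover have lb: "0 \<le> v" if "v \<in> S" for v
    using that F_mono[of v 0] F0 by (cases "0 \<le> v") (auto simp: S_def)
  ultimately have inf: "Inf S \<in> S"
    by (intro closed_contains_Inf) (auto intro!: bdd_belowI)
  then have "measure V {Inf S..} = 0"
    unfolding prob_ge S_def by (simp add: antisym)
  then have "AE v in V. v \<notin> {Inf S..}"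
    by (subst AE_iff_measurable[of "{Inf S..}"]) (auto simp: V.emeasure_eq_measure)
  then show ?thesis
  proof eventually_elim
    case (elim v)
    have "v \<notin> S"
      using elim lb by (auto intro!: cInf_lower bdd_belowI)
    then show ?case by (simp add: S_def)
  qed
qed

section \<open>The rent function and expected gains\<close>

abbreviation vals :: "(nat \<Rightarrow> real \<times> real) \<Rightarrow> nat \<Rightarrow> real" where
  "vals \<tau> \<equiv> \<lambda>j. fst (\<tau> j)"

definition rent :: "real \<Rightarrow> real" where
  "rent v = integral {v..r} (\<lambda>x. (1 - F f x) ^ (N - 1))"

lemma q_antimono: "x \<le> y \<Longrightarrow> (1 - F f y) ^ n \<le> (1 - F f x) ^ n"
  by (intro power_mono) (auto intro: F_mono)

lemma q_le_1: "(1 - F f y) ^ n \<le> 1"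
  by (intro power_le_one) auto

lemma q_cont: "continuous_on A (\<lambda>x. (1 - F f x) ^ n)"
  by (intro continuous_intros F_cont)

lemma q_integrable: "(\<lambda>x. (1 - F f x) ^ n) integrable_on {a..b}"
  by (intro integrable_continuous_interval q_cont)

lemma rent_above: "r \<le> v \<Longrightarrow> rent v = 0"
  unfolding rent_def by (cases "r = v") auto

lemma rent_nonneg: "0 \<le> rent v"
  unfolding rent_def by (intro integral_nonneg q_integrable) simp

text \<open>The integrand is decreasing, so its values at the endpoints bound the integral. The
  upper bound makes \<open>v + rent v\<close> increasing; the lower one enters the envelope
  comparison with \<open>U\<close>.\<close>

lemma rent_diff:
  assumes "a \<le> b" "b \<le> r"
  shows "rent a - rent b \<le> (1 - F f a) ^ (N - 1) * (b - a)"
    and "(1 - F f b) ^ (N - 1) * (b - a) \<le> rent a - rent b"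
proof -
  have eq: "rent a - rent b = integral {a..b} (\<lambda>x. (1 - F f x) ^ (N - 1))"
    unfolding rent_def using Henstock_Kurzweil_Integration.integral_combine[OF assms q_integrable, of "N - 1"] by simp
  have "integral {a..b} (\<lambda>x. (1 - F f x) ^ (N - 1)) \<le> integral {a..b} (\<lambda>x. (1 - F f a) ^ (N - 1))"
    by (intro integral_le q_integrable q_antimono) auto
  then show "rent a - rent b \<le> (1 - F f a) ^ (N - 1) * (b - a)"
    using assms by (simp add: eq mult.commute)
  have "integral {a..b} (\<lambda>x. (1 - F f b) ^ (N - 1)) \<le> integral {a..b} (\<lambda>x. (1 - F f x) ^ (N - 1))"
    by (intro integral_le q_integrable q_antimono) auto
  then show "(1 - F f b) ^ (N - 1) * (b - a) \<le> rent a - rent b"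
    using assms by (simp add: eq mult.commute)
qed

lemma rent_le:
  assumes "v \<le> r" shows "rent v \<le> r - v"
proof -
  have "rent v \<le> (1 - F f v) ^ (N - 1) * (r - v)"
    using rent_diff(1)[of v r] assms by (simp add: rent_above)
  also have "\<dots> \<le> 1 * (r - v)"
    using assms by (intro mult_right_mono q_le_1) auto
  finally show ?thesis by simp
qed

lemma q_less_1: "0 < v \<Longrightarrow> (1 - F f v) ^ (N - 1) < 1"
proof -
  assume "0 < v"
  have "(1 - F f v) ^ (N - 1) \<le> (1 - F f v) ^ 1"
    using N2 by (intro power_decreasing) auto
  also have "\<dots> < 1" using F_pos[OF \<open>0 < v\<close>] by simp
  finally show ?thesis .
qed

lemma rent_strict_pos:
  assumes "0 < a" "a < b" "b \<le> r"
  shows "a + rent a < b + rent b"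
proof -
  have "rent a - rent b \<le> (1 - F f a) ^ (N - 1) * (b - a)"
    using rent_diff(1)[of a b] assms by simp
  also have "\<dots> < 1 * (b - a)"
    using assms q_less_1[of a] by (intro mult_strict_right_mono) auto
  finally show ?thesis by simp
qed

text \<open>Since \<open>v + rent v\<close> is the offer that makes a seller of value
  \<open>v\<close> indifferent, strictness gives uniqueness of the cutoff induced by an offer and a
  strict preference for acceptance below it.\<close>

lemma rent_strict:
  assumes "0 \<le> a" "a < b" "b \<le> r"
  shows "a + rent a < b + rent b"
proof -
  \<comment> \<open>At \<open>a = 0\<close> the slope bound equals 1 and yields no strict
    inequality; strictness is gained on the stretch from the interior point \<open>m\<close> to
    \<open>b\<close>.\<close>
  obtain m where m: "a < m" "m < b" using dense assms by blast
  have "rent a - rent m \<le> (1 - F f a) ^ (N - 1) * (m - a)"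
    using rent_diff(1)[of a m] m assms by simp
  also have "\<dots> \<le> 1 * (m - a)"
    using m assms q_le_1[of a] by (intro mult_right_mono) auto
  finally have "a + rent a \<le> m + rent m" by simp
  also have "\<dots> < b + rent b"
    using m assms by (intro rent_strict_pos) auto
  finally show ?thesis .
qed

lemma rent_cont: "continuous_on {0..r} rent"
  unfolding rent_def by (intro indefinite_integral_continuous_1' q_integrable)

lemma rent_measurable[measurable]: "rent \<in> borel_measurable borel"
proof -
  have "mono (\<lambda>v. - rent v)"
  proof
    fix x y :: real assume "x \<le> y"
    show "- rent x \<le> - rent y"
    proof (cases "y \<le> r")
      case True
      have "0 \<le> (1 - F f y) ^ (N - 1) * (y - x)" using \<open>x \<le> y\<close> by simp
      also have "\<dots> \<le> rent x - rent y" using \<open>x \<le> y\<close> True by (rule rent_diff(2))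
      finally show ?thesis by simp
    qed (simp add: rent_above rent_nonneg)
  qed
  then have "(\<lambda>v. - (- rent v)) \<in> borel_measurable borel"
    by (intro borel_measurable_uminus borel_measurable_mono)
  then show ?thesis by simp
qed

lemma measurable_Min_insert:
  fixes g :: "'i \<Rightarrow> 'c \<Rightarrow> real"
  assumes "finite A" "\<And>i. i \<in> A \<Longrightarrow> g i \<in> borel_measurable M"
  shows "(\<lambda>x. Min (insert c ((\<lambda>i. g i x) ` A))) \<in> borel_measurable M"
  using assms
proof (induction A)
  case (insert a A)
  have eq: "Min (insert c (insert (g a x) ((\<lambda>i. g i x) ` A))) = min (g a x) (Min (insert c ((\<lambda>i. g i x) ` A)))" for x
    using insert.hyps by (subst insert_commute, subst Min_insert) auto
  show ?case using insert by (simp add: eq del: Min_insert)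
qed simp

lemma value_measurable[measurable]:
  assumes "i \<in> I" shows "(\<lambda>\<tau>. fst (\<tau> i)) \<in> borel_measurable (D I)"
proof -
  have "(\<lambda>\<tau>. \<tau> i) \<in> D I \<rightarrow>\<^sub>M (borel \<Otimes>\<^sub>M borel)"
    using assms by (subst measurable_cong_sets[OF sets_D refl]) simp
  then show ?thesis by measurable
qed

lemma gain_measurable:
  assumes "{..<N} \<subseteq> I" "i < N"
  shows "(\<lambda>\<tau>. gain N r (vals \<tau>) i) \<in> borel_measurable (D I)"
  unfolding gain_def using assms
  by (intro borel_measurable_max borel_measurable_diff measurable_Min_insert value_measurable) auto

lemma gain_upd_measurable:
  assumes "{..<N} \<subseteq> I"
  shows "(\<lambda>\<tau>. gain N r ((vals \<tau>)(i := v)) i) \<in> borel_measurable (D I)"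
  unfolding gain_def fun_upd_def using assms
  by (intro borel_measurable_max borel_measurable_diff measurable_Min_insert) auto

lemma prob_values_greater:
  assumes "A \<subseteq> I" "A \<subseteq> {..<N}"
  shows "measure (D I) {\<tau> \<in> space (D I). \<forall>j\<in>A. x < vals \<tau> j} = (1 - F f x) ^ card A"
proof -
  have "Measurable.pred T (\<lambda>t. x < fst t)" by measurable
  then have B: "{t. x < fst t} \<in> sets T" by (simp add: pred_def space_pair_measure)
  have m: "measure T {t. x < fst t} = 1 - F f x"
    using prob_value[of "{x<..}"] by (simp add: prob_greater)
  show ?thesis
    using prob_sellers[OF assms, of "\<lambda>_. {t. x < fst t}"] B by (simp add: m)
qed

text \<open>Layer-cake formula: the gain is the length of the set of prices between the value and the
  reserve that undercut all competitors.\<close>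

lemma integral_gain:
  assumes I: "finite I" "{..<N} \<subseteq> I" and i: "i < N"
  shows "(\<integral>\<tau>. gain N r ((vals \<tau>)(i := v)) i \<partial>D I) = rent v"
proof (cases "v \<le> r")
  case False
  then show ?thesis by (simp add: gain_eq_0_reserve rent_above)
next
  case True
  let ?O = "{..<N} - {i}"
  interpret L: pair_sigma_finite "D I" lborel ..
  define S where "S = (\<lambda>(\<tau>, x). v \<le> x \<and> x < r \<and> (\<forall>j\<in>?O. x < vals \<tau> j))"
  have [measurable]: "Measurable.pred (D I \<Otimes>\<^sub>M lborel) S"
    unfolding S_def split_beta'
    using I(2) by (intro pred_intros_logic pred_intros_finite borel_measurable_pred_less) 
      (auto intro!: measurable_compose[OF measurable_fst value_measurable])
  have g: "ennreal (gain N r ((vals \<tau>)(i := v)) i) = (\<integral>\<^sup>+x. indicator (Collect S) (\<tau>, x) \<partial>lborel)" for \<tau>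
  proof -
    let ?m = "Min (insert r (vals \<tau> ` ?O))"
    have eq: "gain N r ((vals \<tau>)(i := v)) i = max 0 (?m - v)"
      by (simp add: gain_def)
    have "{x. S (\<tau>, x)} = {v..<?m}" by (auto simp: S_def)
    moreover have "indicator (Collect S) (\<tau>, x) = (indicator {x. S (\<tau>, x)} x :: ennreal)" for x
      by (simp add: indicator_def)
    ultimately have "(\<integral>\<^sup>+x. indicator (Collect S) (\<tau>, x) \<partial>lborel) = (\<integral>\<^sup>+x. indicator {v..<?m} x \<partial>lborel)"
      by (simp only:)
    also have "(\<integral>\<^sup>+x. indicator {v..<m} x \<partial>lborel) = ennreal (max 0 (m - v))" for m :: real
      by (cases "v \<le> m") (auto simp: max_def)
    finally show ?thesis unfolding eq by simp
  qed
  \<comment> \<open>\<open>S\<close> excludes the endpoint \<open>r\<close>, whereas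
    \<open>rent\<close> integrates over a closed interval; the single point is discarded as a null
    set.\<close>
  have P: "(\<integral>\<^sup>+\<tau>. indicator (Collect S) (\<tau>, x) \<partial>D I) = indicator {v..r} x * ennreal ((1 - F f x) ^ (N - 1))"
    if "x \<noteq> r" for x
  proof (cases "v \<le> x \<and> x < r")
    case True
    let ?B = "{\<tau> \<in> space (D I). \<forall>j\<in>?O. x < vals \<tau> j}"
    have B: "?B \<in> sets (D I)"
      using I by (intro sets.sets_Collect_finite_All) auto
    have "(\<integral>\<^sup>+\<tau>. indicator (Collect S) (\<tau>, x) \<partial>D I) = (\<integral>\<^sup>+\<tau>. indicator ?B \<tau> \<partial>D I)"
      using True by (intro nn_integral_cong) (auto simp: S_def indicator_def)
    also have "\<dots> = ennreal (measure (D I) ?B)" using B by (simp add: D.emeasure_eq_measure)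
    also have "\<dots> = ennreal ((1 - F f x) ^ (N - 1))"
      using I i by (subst prob_values_greater) auto
    finally show ?thesis using True by simp
  next
    case False
    then have "(\<integral>\<^sup>+\<tau>. indicator (Collect S) (\<tau>, x) \<partial>D I) = 0"
      by (auto simp: S_def indicator_def)
    then show ?thesis using False that by (auto simp: indicator_def)
  qed
  have "(\<integral>\<^sup>+\<tau>. ennreal (gain N r ((vals \<tau>)(i := v)) i) \<partial>D I)
      = (\<integral>\<^sup>+x. (\<integral>\<^sup>+\<tau>. indicator (Collect S) (\<tau>, x) \<partial>D I) \<partial>lborel)"
    unfolding g by (rule L.Fubini'[symmetric]) (simp add: split_beta')
  also have "\<dots> = (\<integral>\<^sup>+x. ennreal (indicator {v..r} x * (1 - F f x) ^ (N - 1)) \<partial>lborel)"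
    using AE_lborel_singleton[of r]
  proof (intro nn_integral_cong_AE, eventually_elim)
    case (elim x)
    show ?case unfolding P[OF elim(2)] by (simp add: indicator_def)
  qed
  also have "\<dots> = ennreal (rent v)"
    unfolding rent_def by (intro nn_integral_has_integral_lebesgue integrable_integral q_integrable) auto
  finally have "(\<integral>\<^sup>+\<tau>. ennreal (gain N r ((vals \<tau>)(i := v)) i) \<partial>D I) = ennreal (rent v)" .
  then show ?thesis
    using gain_upd_measurable[OF I(2), of i v] by (subst integral_eq_nn_integral) (auto simp: gain_nonneg rent_nonneg)
qed

lemma AE_values:
  assumes "finite I" "{..<N} \<subseteq> I" "AE v in V. Q v"
  shows "AE \<tau> in D I. \<forall>i<N. Q (vals \<tau> i)"
proof -
  have "AE \<tau> in D I. \<forall>i\<in>{..<N}. Q (vals \<tau> i)"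
    using assms AE_value[OF assms(3)] by (intro eventually_ball_finite) (auto intro!: AE_seller)
  then show ?thesis by (rule eventually_mono) auto
qed

lemma AE_bounds:
  assumes "finite I" "{..<N} \<subseteq> I"
  shows "AE \<tau> in D I. \<forall>i<N. 0 < vals \<tau> i \<and> vals \<tau> i \<le> 1"
  using AE_V_pos AE_V_le_1 by (intro AE_values assms) auto

lemma gain_le:
  assumes "0 \<le> x i" shows "gain N r x i \<le> r"
proof -
  have "Min (insert r (x ` ({..<N} - {i}))) \<le> r" by (intro Min_le) auto
  then show ?thesis using assms r_pos unfolding gain_def by linarith
qed

lemma gain_integrable:
  assumes "finite I" "{..<N} \<subseteq> I" "i < N"
  shows "integrable (D I) (\<lambda>\<tau>. gain N r (vals \<tau>) i)"
proof (rule D.integrable_const_bound)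
  show "AE \<tau> in D I. norm (gain N r (vals \<tau>) i) \<le> r"
    using AE_bounds[OF assms(1,2)]
  proof eventually_elim
    case (elim \<tau>)
    then have "0 \<le> vals \<tau> i" using assms(3) by (simp add: less_imp_le)
    then show ?case using gain_le[of "vals \<tau>" i] by (simp add: gain_nonneg)
  qed
qed (use assms in \<open>auto intro: gain_measurable\<close>)

lemma integral_gain_type:
  assumes "finite I" "{..<N} \<subseteq> I" "i < N"
  shows "(\<integral>\<tau>. gain N r (vals \<tau>) i \<partial>D I) = (\<integral>t. rent (fst t) \<partial>T)"
proof -
  have eq: "(\<lambda>j. fst (if j = i then t else \<tau> j)) = (vals \<tau>)(i := fst t)" for \<tau> and t :: "real \<times> real" by auto
  show ?thesis
    using assms by (subst integral_resample[of I i]) (auto simp: gain_integrable eq integral_gain)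
qed

lemma value_pred_measurable[measurable]:
  assumes "i \<in> I" shows "Measurable.pred (D I) (\<lambda>\<tau>. vals \<tau> i < c)"
  using assms by measurable

lemma accept_measurable:
  "Measurable.pred (D {..N}) (\<lambda>\<tau>. \<exists>a<N. vals \<tau> a < c)"
proof -
  have "Measurable.pred (D {..N}) (\<lambda>\<tau>. \<exists>a\<in>{..<N}. vals \<tau> a < c)"
    by (intro pred_intros_finite value_pred_measurable) auto
  then show ?thesis by (simp add: Bex_def)
qed

lemma rejecting_measurable:
  assumes "{..<N} \<subseteq> I"
  shows "(\<lambda>\<tau>. {i. i < N \<and> \<not> vals \<tau> i < c}) \<in> D I \<rightarrow>\<^sub>M count_space (Pow {..<N})"
  unfolding measurable_count_space_eq2[OF finite_Pow_iff[THEN iffD2, OF finite_lessThan]]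
proof (intro conjI ballI)
  fix R assume R: "R \<in> Pow {..<N}"
  have "(\<lambda>\<tau>. {i. i < N \<and> \<not> vals \<tau> i < c}) -` {R} \<inter> space (D I)
    = {\<tau> \<in> space (D I). \<forall>i\<in>{..<N}. (i \<in> R) = (\<not> vals \<tau> i < c)}"
    using R by auto
  also have "\<dots> \<in> sets (D I)"
  proof (intro sets.sets_Collect_finite_All)
    fix i assume "i \<in> {..<N}"
    then have "i \<in> I" using assms by auto
    then have [measurable]: "Measurable.pred (D I) (\<lambda>\<tau>. vals \<tau> i < c)" by (rule value_pred_measurable)
    show "{\<tau> \<in> space (D I). (i \<in> R) = (\<not> vals \<tau> i < c)} \<in> sets (D I)"
      by (cases "i \<in> R") simp_all
  qed simp
  finally show "(\<lambda>\<tau>. {i. i < N \<and> \<not> vals \<tau> i < c}) -` {R} \<inter> space (D I) \<in> sets (D I)" .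
qed auto

text \<open>The rejecting set takes finitely many values, so measurability may be checked for each
  fixed set separately.\<close>

lemma rejecting_compose_measurable:
  assumes "{..<N} \<subseteq> I" "\<And>R. R \<subseteq> {..<N} \<Longrightarrow> (\<lambda>\<tau>. h R \<tau>) \<in> borel_measurable (D I)"
  shows "(\<lambda>\<tau>. h {i. i < N \<and> \<not> vals \<tau> i < c} \<tau> :: real) \<in> borel_measurable (D I)"
proof (rule measurable_compose_countable'[where f = h, OF _ rejecting_measurable[OF assms(1)]])
  show "countable (Pow {..<N})" by (rule countable_finite) simp
qed (use assms(2) in simp)

abbreviation lowest_rejecting :: "real \<Rightarrow> (nat \<Rightarrow> real) \<Rightarrow> real" where
  "lowest_rejecting c x \<equiv> Min (insert r (x ` {i. i < N \<and> \<not> x i < c}))"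

lemma lowest_rejecting_measurable:
  assumes "{..<N} \<subseteq> I"
  shows "(\<lambda>\<tau>. lowest_rejecting c (vals \<tau>)) \<in> borel_measurable (D I)"
proof (rule rejecting_compose_measurable[OF assms])
  fix R assume "R \<subseteq> {..<N}"
  show "(\<lambda>\<tau>. Min (insert r (vals \<tau> ` R))) \<in> borel_measurable (D I)"
  proof (rule measurable_Min_insert)
    show "finite R" by (rule finite_subset[OF \<open>R \<subseteq> _\<close> finite_lessThan])
    fix i assume "i \<in> R"
    then have "i \<in> I" using assms \<open>R \<subseteq> _\<close> by blast
    then show "(\<lambda>\<tau>. vals \<tau> i) \<in> borel_measurable (D I)" by (rule value_measurable)
  qed
qed

lemma lowest_rejecting_bounds:
  assumes "\<And>i. i < N \<Longrightarrow> 0 < x i"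
  shows "0 \<le> lowest_rejecting c x" "lowest_rejecting c x \<le> r"
proof -
  show "0 \<le> lowest_rejecting c x"
    using assms r_pos by (intro Min.boundedI) (auto intro: less_imp_le)
  show "lowest_rejecting c x \<le> r" by (intro Min_le) auto
qed

lemma lowest_rejecting_integrable:
  assumes "finite I" "{..<N} \<subseteq> I"
  shows "integrable (D I) (\<lambda>\<tau>. lowest_rejecting c (vals \<tau>))"
proof (rule D.integrable_const_bound)
  show "AE \<tau> in D I. norm (lowest_rejecting c (vals \<tau>)) \<le> r"
    using AE_bounds[OF assms]
  proof eventually_elim
    case (elim \<tau>)
    then have "0 < vals \<tau> i" if "i < N" for i using that by simp
    from lowest_rejecting_bounds[of "vals \<tau>", OF this] show ?case by (simp only: real_norm_def abs_of_nonneg)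
  qed
qed (rule lowest_rejecting_measurable[OF assms(2)])

lemma lowest_value_measurable:
  assumes "{..<N} \<subseteq> I"
  shows "(\<lambda>\<tau>. Min (vals \<tau> ` {..<N})) \<in> borel_measurable (D I)"
  using assms by (intro borel_measurable_Min) (auto intro!: value_measurable)

lemma lowest_value_bounds:
  assumes "\<And>i. i < N \<Longrightarrow> 0 < x i \<and> x i \<le> 1"
  shows "0 < Min (x ` {..<N})" "Min (x ` {..<N}) \<le> 1"
proof -
  have "Min (x ` {..<N}) \<in> x ` {..<N}" using N2 by (intro Min_in) (auto simp: lessThan_empty_iff)
  then show "0 < Min (x ` {..<N})" "Min (x ` {..<N}) \<le> 1" using assms by auto
qed

lemma N_pos: "0 < N"
  using N2 by simp

subsection \<open>The speculator in the second-price auction\<close>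

abbreviation truthful_speculator_payoff where
  "truthful_speculator_payoff c p \<equiv> speculator_payoff f N r (truthful_play c p)"

lemma AE_bounds_all: "AE \<tau> in D {..N}. \<forall>i<N. 0 < vals \<tau> i \<and> vals \<tau> i \<le> 1"
  by (intro AE_bounds) auto

lemma speculator_payoff_0:
  assumes "cutoff P = 0"
  shows "speculator_payoff f N r P = 0"
proof -
  have "AE \<tau> in D {..N}. wins N r P \<tau> N * price N r P \<tau> N
      - real (N - card (rejecting N P \<tau>)) * offer P = 0"
    using AE_bounds_all
  proof eventually_elim
    case (elim \<tau>)
    then have "rejecting N P \<tau> = {..<N}"
      using assms by (intro rejecting_all) (auto intro: less_imp_le)
    then show ?case by (simp add: wins_def bidders_all win_prob_outside)
  qed
  then show ?thesis unfolding speculator_payoff_def by (rule integral_eq_zero_AE)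
qed

text \<open>The random cost \<open>c + gain N r (x(i := c)) i\<close> stands in for the offer, whose
  value it has on average. A single acceptor then costs exactly what his item earns. With two or
  more acceptors every gain vanishes and the total cost is at most \<open>N * c\<close>, which is
  charged to the ordered pairs of accepting sellers, while the revenue is at least \<open>d\<close>
  whenever all rejecting values are.\<close>

lemma speculator_pointwise:
  fixes c d :: real
  assumes c: "0 < c" "c < d" "d \<le> r"
  shows "d * of_bool (x 0 < c \<and> x 1 < c \<and> (\<forall>j\<in>{2..<N}. d \<le> x j))
      - N * c * (\<Sum>i<N. \<Sum>j\<in>{..<N} - {i}. of_bool (x i < c \<and> x j < c))
    \<le> (if \<exists>a<N. x a < c then lowest_rejecting c x - (\<Sum>i<N. of_bool (x i < c) * (c + gain N r (x(i := c)) i))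
       else 0)"
proof -
  let ?B = "of_bool (x 0 < c \<and> x 1 < c \<and> (\<forall>j\<in>{2..<N}. d \<le> x j)) :: real"
  let ?P = "\<Sum>i<N. \<Sum>j\<in>{..<N} - {i}. of_bool (x i < c \<and> x j < c) :: real"
  let ?\<Psi> = "if \<exists>a<N. x a < c then lowest_rejecting c x - (\<Sum>i<N. of_bool (x i < c) * (c + gain N r (x(i := c)) i)) else 0"
  have P0: "0 \<le> ?P" by (intro sum_nonneg) auto
  have NcP: "0 \<le> N * c * ?P" using P0 c by simp
  consider "\<forall>a<N. \<not> x a < c" | a where "a < N" "x a < c" "\<And>b. b < N \<Longrightarrow> x b < c \<Longrightarrow> b = a"
    | a b where "a < N" "x a < c" "b < N" "x b < c" "a \<noteq> b" by blast
  then show ?thesis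
  proof cases
    case 1
    then have B: "?B = 0" using N2 by auto
    have \<Psi>: "?\<Psi> = 0" using 1 by auto
    show ?thesis unfolding B \<Psi> using NcP by linarith
  next
    case (2 a)
    have B: "?B = 0" using 2(3)[of 0] 2(3)[of 1] N2 by auto
    have S: "{i. i < N \<and> \<not> x i < c} = {..<N} - {a}"
      unfolding set_eq_iff mem_Collect_eq Diff_iff lessThan_iff singleton_iff using 2 by metis
    have "c \<le> lowest_rejecting c x" using c by (intro Min.boundedI) auto
    \<comment> \<open>The rejecting sellers are exactly the competitors of \<open>a\<close>, so his
      cost coincides with the speculator's revenue.\<close>
    then have g: "gain N r (x(a := c)) a = lowest_rejecting c x - c"
      unfolding S by (simp add: gain_def)
    have "(\<Sum>i<N. of_bool (x i < c) * (c + gain N r (x(i := c)) i))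
      = (\<Sum>i\<in>{a}. of_bool (x i < c) * (c + gain N r (x(i := c)) i))"
    proof (intro sum.mono_neutral_right ballI)
      fix i assume "i \<in> {..<N} - {a}"
      then have "\<not> x i < c" using 2(3)[of i] by blast
      then show "of_bool (x i < c) * (c + gain N r (x(i := c)) i) = 0" by simp
    qed (use \<open>a < N\<close> in simp_all)
    also have "\<dots> = lowest_rejecting c x" using 2(2) g by simp
    finally have \<Psi>: "?\<Psi> = 0" by simp
    show ?thesis unfolding B \<Psi> using NcP by linarith
  next
    case (3 a b)
    \<comment> \<open>Another accepting seller has a value below \<open>c\<close>, so
      \<open>i\<close> would not win with value \<open>c\<close>.\<close>
    have z: "gain N r (x(i := c)) i = 0" if "i < N" "x i < c" for i
    proof -
      obtain k where "k < N" "k \<noteq> i" "x k < c" using 3 by metis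
      then show ?thesis by (intro gain_eq_0[of k]) auto
    qed
    have "(\<Sum>i<N. of_bool (x i < c) * (c + gain N r (x(i := c)) i)) \<le> (\<Sum>i<N. c)"
      using c by (intro sum_mono) (auto simp: z)
    \<comment> \<open>The ordered pair of \<open>a\<close> and \<open>b\<close> alone already
      contributes 1 to \<open>?P\<close>.\<close>
    also have "\<dots> \<le> N * c * ?P"
    proof -
      have "1 \<le> (\<Sum>j\<in>{..<N} - {a}. of_bool (x a < c \<and> x j < c) :: real)"
        using 3 member_le_sum[of b "{..<N} - {a}" "\<lambda>j. of_bool (x a < c \<and> x j < c) :: real"] by auto
      also have "\<dots> \<le> ?P"
        using 3 member_le_sum[of a "{..<N}" "\<lambda>i. \<Sum>j\<in>{..<N} - {i}. of_bool (x i < c \<and> x j < c) :: real"]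
        by (auto intro: sum_nonneg)
      finally have "1 \<le> ?P" .
      then have "N * c * 1 \<le> N * c * ?P" using c by (intro mult_left_mono) auto
      then show ?thesis by simp
    qed
    moreover have "d * ?B \<le> lowest_rejecting c x"
    proof (cases "x 0 < c \<and> x 1 < c \<and> (\<forall>j\<in>{2..<N}. d \<le> x j)")
      case True
      have "d \<le> x i" if "i < N" "\<not> x i < c" for i
      proof -
        have "i \<noteq> 0" "i \<noteq> 1" using that(2) True by metis+
        then show ?thesis using True that by auto
      qed
      then have "d \<le> lowest_rejecting c x" using c by (intro Min.boundedI) auto
      moreover have "?B = 1" unfolding of_bool_def using True by (rule if_P)
      ultimately show ?thesis by (simp only: mult_1_right)
    next
      case False
      have "0 \<le> lowest_rejecting c x" using c by (intro Min.boundedI) auto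
      moreover have "?B = 0" unfolding of_bool_def using False by (rule if_not_P)
      ultimately show ?thesis by (simp only: mult_zero_right)
    qed
    moreover have "?\<Psi> = lowest_rejecting c x - (\<Sum>i<N. of_bool (x i < c) * (c + gain N r (x(i := c)) i))"
      using 3 by auto
    ultimately show ?thesis by linarith
  qed
qed

lemma prob_pair:
  assumes "i < N" "j < N" "i \<noteq> j"
  shows "(\<integral>\<tau>. of_bool (vals \<tau> i < c \<and> vals \<tau> j < c) \<partial>D {..N}) = (F f c)\<^sup>2"
proof -
  have "Measurable.pred T (\<lambda>t. fst t < c)" by measurable
  then have B: "{t. fst t < c} \<in> sets T" by (simp add: pred_def space_pair_measure)
  have m: "measure T {t. fst t < c} = F f c"
    using prob_value[of "{..<c}"] by (simp add: prob_less)
  have eq: "of_bool (vals \<tau> i < c \<and> vals \<tau> j < c)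
      = (indicator {\<tau> \<in> space (D {..N}). \<forall>k\<in>{i, j}. \<tau> k \<in> {t. fst t < c}} \<tau> :: real)"
    if "\<tau> \<in> space (D {..N})" for \<tau>
    using that by (auto simp: indicator_def)
  have "(\<integral>\<tau>. of_bool (vals \<tau> i < c \<and> vals \<tau> j < c) \<partial>D {..N})
    = measure (D {..N}) {\<tau> \<in> space (D {..N}). \<forall>k\<in>{i, j}. \<tau> k \<in> {t. fst t < c}}"
    by (subst Bochner_Integration.integral_cong[OF refl eq]) (auto intro!: arg_cong[where f = "measure (D {..N})"])
  also have "\<dots> = (F f c)\<^sup>2"
    using assms B by (subst prob_sellers) (auto simp: m power2_eq_square)
  finally show ?thesis .
qed

lemma prob_low_two:
  shows "(\<integral>\<tau>. of_bool (vals \<tau> 0 < c \<and> vals \<tau> 1 < c \<and> (\<forall>j\<in>{2..<N}. d \<le> vals \<tau> j)) \<partial>D {..N})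
    = (F f c)\<^sup>2 * (1 - F f d) ^ (N - 2)"
proof -
  define B where "B j = (if j < 2 then {t::real \<times> real. fst t < c} else {t. d \<le> fst t})" for j :: nat
  have "Measurable.pred T (\<lambda>t. fst t < c)" "Measurable.pred T (\<lambda>t. d \<le> fst t)" by measurable
  then have B: "B j \<in> sets T" for j by (simp add: B_def pred_def space_pair_measure)
  have m: "measure T {t. fst t < c} = F f c" "measure T {t. d \<le> fst t} = 1 - F f d"
    using prob_value[of "{..<c}"] prob_value[of "{d..}"] by (simp_all add: prob_less prob_ge)
  have split: "{..<N} = {0, 1} \<union> {2..<N}" using N2 by auto
  have eq: "of_bool (vals \<tau> 0 < c \<and> vals \<tau> 1 < c \<and> (\<forall>j\<in>{2..<N}. d \<le> vals \<tau> j))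
      = (indicator {\<tau> \<in> space (D {..N}). \<forall>k\<in>{..<N}. \<tau> k \<in> B k} \<tau> :: real)"
    if "\<tau> \<in> space (D {..N})" for \<tau>
    using that unfolding split by (auto simp: indicator_def B_def)
  have "(\<integral>\<tau>. of_bool (vals \<tau> 0 < c \<and> vals \<tau> 1 < c \<and> (\<forall>j\<in>{2..<N}. d \<le> vals \<tau> j)) \<partial>D {..N})
    = measure (D {..N}) {\<tau> \<in> space (D {..N}). \<forall>k\<in>{..<N}. \<tau> k \<in> B k}"
    by (subst Bochner_Integration.integral_cong[OF refl eq]) (auto intro!: arg_cong[where f = "measure (D {..N})"])
  also have "\<dots> = (\<Prod>j\<in>{..<N}. measure T (B j))"
    using B by (subst prob_sellers) auto
  also have "\<dots> = (\<Prod>j\<in>{0, 1}. measure T (B j)) * (\<Prod>j\<in>{2..<N}. measure T (B j))"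
    unfolding split by (intro prod.union_disjoint) auto
  also have "(\<Prod>j\<in>{2..<N}. measure T (B j)) = (\<Prod>j\<in>{2..<N}. 1 - F f d)"
    by (intro prod.cong) (auto simp: B_def m)
  finally show ?thesis by (simp add: B_def m power2_eq_square)
qed

text \<open>
  The cutoff seller is indifferent: the offer \<open>c + rent c\<close> is what he expects from undercutting the
  other sellers. This turns the expected acquisition cost into one that can be compared with the
  auction revenue state by state, as in \<open>speculator_pointwise\<close>.
\<close>

lemma acceptance_cost:
  assumes i: "i < N" and p: "p = c + rent c"
  shows "(\<integral>\<tau>. of_bool (vals \<tau> i < c) * (c + gain N r ((vals \<tau>)(i := c)) i) \<partial>D {..N})
      = (\<integral>\<tau>. of_bool (vals \<tau> i < c) * p \<partial>D {..N})"
    and "integrable (D {..N}) (\<lambda>\<tau>. of_bool (vals \<tau> i < c) * (c + gain N r ((vals \<tau>)(i := c)) i))"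
    and "integrable (D {..N}) (\<lambda>\<tau>. of_bool (vals \<tau> i < c) * p)"
proof -
  have sub: "{..<N} \<subseteq> {..N}" by auto
  have [measurable]: "Measurable.pred (D {..N}) (\<lambda>\<tau>. vals \<tau> i < c)"
    using i by (intro value_pred_measurable) simp
  note [measurable] = gain_upd_measurable[OF sub, of i c]
  have bound: "gain N r ((vals \<tau>)(i := c)) i \<le> r + \<bar>c\<bar>" for \<tau>
  proof -
    have "Min (insert r (((vals \<tau>)(i := c)) ` ({..<N} - {i}))) \<le> r" by (intro Min_le) auto
    then show ?thesis unfolding gain_def using r_pos by (simp only: fun_upd_same)
  qed
  have gint: "integrable (D {..N}) (\<lambda>\<tau>. gain N r ((vals \<tau>)(i := c)) i)"
    by (rule D.integrable_const_bound[where B = "r + \<bar>c\<bar>"]) (auto simp: gain_nonneg bound)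
  show int: "integrable (D {..N}) (\<lambda>\<tau>. of_bool (vals \<tau> i < c) * (c + gain N r ((vals \<tau>)(i := c)) i))"
  proof (rule D.integrable_const_bound[where B = "r + 2 * \<bar>c\<bar>"])
    show "AE \<tau> in D {..N}. norm (of_bool (vals \<tau> i < c) * (c + gain N r ((vals \<tau>)(i := c)) i)) \<le> r + 2 * \<bar>c\<bar>"
    proof (rule AE_I2)
      fix \<tau> show "norm (of_bool (vals \<tau> i < c) * (c + gain N r ((vals \<tau>)(i := c)) i)) \<le> r + 2 * \<bar>c\<bar>"
        using bound[of \<tau>] gain_nonneg[of N r "(vals \<tau>)(i := c)" i] r_pos by (auto simp del: fun_upd_apply)
    qed
  qed measurable
  show int': "integrable (D {..N}) (\<lambda>\<tau>. of_bool (vals \<tau> i < c) * p)"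
    by (rule D.integrable_const_bound[where B = "\<bar>p\<bar>"]) auto
  \<comment> \<open>Once value \<open>i\<close> is overwritten by \<open>c\<close>, the gain no
    longer depends on the type of \<open>i\<close>, so acceptance and gain are independent and the
    inner expectation of the gain is \<open>rent c\<close>.\<close>
  have eq: "(\<lambda>j. fst ((\<tau>(i := t)) j))(i := c) = (vals \<tau>)(i := c)" for \<tau> and t :: "real \<times> real" by auto
  have "(\<integral>\<tau>. of_bool (vals \<tau> i < c) * (c + gain N r ((vals \<tau>)(i := c)) i) \<partial>D {..N})
    = (\<integral>t. (\<integral>\<tau>. of_bool (fst t < c) * (c + gain N r ((vals \<tau>)(i := c)) i) \<partial>D {..N}) \<partial>tp i)"
    using i by (subst integral_resample[OF _ _ int, of i]) (simp_all add: eq fun_upd_same del: fun_upd_apply)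
  also have "\<dots> = (\<integral>t. (\<integral>\<tau>. of_bool (fst t < c) * p \<partial>D {..N}) \<partial>tp i)"
    using gint integral_gain[OF _ sub i, of c] by (simp add: p D.prob_space[simplified])
  also have "\<dots> = (\<integral>\<tau>. of_bool (vals \<tau> i < c) * p \<partial>D {..N})"
    using i by (subst integral_resample[OF _ _ int', of i]) simp_all
  finally show "(\<integral>\<tau>. of_bool (vals \<tau> i < c) * (c + gain N r ((vals \<tau>)(i := c)) i) \<partial>D {..N})
      = (\<integral>\<tau>. of_bool (vals \<tau> i < c) * p \<partial>D {..N})" .
qed

text \<open>By \<open>acceptance_cost\<close> the offer paid to each acceptor can be exchanged under
  the expectation for the random cost used in \<open>speculator_pointwise\<close>.\<close>

lemma truthful_speculator_payoff_eq:
  assumes c: "0 < c" and p: "p = c + rent c"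
  shows "truthful_speculator_payoff c p =
     (\<integral>\<tau>. (if \<exists>a<N. vals \<tau> a < c then lowest_rejecting c (vals \<tau>)
       - (\<Sum>i<N. of_bool (vals \<tau> i < c) * (c + gain N r ((vals \<tau>)(i := c)) i)) else 0) \<partial>D {..N})" (is "_ = (\<integral>\<tau>. ?\<Psi> \<tau> \<partial>_)")
    and "integrable (D {..N}) (\<lambda>\<tau>. if \<exists>a<N. vals \<tau> a < c then lowest_rejecting c (vals \<tau>)
       - (\<Sum>i<N. of_bool (vals \<tau> i < c) * (c + gain N r ((vals \<tau>)(i := c)) i)) else 0)"
proof -
  have sub: "{..<N} \<subseteq> {..N}" by auto
  let ?E = "\<lambda>\<tau>. \<exists>a<N. vals \<tau> a < c"
  note [measurable] = accept_measurable[of c]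
  \<comment> \<open>If nobody accepts, every summand has a zero factor, so the condition can be
    confined to the revenue term and the integral splits.\<close>
  have split: "(if ?E \<tau> then lowest_rejecting c (vals \<tau>) - (\<Sum>i<N. of_bool (vals \<tau> i < c) * h i) else 0)
    = of_bool (?E \<tau>) * lowest_rejecting c (vals \<tau>) - (\<Sum>i<N. of_bool (vals \<tau> i < c) * h i)"
    for h :: "nat \<Rightarrow> real" and \<tau>
    by (auto intro!: sum.neutral)
  have int: "integrable (D {..N}) (\<lambda>\<tau>. of_bool (?E \<tau>) * lowest_rejecting c (vals \<tau>))"
  proof (rule Bochner_Integration.integrable_bound[OF lowest_rejecting_integrable[OF _ sub, of c]])
    have [measurable]: "(\<lambda>\<tau>. lowest_rejecting c (vals \<tau>)) \<in> borel_measurable (D {..N})"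
      by (rule lowest_rejecting_measurable[OF sub])
    show "(\<lambda>\<tau>. of_bool (?E \<tau>) * lowest_rejecting c (vals \<tau>)) \<in> borel_measurable (D {..N})"
      by measurable
    have "norm (of_bool b * m) \<le> norm m" for b and m :: real by simp
    then show "AE \<tau> in D {..N}. norm (of_bool (?E \<tau>) * lowest_rejecting c (vals \<tau>)) \<le> norm (lowest_rejecting c (vals \<tau>))"
      by (rule AE_I2)
  qed simp
  have sums: "integrable (D {..N}) (\<lambda>\<tau>. if ?E \<tau> then lowest_rejecting c (vals \<tau>) - (\<Sum>i<N. of_bool (vals \<tau> i < c) * h i \<tau>) else 0)"
    "(\<integral>\<tau>. (if ?E \<tau> then lowest_rejecting c (vals \<tau>) - (\<Sum>i<N. of_bool (vals \<tau> i < c) * h i \<tau>) else 0) \<partial>D {..N})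
      = (\<integral>\<tau>. of_bool (?E \<tau>) * lowest_rejecting c (vals \<tau>) \<partial>D {..N})
        - (\<Sum>i<N. \<integral>\<tau>. of_bool (vals \<tau> i < c) * h i \<tau> \<partial>D {..N})"
    if h: "\<And>i. i < N \<Longrightarrow> integrable (D {..N}) (\<lambda>\<tau>. of_bool (vals \<tau> i < c) * h i \<tau>)"
    for h :: "nat \<Rightarrow> _ \<Rightarrow> real"
  proof -
    have h': "integrable (D {..N}) (\<lambda>\<tau>. of_bool (vals \<tau> i < c) * h i \<tau>)" if "i \<in> {..<N}" for i
      using h that by simp
    have iS: "integrable (D {..N}) (\<lambda>\<tau>. \<Sum>i<N. of_bool (vals \<tau> i < c) * h i \<tau>)"
      by (rule Bochner_Integration.integrable_sum[OF h'])
    show "integrable (D {..N}) (\<lambda>\<tau>. if ?E \<tau> then lowest_rejecting c (vals \<tau>) - (\<Sum>i<N. of_bool (vals \<tau> i < c) * h i \<tau>) else 0)"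
      unfolding split by (rule Bochner_Integration.integrable_diff[OF int iS])
    show "(\<integral>\<tau>. (if ?E \<tau> then lowest_rejecting c (vals \<tau>) - (\<Sum>i<N. of_bool (vals \<tau> i < c) * h i \<tau>) else 0) \<partial>D {..N})
      = (\<integral>\<tau>. of_bool (?E \<tau>) * lowest_rejecting c (vals \<tau>) \<partial>D {..N})
        - (\<Sum>i<N. \<integral>\<tau>. of_bool (vals \<tau> i < c) * h i \<tau> \<partial>D {..N})"
      unfolding split Bochner_Integration.integral_diff[OF int iS]
      by (subst Bochner_Integration.integral_sum[OF h']) simp_all
  qed
  show "integrable (D {..N}) ?\<Psi>"
    by (rule sums(1)[OF acceptance_cost(2)[OF _ p]])
  have "truthful_speculator_payoff c p
    = (\<integral>\<tau>. (if ?E \<tau> then lowest_rejecting c (vals \<tau>) - (\<Sum>i<N. of_bool (vals \<tau> i < c) * p) else 0) \<partial>D {..N})"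
    unfolding speculator_payoff_def truthful_speculator[OF r_pos c] Let_def ..
  also have "\<dots> = (\<integral>\<tau>. of_bool (?E \<tau>) * lowest_rejecting c (vals \<tau>) \<partial>D {..N})
      - (\<Sum>i<N. \<integral>\<tau>. of_bool (vals \<tau> i < c) * p \<partial>D {..N})"
    by (rule sums(2)[OF acceptance_cost(3)[OF _ p]])
  also have "(\<Sum>i<N. \<integral>\<tau>. of_bool (vals \<tau> i < c) * p \<partial>D {..N})
    = (\<Sum>i<N. \<integral>\<tau>. of_bool (vals \<tau> i < c) * (c + gain N r ((vals \<tau>)(i := c)) i) \<partial>D {..N})"
    by (intro sum.cong refl acceptance_cost(1)[symmetric] p) auto
  also have "(\<integral>\<tau>. of_bool (?E \<tau>) * lowest_rejecting c (vals \<tau>) \<partial>D {..N})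
      - (\<Sum>i<N. \<integral>\<tau>. of_bool (vals \<tau> i < c) * (c + gain N r ((vals \<tau>)(i := c)) i) \<partial>D {..N}) = (\<integral>\<tau>. ?\<Psi> \<tau> \<partial>D {..N})"
    by (rule sums(2)[OF acceptance_cost(2)[OF _ p], symmetric])
  finally show "truthful_speculator_payoff c p = (\<integral>\<tau>. ?\<Psi> \<tau> \<partial>D {..N})" .
qed

text \<open>Expectation of \<open>speculator_pointwise\<close>. Each of the
  \<open>N * (N - 1)\<close> ordered pairs accepts with probability \<open>(F f c)\<^sup>2\<close>,
  and the same factor appears in the revenue term, so the two can be compared after dividing it
  out.\<close>

lemma truthful_speculator_payoff_ge:
  fixes c d p :: real
  assumes c: "0 < c" "c < d" "d \<le> r" and p: "p = c + rent c"
  shows "d * ((F f c)\<^sup>2 * (1 - F f d) ^ (N - 2)) - N * c * (real N * (real N - 1) * (F f c)\<^sup>2)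
    \<le> truthful_speculator_payoff c p"
proof -
  let ?B = "\<lambda>\<tau>. of_bool (vals \<tau> 0 < c \<and> vals \<tau> 1 < c \<and> (\<forall>j\<in>{2..<N}. d \<le> vals \<tau> j)) :: real"
  let ?Q = "\<lambda>\<tau> i j. of_bool (vals \<tau> i < c \<and> vals \<tau> j < c) :: real"
  have m: "Measurable.pred (D {..N}) (\<lambda>\<tau>. vals \<tau> j < e)" if "j < N" for j e
    using that by (intro value_pred_measurable) simp
  have m': "Measurable.pred (D {..N}) (\<lambda>\<tau>. d \<le> vals \<tau> j)" if "j < N" for j
    using pred_intros_logic(2)[OF m[OF that, of d]] by (simp add: not_less)
  have mB: "?B \<in> borel_measurable (D {..N})"
  proof -
    have [measurable]: "Measurable.pred (D {..N}) (\<lambda>\<tau>. \<forall>j\<in>{2..<N}. d \<le> vals \<tau> j)"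
      by (intro pred_intros_finite m') auto
    have [measurable]: "Measurable.pred (D {..N}) (\<lambda>\<tau>. vals \<tau> 0 < c)" "Measurable.pred (D {..N}) (\<lambda>\<tau>. vals \<tau> 1 < c)"
      using N2 by (auto intro: m)
    show ?thesis by measurable
  qed
  have [measurable]: "(\<lambda>\<tau>. ?Q \<tau> i j) \<in> borel_measurable (D {..N})" if "i < N" "j < N" for i j
  proof -
    note [measurable] = m[OF that(1)] m[OF that(2)]
    show ?thesis by measurable
  qed
  have iB: "integrable (D {..N}) ?B"
    by (rule D.integrable_const_bound[where B = 1, OF AE_I2 mB]) simp
  have iQ: "integrable (D {..N}) (\<lambda>\<tau>. ?Q \<tau> i j)" if "i < N" "j < N" for i j
    using that by (intro D.integrable_const_bound[where B = 1]) auto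
  have iS: "integrable (D {..N}) (\<lambda>\<tau>. \<Sum>i<N. \<Sum>j\<in>{..<N} - {i}. ?Q \<tau> i j)"
    by (intro Bochner_Integration.integrable_sum iQ) auto
  have "(\<integral>\<tau>. d * ?B \<tau> - N * c * (\<Sum>i<N. \<Sum>j\<in>{..<N} - {i}. ?Q \<tau> i j) \<partial>D {..N}) \<le> truthful_speculator_payoff c p"
    unfolding truthful_speculator_payoff_eq(1)[OF c(1) p]
    by (rule integral_mono[OF _ truthful_speculator_payoff_eq(2)[OF c(1) p]])
      (intro Bochner_Integration.integrable_diff Bochner_Integration.integrable_mult_right iB iS speculator_pointwise[OF c])+
  moreover have "(\<integral>\<tau>. (\<Sum>i<N. \<Sum>j\<in>{..<N} - {i}. ?Q \<tau> i j) \<partial>D {..N})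
    = (\<Sum>i<N. \<Sum>j\<in>{..<N} - {i}. (F f c)\<^sup>2)"
  proof -
    have "(\<integral>\<tau>. (\<Sum>i<N. \<Sum>j\<in>{..<N} - {i}. ?Q \<tau> i j) \<partial>D {..N})
      = (\<Sum>i<N. \<integral>\<tau>. (\<Sum>j\<in>{..<N} - {i}. ?Q \<tau> i j) \<partial>D {..N})"
      by (rule Bochner_Integration.integral_sum) (intro Bochner_Integration.integrable_sum iQ, simp_all)
    also have "\<dots> = (\<Sum>i<N. \<Sum>j\<in>{..<N} - {i}. \<integral>\<tau>. ?Q \<tau> i j \<partial>D {..N})"
      by (intro sum.cong refl Bochner_Integration.integral_sum iQ) simp_all
    also have "\<dots> = (\<Sum>i<N. \<Sum>j\<in>{..<N} - {i}. (F f c)\<^sup>2)"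
      by (intro sum.cong refl prob_pair) simp_all
    finally show ?thesis .
  qed
  moreover have "(\<Sum>i<N. \<Sum>j\<in>{..<N} - {i}. (F f c)\<^sup>2) = real N * (real N - 1) * (F f c)\<^sup>2"
    using N2 by (simp add: of_nat_diff)
  moreover have "(\<integral>\<tau>. d * ?B \<tau> - N * c * (\<Sum>i<N. \<Sum>j\<in>{..<N} - {i}. ?Q \<tau> i j) \<partial>D {..N})
    = d * (\<integral>\<tau>. ?B \<tau> \<partial>D {..N}) - N * c * (\<integral>\<tau>. (\<Sum>i<N. \<Sum>j\<in>{..<N} - {i}. ?Q \<tau> i j) \<partial>D {..N})"
    using iB iS by (subst Bochner_Integration.integral_diff) auto
  ultimately show ?thesis unfolding prob_low_two by simp
qed

lemma profitable_speculation:
  obtains c where "0 < c" "c < r" "0 < truthful_speculator_payoff c (c + rent c)"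
proof -
  have "(F f \<longlongrightarrow> F f 0) (at 0)" using F_isCont[of 0] by (simp add: isCont_def)
  from order_tendstoD(2)[OF this, of 1] have "eventually (\<lambda>x. F f x < 1) (at 0)" using F0 by simp
  then obtain e where e: "0 < e" "\<And>x. x \<noteq> 0 \<Longrightarrow> dist x 0 < e \<Longrightarrow> F f x < 1"
    by (auto simp: eventually_at)
  \<comment> \<open>By continuity F is still below 1 at \<open>d\<close>, so the other sellers
    exceed \<open>d\<close> with positive probability.\<close>
  define d where "d = min r (e / 2)"
  have d: "0 < d" "d \<le> r" "F f d < 1" using e r_pos by (auto simp: d_def min_def intro!: e(2))
  define \<delta> where "\<delta> = d * (1 - F f d) ^ (N - 2)"
  have \<delta>: "0 < \<delta>" using d by (simp add: \<delta>_def)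
  \<comment> \<open>The second bound makes the cost term at most half of \<open>\<delta>\<close>, so
    the difference is positive; the first keeps \<open>c\<close> below \<open>d\<close>.\<close>
  define c where "c = min (d / 2) (\<delta> / (2 * N * (real N * (real N - 1))))"
  have K: "0 < 2 * real N * (real N * (real N - 1))" using N2 by simp
  have c: "0 < c" "c < d" "c \<le> \<delta> / (2 * N * (real N * (real N - 1)))" using d \<delta> K by (auto simp: c_def)
  have "2 * N * (real N * (real N - 1)) * c \<le> \<delta>" using c(3) K by (simp add: pos_le_divide_eq mult.commute)
  then have "N * c * (real N * (real N - 1)) < \<delta>" using \<delta> by (simp add: algebra_simps)
  then have "0 < (F f c)\<^sup>2 * (\<delta> - N * c * (real N * (real N - 1)))" using F_pos[OF c(1)] by simp
  also have "\<dots> = d * ((F f c)\<^sup>2 * (1 - F f d) ^ (N - 2)) - N * c * (real N * (real N - 1) * (F f c)\<^sup>2)"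
    by (simp add: \<delta>_def algebra_simps)
  also have "\<dots> \<le> truthful_speculator_payoff c (c + rent c)"
    using c d by (intro truthful_speculator_payoff_ge) auto
  finally show thesis using that[of c] c d by auto
qed

section \<open>Equilibrium cutoff and payoffs of the second-price auction with speculation\<close>

lemma no_sale_offer_eq: "no_sale_offer f N r = rent 0"
  by (simp add: no_sale_offer_def rent_def)

lemma spa_cutoff_offer:
  assumes "0 < c" "c \<le> r"
  shows "spa_cutoff f N r (c + rent c) = c"
proof -
  have "rent 0 < c + rent c" using rent_strict[of 0 c] assms by simp
  moreover have "(THE v. v \<in> {0..r} \<and> c + rent c - v = rent v) = c"
  proof (rule the_equality)
    fix v assume v: "v \<in> {0..r} \<and> c + rent c - v = rent v"
    then show "v = c" using rent_strict[of v c] rent_strict[of c v] assms by force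
  qed (use assms in auto)
  ultimately show ?thesis
    unfolding spa_cutoff_def no_sale_offer_eq rent_def[symmetric] by simp
qed

text \<open>The profitable offer of \<open>profitable_speculation\<close> is an available deviation,
  so the equilibrium profit is positive, whereas any offer up to \<open>rent 0\<close> yields
  zero.\<close>

lemma spa_equilibrium_speculation:
  assumes "spa_equilibrium f N r S"
  obtains c where "0 < c" "c \<le> r" "S = truthful_play c (c + rent c)"
proof -
  obtain p where p: "p \<in> {0..r}" "S = spa_play f N r p"
    and opt: "\<And>q. q \<in> {0..r} \<Longrightarrow> speculator_payoff f N r (spa_play f N r q) \<le> speculator_payoff f N r S"
    using assms by (auto simp: spa_equilibrium_def)
  obtain a where a: "0 < a" "a < r" "0 < truthful_speculator_payoff a (a + rent a)"
    by (rule profitable_speculation)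
  have "a + rent a \<in> {0..r}" using a rent_nonneg[of a] rent_le[of a] by auto
  from opt[OF this] have pos: "0 < speculator_payoff f N r S"
    using a by (simp add: spa_play_truthful spa_cutoff_offer)
  have big: "rent 0 < p"
  proof (rule ccontr)
    assume "\<not> rent 0 < p"
    then have "cutoff S = 0" by (simp add: p spa_play_def spa_cutoff_def no_sale_offer_eq)
    then show False using speculator_payoff_0[of S] pos by simp
  qed
  \<comment> \<open>Intermediate values of \<open>c + rent c\<close>, which runs continuously from
    \<open>rent 0\<close> at 0 to \<open>r\<close> at \<open>r\<close>.\<close>
  have "\<exists>c\<ge>0. c \<le> r \<and> c + rent c = p"
    using big p(1) r_pos by (intro IVT') (auto simp: rent_above intro!: continuous_intros rent_cont)
  then obtain c where c: "0 \<le> c" "c \<le> r" "c + rent c = p" by blast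
  then have "0 < c" using big by (cases "c = 0") auto
  with c p that show thesis by (auto simp: spa_play_truthful spa_cutoff_offer)
qed

text \<open>Efficiency is relative to the reserve rule: trade takes place exactly when the lowest
  value does not exceed \<open>r\<close>, whether or not \<open>w\<close> exceeds that
  value.\<close>

abbreviation efficient_surplus :: "real \<Rightarrow> (nat \<Rightarrow> real) \<Rightarrow> real" where
  "efficient_surplus w x \<equiv> of_bool (Min (x ` {..<N}) \<le> r) * (w - Min (x ` {..<N}))"

lemma efficient_surplus_integrable:
  "integrable (D {..N}) (\<lambda>\<tau>. efficient_surplus w (vals \<tau>))"
proof (rule D.integrable_const_bound)
  have [measurable]: "(\<lambda>\<tau>. Min (vals \<tau> ` {..<N})) \<in> borel_measurable (D {..N})"
    by (rule lowest_value_measurable) auto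
  show "(\<lambda>\<tau>. efficient_surplus w (vals \<tau>)) \<in> borel_measurable (D {..N})" by measurable
  have bound: "norm (of_bool b * (w - m)) \<le> \<bar>w\<bar> + 1" if "0 < m" "m \<le> 1" for b and m :: real
    using that by (cases b) auto
  show "AE \<tau> in D {..N}. norm (efficient_surplus w (vals \<tau>)) \<le> \<bar>w\<bar> + 1"
    using AE_bounds_all
  proof eventually_elim
    case (elim \<tau>)
    then have "0 < vals \<tau> i \<and> vals \<tau> i \<le> 1" if "i < N" for i using that by blast
    from lowest_value_bounds[of "vals \<tau>", OF this] show ?case by (rule bound)
  qed
qed

text \<open>This and the next two definitions express ex post payoffs through the value profile
  alone, so that comparisons can be made state by state.\<close>

definition truthful_auctioneer_gain :: "real \<Rightarrow> real \<Rightarrow> (nat \<Rightarrow> real) \<Rightarrow> real" where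
  "truthful_auctioneer_gain c w x = (if \<exists>a<N. x a < c then w - lowest_rejecting c x
     else efficient_surplus w x - (\<Sum>i<N. gain N r x i))"

definition truthful_seller_gain :: "real \<Rightarrow> real \<Rightarrow> nat \<Rightarrow> (nat \<Rightarrow> real) \<Rightarrow> real" where
  "truthful_seller_gain c p i x = (if x i < c then p - x i else gain N r x i)"

definition truthful_speculator_gain :: "real \<Rightarrow> real \<Rightarrow> (nat \<Rightarrow> real) \<Rightarrow> real" where
  "truthful_speculator_gain c p x = (if \<exists>a<N. x a < c then lowest_rejecting c x - (\<Sum>i<N. of_bool (x i < c) * p)
     else 0)"

lemma value_integrable:
  assumes "i < N" shows "integrable (D {..N}) (\<lambda>\<tau>. vals \<tau> i)"
proof (rule D.integrable_const_bound)
  show "AE \<tau> in D {..N}. norm (vals \<tau> i) \<le> 1"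
    using AE_bounds_all by eventually_elim (use assms in auto)
qed (use assms in \<open>intro value_measurable, simp\<close>)

lemma truthful_gains_integrable:
  shows "integrable (D {..N}) (\<lambda>\<tau>. truthful_auctioneer_gain c w (vals \<tau>))"
    and "i < N \<Longrightarrow> integrable (D {..N}) (\<lambda>\<tau>. truthful_seller_gain c p i (vals \<tau>))"
    and "integrable (D {..N}) (\<lambda>\<tau>. truthful_speculator_gain c p (vals \<tau>))"
proof -
  have sub: "{..<N} \<subseteq> {..N}" by auto
  have accept: "Measurable.pred (D {..N}) (\<lambda>\<tau>. vals \<tau> i < c)" if "i < N" for i
    using that by (intro value_pred_measurable) simp
  show "integrable (D {..N}) (\<lambda>\<tau>. truthful_auctioneer_gain c w (vals \<tau>))"
    unfolding truthful_auctioneer_gain_def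
    by (intro integrable_if accept_measurable Bochner_Integration.integrable_diff D.integrable_const
        lowest_rejecting_integrable efficient_surplus_integrable Bochner_Integration.integrable_sum
        gain_integrable sub finite_atMost) simp
  show "integrable (D {..N}) (\<lambda>\<tau>. truthful_seller_gain c p i (vals \<tau>))" if "i < N"
    unfolding truthful_seller_gain_def using that
    by (intro integrable_if accept Bochner_Integration.integrable_diff D.integrable_const
        gain_integrable value_integrable sub finite_atMost)
  have "integrable (D {..N}) (\<lambda>\<tau>. of_bool (vals \<tau> i < c) * p)" if "i < N" for i
  proof -
    note [measurable] = accept[OF that]
    show ?thesis by (rule D.integrable_const_bound[where B = "\<bar>p\<bar>"]) auto
  qed
  then show "integrable (D {..N}) (\<lambda>\<tau>. truthful_speculator_gain c p (vals \<tau>))"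
    unfolding truthful_speculator_gain_def
    by (intro integrable_if accept_measurable Bochner_Integration.integrable_diff D.integrable_const
        lowest_rejecting_integrable Bochner_Integration.integrable_sum sub finite_atMost) simp_all
qed

lemma truthful_payoffs:
  assumes "0 < c"
  shows "auctioneer_payoff f N r w (truthful_play c p) = (\<integral>\<tau>. truthful_auctioneer_gain c w (vals \<tau>) \<partial>D {..N})"
    and "i < N \<Longrightarrow> seller_payoff f N r (truthful_play c p) i = (\<integral>\<tau>. truthful_seller_gain c p i (vals \<tau>) \<partial>D {..N})"
    and "speculator_payoff f N r (truthful_play c p) = (\<integral>\<tau>. truthful_speculator_gain c p (vals \<tau>) \<partial>D {..N})"
proof -
  show "auctioneer_payoff f N r w (truthful_play c p) = (\<integral>\<tau>. truthful_auctioneer_gain c w (vals \<tau>) \<partial>D {..N})"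
    unfolding auctioneer_payoff_def truthful_auctioneer[OF r_pos assms N_pos] Let_def truthful_auctioneer_gain_def ..
  show "speculator_payoff f N r (truthful_play c p) = (\<integral>\<tau>. truthful_speculator_gain c p (vals \<tau>) \<partial>D {..N})"
    unfolding speculator_payoff_def truthful_speculator[OF r_pos assms] Let_def truthful_speculator_gain_def ..
  show "seller_payoff f N r (truthful_play c p) i = (\<integral>\<tau>. truthful_seller_gain c p i (vals \<tau>) \<partial>D {..N})" if "i < N"
    unfolding seller_payoff_def truthful_play_sel truthful_seller[OF that r_pos assms] truthful_seller_gain_def ..
qed

text \<open>This event, of probability \<open>(F f c)\<^sup>2\<close>, is where an item is withheld;
  it carries the strictness of the auctioneer and surplus comparisons.\<close>

lemma two_low_values:
  assumes "0 < c"
  shows "{\<tau> \<in> space (D {..N}). vals \<tau> 0 < c \<and> vals \<tau> 1 < c} \<in> sets (D {..N})"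
    and "emeasure (D {..N}) {\<tau> \<in> space (D {..N}). vals \<tau> 0 < c \<and> vals \<tau> 1 < c} \<noteq> 0"
proof -
  have [measurable]: "Measurable.pred (D {..N}) (\<lambda>\<tau>. vals \<tau> 0 < c)" "Measurable.pred (D {..N}) (\<lambda>\<tau>. vals \<tau> 1 < c)"
    using N2 by (auto intro!: value_pred_measurable)
  show "{\<tau> \<in> space (D {..N}). vals \<tau> 0 < c \<and> vals \<tau> 1 < c} \<in> sets (D {..N})"
    by (intro sets.sets_Collect_conj) measurable
  have eq: "of_bool (vals \<tau> 0 < c \<and> vals \<tau> 1 < c)
      = (indicator {\<tau> \<in> space (D {..N}). vals \<tau> 0 < c \<and> vals \<tau> 1 < c} \<tau> :: real)"
    if "\<tau> \<in> space (D {..N})" for \<tau>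
    using that by (simp add: indicator_def)
  have "measure (D {..N}) {\<tau> \<in> space (D {..N}). vals \<tau> 0 < c \<and> vals \<tau> 1 < c}
    = (\<integral>\<tau>. of_bool (vals \<tau> 0 < c \<and> vals \<tau> 1 < c) \<partial>D {..N})"
    by (subst Bochner_Integration.integral_cong[OF refl eq]) (auto intro!: arg_cong[where f = "measure (D {..N})"])
  also have "\<dots> = (F f c)\<^sup>2" using N2 by (intro prob_pair) auto
  finally show "emeasure (D {..N}) {\<tau> \<in> space (D {..N}). vals \<tau> 0 < c \<and> vals \<tau> 1 < c} \<noteq> 0"
    using F_pos[OF assms] by (simp add: D.emeasure_eq_measure)
qed

lemma lowest_value_le: "i < N \<Longrightarrow> Min (x ` {..<N}) \<le> x i"
  by (intro Min_le) auto

lemma integral_two_low_values_less: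
  fixes g h :: "(nat \<Rightarrow> real) \<Rightarrow> real"
  assumes "0 < c" and int: "integrable (D {..N}) (\<lambda>\<tau>. g (vals \<tau>))" "integrable (D {..N}) (\<lambda>\<tau>. h (vals \<tau>))"
    and le: "\<And>x. (\<And>i. i < N \<Longrightarrow> 0 < x i) \<Longrightarrow> g x \<le> h x"
    and less: "\<And>x. (\<And>i. i < N \<Longrightarrow> 0 < x i) \<Longrightarrow> x 0 < c \<Longrightarrow> x 1 < c \<Longrightarrow> g x < h x"
  shows "(\<integral>\<tau>. g (vals \<tau>) \<partial>D {..N}) < (\<integral>\<tau>. h (vals \<tau>) \<partial>D {..N})"
proof (rule D.integral_less_AE[OF int two_low_values(2,1)[OF \<open>0 < c\<close>]])
  show "AE \<tau> in D {..N}. \<tau> \<in> {\<tau> \<in> space (D {..N}). vals \<tau> 0 < c \<and> vals \<tau> 1 < c} \<longrightarrow> g (vals \<tau>) \<noteq> h (vals \<tau>)"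
    using AE_bounds_all
  proof eventually_elim
    case (elim \<tau>)
    then show ?case using less[of "vals \<tau>"] by auto
  qed
  show "AE \<tau> in D {..N}. g (vals \<tau>) \<le> h (vals \<tau>)"
    using AE_bounds_all
  proof eventually_elim
    case (elim \<tau>)
    then show ?case using le[of "vals \<tau>"] by blast
  qed
qed

text \<open>The right-hand side is the benchmark: efficient surplus less the expected gains of the
  sellers. State by state speculation raises the payment by \<open>min_plus_gains_le\<close>,
  strictly by \<open>min_plus_gains_less\<close> when two sellers accept.\<close>

lemma truthful_auctioneer_payoff_less:
  assumes c: "0 < c" "c \<le> r"
  shows "auctioneer_payoff f N r w (truthful_play c p)
    < (\<integral>\<tau>. efficient_surplus w (vals \<tau>) \<partial>D {..N}) - N * (\<integral>t. rent (fst t) \<partial>T)"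
proof -
  have sub: "{..<N} \<subseteq> {..N}" by auto
  have gi: "integrable (D {..N}) (\<lambda>\<tau>. gain N r (vals \<tau>) i)" if "i \<in> {..<N}" for i
    using that by (intro gain_integrable) auto
  note gs = Bochner_Integration.integrable_sum[OF gi]
  have "auctioneer_payoff f N r w (truthful_play c p)
    < (\<integral>\<tau>. efficient_surplus w (vals \<tau>) - (\<Sum>i<N. gain N r (vals \<tau>) i) \<partial>D {..N})"
    unfolding truthful_payoffs[OF c(1)]
  proof (rule integral_two_low_values_less[OF c(1)])
    fix x :: "nat \<Rightarrow> real"
    have m: "efficient_surplus w x = w - Min (x ` {..<N})" if "a < N" "x a < c" for a
    proof -
      have "Min (x ` {..<N}) \<le> r" using lowest_value_le[of a x] that c by linarith
      then show ?thesis by (simp only: of_bool_eq simp_thms mult_1_left)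
    qed
    show "truthful_auctioneer_gain c w x \<le> efficient_surplus w x - (\<Sum>i<N. gain N r x i)"
    proof (cases "\<exists>a<N. x a < c")
      case True
      then obtain a where a: "a < N" "x a < c" by blast
      have "truthful_auctioneer_gain c w x = w - lowest_rejecting c x"
        unfolding truthful_auctioneer_gain_def using True by (rule if_P)
      then show ?thesis using m[OF a] min_plus_gains_le[of a N x c r] a c by linarith
    next
      case False
      then show ?thesis unfolding truthful_auctioneer_gain_def by (simp only: if_False order_refl)
    qed
    assume a: "x 0 < c" "x 1 < c"
    then have "\<exists>a<N. x a < c" using N_pos by blast
    then have "truthful_auctioneer_gain c w x = w - lowest_rejecting c x"
      unfolding truthful_auctioneer_gain_def by (rule if_P)
    then show "truthful_auctioneer_gain c w x < efficient_surplus w x - (\<Sum>i<N. gain N r x i)"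
      using m[of 0] min_plus_gains_less[of 0 N x c 1 r] a c N2 by linarith
  qed (intro truthful_gains_integrable Bochner_Integration.integrable_diff gs efficient_surplus_integrable)+
  also have "\<dots> = (\<integral>\<tau>. efficient_surplus w (vals \<tau>) \<partial>D {..N}) - (\<integral>\<tau>. (\<Sum>i<N. gain N r (vals \<tau>) i) \<partial>D {..N})"
    by (rule Bochner_Integration.integral_diff[OF efficient_surplus_integrable gs])
  also have "(\<integral>\<tau>. (\<Sum>i<N. gain N r (vals \<tau>) i) \<partial>D {..N}) = (\<Sum>i<N. \<integral>\<tau>. gain N r (vals \<tau>) i \<partial>D {..N})"
    by (rule Bochner_Integration.integral_sum[OF gi])
  also have "(\<Sum>i<N. \<integral>\<tau>. gain N r (vals \<tau>) i \<partial>D {..N}) = N * (\<integral>t. rent (fst t) \<partial>T)"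
    using integral_gain_type[OF finite_atMost sub] by simp
  finally show ?thesis .
qed

text \<open>Payments cancel between the parties. After any acceptance the surplus is
  \<open>w\<close> minus all accepted values, not just the lowest one, and values are almost surely
  positive, so a second acceptance destroys surplus.\<close>

lemma truthful_total_surplus_less:
  assumes c: "0 < c" "c \<le> r"
  shows "total_surplus f N r w (truthful_play c p) < (\<integral>\<tau>. efficient_surplus w (vals \<tau>) \<partial>D {..N})"
proof -
  let ?a = "truthful_auctioneer_gain c w" and ?b = "\<lambda>i. truthful_seller_gain c p i" and ?s = "truthful_speculator_gain c p"
  have ib: "integrable (D {..N}) (\<lambda>\<tau>. ?b i (vals \<tau>))" if "i \<in> {..<N}" for i
    using that by (intro truthful_gains_integrable) simp
  note ibs = Bochner_Integration.integrable_sum[OF ib]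
  have "total_surplus f N r w (truthful_play c p)
    = (\<integral>\<tau>. ?a (vals \<tau>) \<partial>D {..N}) + (\<Sum>i<N. \<integral>\<tau>. ?b i (vals \<tau>) \<partial>D {..N}) + (\<integral>\<tau>. ?s (vals \<tau>) \<partial>D {..N})"
    unfolding total_surplus_def truthful_payoffs(1,3)[OF c(1)] using truthful_payoffs(2)[OF c(1)] by simp
  also have "(\<Sum>i<N. \<integral>\<tau>. ?b i (vals \<tau>) \<partial>D {..N}) = (\<integral>\<tau>. (\<Sum>i<N. ?b i (vals \<tau>)) \<partial>D {..N})"
    by (rule Bochner_Integration.integral_sum[OF ib, symmetric])
  also have "(\<integral>\<tau>. ?a (vals \<tau>) \<partial>D {..N}) + (\<integral>\<tau>. (\<Sum>i<N. ?b i (vals \<tau>)) \<partial>D {..N})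
    = (\<integral>\<tau>. ?a (vals \<tau>) + (\<Sum>i<N. ?b i (vals \<tau>)) \<partial>D {..N})"
    by (rule Bochner_Integration.integral_add[OF truthful_gains_integrable(1) ibs, symmetric])
  also have "\<dots> + (\<integral>\<tau>. ?s (vals \<tau>) \<partial>D {..N})
    = (\<integral>\<tau>. ?a (vals \<tau>) + (\<Sum>i<N. ?b i (vals \<tau>)) + ?s (vals \<tau>) \<partial>D {..N})"
    by (rule Bochner_Integration.integral_add[OF Bochner_Integration.integrable_add[OF truthful_gains_integrable(1) ibs]
          truthful_gains_integrable(3), symmetric])
  also have "\<dots> < (\<integral>\<tau>. efficient_surplus w (vals \<tau>) \<partial>D {..N})"
  proof (rule integral_two_low_values_less[OF c(1)])
    fix x :: "nat \<Rightarrow> real" assume pos: "\<And>i. i < N \<Longrightarrow> 0 < x i"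
    have accepted: "?a x + (\<Sum>i<N. ?b i x) + ?s x = w - (\<Sum>i<N. of_bool (x i < c) * x i)"
      "efficient_surplus w x = w - Min (x ` {..<N})"
      if a: "a < N" "x a < c" for a
    proof -
      have ex: "\<exists>a<N. x a < c" using a by blast
      \<comment> \<open>A rejecting seller contributes nothing, because the accepting
        \<open>a\<close> has a lower value.\<close>
      have "?b i x = of_bool (x i < c) * p - of_bool (x i < c) * x i" if "i < N" for i
        using gain_eq_0[of a N i x r] a that by (cases "x i < c") (auto simp: truthful_seller_gain_def)
      then have "(\<Sum>i<N. ?b i x) = (\<Sum>i<N. of_bool (x i < c) * p) - (\<Sum>i<N. of_bool (x i < c) * x i)"
        by (simp add: sum_subtractf del: sum_mult_of_bool_eq sum_of_bool_mult_eq)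
      moreover have "?a x = w - lowest_rejecting c x"
        unfolding truthful_auctioneer_gain_def using ex by (rule if_P)
      moreover have "?s x = lowest_rejecting c x - (\<Sum>i<N. of_bool (x i < c) * p)"
        unfolding truthful_speculator_gain_def using ex by (rule if_P)
      ultimately show "?a x + (\<Sum>i<N. ?b i x) + ?s x = w - (\<Sum>i<N. of_bool (x i < c) * x i)" by linarith
      have "Min (x ` {..<N}) \<le> r" using lowest_value_le[of a x] a c by linarith
      then show "efficient_surplus w x = w - Min (x ` {..<N})" by (simp only: of_bool_eq simp_thms mult_1_left)
    qed
    have sum_ge: "(\<Sum>i\<in>A. of_bool (x i < c) * x i) \<le> (\<Sum>i<N. of_bool (x i < c) * x i)" if "A \<subseteq> {..<N}" for A
      using that pos by (intro sum_mono2) (auto intro: less_imp_le)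
    show "?a x + (\<Sum>i<N. ?b i x) + ?s x \<le> efficient_surplus w x"
    proof (cases "\<exists>a<N. x a < c")
      case True
      then obtain a where a: "a < N" "x a < c" by blast
      have "Min (x ` {..<N}) \<le> (\<Sum>i\<in>{a}. of_bool (x i < c) * x i)" using lowest_value_le[of a x] a by simp
      also have "\<dots> \<le> (\<Sum>i<N. of_bool (x i < c) * x i)" using a by (intro sum_ge) simp
      finally show ?thesis unfolding accepted[OF a] by linarith
    next
      case False
      then have "?a x = efficient_surplus w x - (\<Sum>i<N. gain N r x i)" "?s x = 0" "(\<Sum>i<N. ?b i x) = (\<Sum>i<N. gain N r x i)"
        by (auto simp: truthful_auctioneer_gain_def truthful_speculator_gain_def truthful_seller_gain_def intro!: sum.cong)
      then show ?thesis by linarith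
    qed
    assume a: "x 0 < c" "x 1 < c"
    have "0 < x 1" using N2 by (intro pos) simp
    then have "Min (x ` {..<N}) < x 0 + x 1" using lowest_value_le[OF N_pos, of x] by linarith
    also have "\<dots> = (\<Sum>i\<in>{0, 1}. of_bool (x i < c) * x i)" using a by simp
    also have "\<dots> \<le> (\<Sum>i<N. of_bool (x i < c) * x i)" using N2 by (intro sum_ge) auto
    finally show "?a x + (\<Sum>i<N. ?b i x) + ?s x < efficient_surplus w x"
      unfolding accepted[OF N_pos a(1)] by simp
  qed (rule Bochner_Integration.integrable_add[OF Bochner_Integration.integrable_add[OF truthful_gains_integrable(1) ibs]
          truthful_gains_integrable(3)], assumption, rule efficient_surplus_integrable)
  finally show ?thesis .
qed

lemma rent_type_integrable: "integrable T (\<lambda>t. rent (fst t))"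
proof (rule T.P.integrable_const_bound)
  show "AE t in T. norm (rent (fst t)) \<le> r"
    using AE_value[OF AE_V_pos]
  proof eventually_elim
    case (elim t)
    then show ?case
      using rent_le[of "fst t"] rent_above[of "fst t"] rent_nonneg[of "fst t"] r_pos by (cases "fst t \<le> r") auto
  qed
qed measurable

text \<open>Conditionally on his value a rejecting seller expects exactly his rent, by
  \<open>integral_gain\<close>. An accepting one gets \<open>p - v\<close>, which exceeds
  \<open>rent v\<close> because \<open>v + rent v\<close> increases strictly up to the
  cutoff.\<close>

lemma truthful_seller_payoff_greater:
  assumes c: "0 < c" "c \<le> r" and p: "p = c + rent c" and i: "i < N"
  shows "(\<integral>t. rent (fst t) \<partial>T) < seller_payoff f N r (truthful_play c p) i"
proof -
  let ?g = "\<lambda>t. if fst t < c then p - fst t else rent (fst t)"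
  have sub: "{..<N} \<subseteq> {..N}" by auto
  have inner: "(\<integral>\<tau>. truthful_seller_gain c p i (vals (\<tau>(i := t))) \<partial>D {..N}) = ?g t" for t
  proof -
    have "vals (\<tau>(i := t)) = (vals \<tau>)(i := fst t)" for \<tau> by auto
    then show ?thesis
      using integral_gain[OF finite_atMost sub i, of "fst t"]
      by (simp add: truthful_seller_gain_def D.prob_space[simplified])
  qed
  have "seller_payoff f N r (truthful_play c p) i = (\<integral>t. ?g t \<partial>T)"
    unfolding truthful_payoffs(2)[OF c(1) i]
    by (subst integral_resample[OF _ _ truthful_gains_integrable(2)[OF i], of i]) (use i in \<open>simp_all add: inner del: fun_upd_apply\<close>)
  moreover have "(\<integral>t. rent (fst t) \<partial>T) < (\<integral>t. ?g t \<partial>T)"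
  proof (rule T.P.integral_less_AE[OF rent_type_integrable])
    have [measurable]: "Measurable.pred T (\<lambda>t. fst t < c)" by measurable
    show "integrable T ?g"
    proof (rule integrable_if)
      show "integrable T (\<lambda>t. p - fst t)"
      proof (rule T.P.integrable_const_bound)
        show "AE t in T. norm (p - fst t) \<le> \<bar>p\<bar> + 1"
          using AE_value[OF AE_V_pos] AE_value[OF AE_V_le_1] by eventually_elim auto
      qed measurable
    qed (simp_all add: rent_type_integrable)
    show "{t. fst t < c} \<in> sets T"
      using \<open>Measurable.pred T (\<lambda>t. fst t < c)\<close> by (simp add: pred_def space_pair_measure)
    show "emeasure T {t. fst t < c} \<noteq> 0"
      using prob_value[of "{..<c}"] F_pos[OF c(1)] by (simp add: T.P.emeasure_eq_measure prob_less)
    have less: "rent v < p - v" if "0 < v" "v < c" for v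
      using rent_strict[of v c] that c p by simp
    show "AE t in T. t \<in> {t. fst t < c} \<longrightarrow> rent (fst t) \<noteq> ?g t"
      using AE_value[OF AE_V_pos] by eventually_elim (use less in force)
    show "AE t in T. rent (fst t) \<le> ?g t"
      using AE_value[OF AE_V_pos] by eventually_elim (use less in \<open>force intro: less_imp_le\<close>)
  qed
  ultimately show ?thesis by simp
qed

text \<open>Cutoff 0 can be induced by the offer \<open>rent 0\<close> and yields zero profit, so an
  optimal cutoff cannot have negative profit.\<close>

lemma fpa_cutoff_0:
  assumes "\<And>v. v \<in> {0<..r} \<Longrightarrow> fpa_profit f N r v < 0" and P: "fpa_equilibrium f N r P"
  shows "cutoff P = 0"
proof -
  have "fpa_offer f N r 0 = rent 0"
    using F0 N2 by (auto simp: fpa_offer_def rent_def intro!: sum.neutral)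
  then have "fpa_induces f N r 0 0"
    using r_pos rent_nonneg by (simp add: fpa_induces_def)
  then have "fpa_profit f N r 0 \<le> fpa_profit f N r (cutoff P)"
    using P by (simp add: fpa_equilibrium_def)
  moreover have "fpa_profit f N r 0 = 0"
  proof -
    \<comment> \<open>As \<open>m\<close> is at most \<open>N - 1\<close>, the exponent
      \<open>N - m\<close> is positive and every term contains a power of zero.\<close>
    have "(\<Sum>m=1..N-1. real (N choose m) * (1 - 0) ^ m * 0 ^ (N - m) * b_low f r m 0) = 0"
      using N2 by (intro sum.neutral ballI) auto
    then show ?thesis using N2 unfolding fpa_profit_def F0 by simp
  qed
  moreover have "cutoff P = 0 \<or> cutoff P \<in> {0<..r}"
    using P by (auto simp: fpa_equilibrium_def fpa_induces_def)
  ultimately show ?thesis using assms(1)[of "cutoff P"] by force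
qed

end

section \<open>Equilibrium of the first-price auction\<close>

locale first_price_equilibrium = private_values +
  fixes P :: play
  assumes pricing: "pricing P = first_price" and cutoff: "cutoff P = 0"
    and bidding: "fpa_bidding_equilibrium f N r P"
begin

text \<open>With cutoff 0 almost surely all sellers reject, so the auction on the path of play is
  the one announced with \<open>N\<close> sellers.\<close>

definition \<beta> :: "real \<times> real \<Rightarrow> real" where
  "\<beta> t = seller_bid P N (fst t) (snd t)"

text \<open>Seller 0 represents every seller, as in \<open>fpa_seller_interim\<close>; his own
  coordinate of the profile is overwritten by the bid \<open>b\<close>.\<close>

definition wp :: "real \<Rightarrow> (nat \<Rightarrow> real \<times> real) \<Rightarrow> real" where
  "wp b \<tau> = win_prob r {..<N} ((\<lambda>i. \<beta> (\<tau> i))(0 := b)) 0"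

text \<open>Values are independent, so a seller's value affects his interim payoff
  \<open>Q b * (b - x)\<close> only through the margin. For a fixed bid the payoff is affine in
  \<open>x\<close>, which makes the supremum \<open>U\<close> convex.\<close>

definition Q :: "real \<Rightarrow> real" where
  "Q b = (\<integral>\<tau>. wp b \<tau> \<partial>D {..<N})"

definition U :: "real \<Rightarrow> real" where
  "U x = (SUP b. Q b * (b - x))"

definition best_response :: "real \<times> real \<Rightarrow> bool" where
  "best_response t \<longleftrightarrow> fst t \<le> \<beta> t \<and> (\<forall>b. Q b * (b - fst t) \<le> Q (\<beta> t) * (\<beta> t - fst t))"

lemma belief_eq: "belief f P = V"
proof -
  have 1: "emeasure V {0..} = 1"
    using prob_ge[of 0] F0 by (simp add: V.emeasure_eq_measure)
  have "belief f P = density V (\<lambda>_. 1)"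
    unfolding belief_def uniform_measure_def cutoff 1
    by (rule density_cong) (use AE_V_pos in \<open>auto simp: indicator_def elim!: eventually_mono\<close>)
  then show ?thesis by (simp add: density_1)
qed

lemma \<beta>_measurable[measurable]: "\<beta> \<in> borel_measurable (borel \<Otimes>\<^sub>M borel)"
proof -
  have "case_prod (seller_bid P N) \<in> borel_measurable (borel \<Otimes>\<^sub>M borel)"
    using bidding N2 by (auto simp: fpa_bidding_equilibrium_def)
  also have "case_prod (seller_bid P N) = \<beta>" by (auto simp: \<beta>_def)
  finally show ?thesis .
qed

lemma component_measurable:
  assumes "i \<in> I" shows "(\<lambda>\<tau>. \<tau> i) \<in> D I \<rightarrow>\<^sub>M (borel \<Otimes>\<^sub>M borel)"
  using assms by (subst measurable_cong_sets[OF sets_D refl]) simp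

lemma bid_measurable: "i \<in> I \<Longrightarrow> (\<lambda>\<tau>. \<beta> (\<tau> i)) \<in> borel_measurable (D I)"
  by (rule measurable_compose[OF component_measurable \<beta>_measurable])

lemma bids_eq: "i < N \<Longrightarrow> bids N P N \<tau> i = \<beta> (\<tau> i)"
  by (simp add: bids_def \<beta>_def)

lemma wp_nonneg: "0 \<le> wp b \<tau>" and wp_le_1: "wp b \<tau> \<le> 1"
  unfolding wp_def by (rule win_prob_nonneg win_prob_le_1)+

lemma wp_measurable[measurable]: "wp b \<in> borel_measurable (D {..<N})"
  unfolding wp_def[abs_def]
proof (subst fun_upd_def, rule win_prob_measurable)
  fix k assume "k \<in> {..<N}"
  then show "(\<lambda>\<tau>. if k = 0 then b else \<beta> (\<tau> k)) \<in> borel_measurable (D {..<N})"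
    by (cases "k = 0") (auto intro: bid_measurable)
qed simp

lemma wp_integrable: "integrable (D {..<N}) (wp b)"
  by (rule D.integrable_const_bound[where B = 1]) (auto simp: wp_nonneg wp_le_1)

lemma interim_eq: "fpa_seller_interim f N r P N v b = Q b * (b - v)"
proof -
  have "win_prob r {..<N} ((bids N P N \<tau>)(0 := b)) 0 = wp b \<tau>" for \<tau>
    unfolding wp_def by (rule fun_cong[OF win_prob_cong]) (simp add: bids_eq)
  then show ?thesis
    by (simp add: fpa_seller_interim_def bidders_all belief_eq Q_def)
qed

lemma AE_best_response: "AE t in T. best_response t"
proof -
  have "AE (v, u) in belief f P \<Otimes>\<^sub>M randomizer.
           v \<le> seller_bid P N v u \<and>
           (\<forall>b. fpa_seller_interim f N r P N v b \<le> fpa_seller_interim f N r P N v (seller_bid P N v u))"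
    using bidding N2 by (simp add: fpa_bidding_equilibrium_def)
  then show ?thesis
    unfolding belief_eq interim_eq by (simp add: best_response_def \<beta>_def split_beta')
qed

section \<open>Winning probabilities and best responses\<close>

lemma Q_nonneg: "0 \<le> Q b"
  unfolding Q_def by (intro Bochner_Integration.integral_nonneg) (rule wp_nonneg)

lemma Q_le_1: "Q b \<le> 1"
proof -
  have "Q b \<le> (\<integral>\<tau>. 1 \<partial>D {..<N})"
    unfolding Q_def by (intro integral_mono wp_integrable) (auto simp: wp_le_1)
  then show ?thesis by (simp add: D.prob_space[simplified])
qed

lemma Q_above_reserve: "r < b \<Longrightarrow> Q b = 0"
  by (simp add: Q_def wp_def win_prob_above_reserve)

lemma Q_antimono: "b \<le> b' \<Longrightarrow> Q b' \<le> Q b"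
proof (cases "b = b'")
  case False
  assume "b \<le> b'"
  with False N2 show ?thesis
    unfolding Q_def by (intro integral_mono wp_integrable) (auto simp: wp_def intro!: win_prob_raise)
qed simp

lemma AE_others:
  assumes "AE t in T. R t"
  shows "AE \<tau> in D {..<N}. \<forall>j\<in>{1..<N}. R (\<tau> j)"
  using assms by (intro eventually_ball_finite ballI AE_seller) auto

text \<open>Nobody bids below his value, so a bid below all competing values wins alone.\<close>

lemma Q_ge:
  assumes "b \<le> r"
  shows "(1 - F f b) ^ (N - 1) \<le> Q b"
proof -
  let ?B = "{\<tau> \<in> space (D {..<N}). \<forall>j\<in>{1..<N}. b < vals \<tau> j}"
  have B: "?B \<in> sets (D {..<N})"
    by (intro sets.sets_Collect_finite_All) auto
  have "(\<integral>\<tau>. indicator ?B \<tau> \<partial>D {..<N}) \<le> (\<integral>\<tau>. wp b \<tau> \<partial>D {..<N})"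
  proof (intro integral_mono_AE wp_integrable)
    show "AE \<tau> in D {..<N}. indicator ?B \<tau> \<le> wp b \<tau>"
      using AE_others[OF AE_best_response]
    proof eventually_elim
      case (elim \<tau>)
      show ?case
      proof (cases "\<tau> \<in> ?B")
        case True
        have "b < \<beta> (\<tau> j)" if "j \<in> {..<N}" "j \<noteq> 0" for j
        proof -
          have "j \<in> {1..<N}" using that by simp
          then have "b < vals \<tau> j" "vals \<tau> j \<le> \<beta> (\<tau> j)"
            using True elim by (auto simp: best_response_def)
          then show ?thesis by simp
        qed
        then have "wp b \<tau> = 1" unfolding wp_def using assms N2 by (intro win_prob_lowest) auto
        then show ?thesis by (simp add: indicator_def)
      next
        case False
        then show ?thesis by (simp add: wp_nonneg del: atLeastLessThan_iff)
      qed
    qed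
  qed (intro integrable_real_indicator B, simp add: D.emeasure_eq_measure)
  moreover have "(\<integral>\<tau>. indicator ?B \<tau> \<partial>D {..<N}) = measure (D {..<N}) ?B" by simp
  moreover have "measure (D {..<N}) ?B = (1 - F f b) ^ card {1..<N}"
    by (rule prob_values_greater) auto
  ultimately have "(1 - F f b) ^ card {1..<N} \<le> Q b" unfolding Q_def by (simp only:)
  then show ?thesis by simp
qed

lemma best_response_rational:
  assumes t: "best_response t" and v: "F f (fst t) < 1" "fst t < r"
  shows "\<beta> t \<le> r" "0 < Q (\<beta> t)" "fst t < \<beta> t"
proof -
  \<comment> \<open>Continuity keeps F below 1 slightly above the value. A bid there wins with
    positive probability at a positive margin, so every best response has a positive payoff.\<close>
  have "(F f \<longlongrightarrow> F f (fst t)) (at_right (fst t))"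
    using F_isCont[of "fst t"] by (simp add: isCont_def filterlim_at_split)
  then have "eventually (\<lambda>b. F f b < 1) (at_right (fst t))" using v(1) by (rule order_tendstoD)
  then have "\<exists>c>fst t. \<forall>b>fst t. b < c \<longrightarrow> F f b < 1"
    by (simp add: eventually_at_right[OF v(2)])
  then obtain c where c: "fst t < c" "\<And>b. fst t < b \<Longrightarrow> b < c \<Longrightarrow> F f b < 1"
    by blast
  obtain b where b: "fst t < b" "b < min c r" using dense[of "fst t" "min c r"] c v by auto
  have "0 < (1 - F f b) ^ (N - 1)" using c(2)[of b] b by simp
  also have "\<dots> \<le> Q b" using b by (intro Q_ge) auto
  finally have "0 < Q b * (b - fst t)" using b by simp
  also have "\<dots> \<le> Q (\<beta> t) * (\<beta> t - fst t)" using t by (simp add: best_response_def)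
  finally have pos: "0 < Q (\<beta> t) * (\<beta> t - fst t)" .
  show "0 < Q (\<beta> t)" using pos Q_nonneg[of "\<beta> t"] by (cases "Q (\<beta> t) = 0") auto
  with pos show "fst t < \<beta> t" by (simp add: zero_less_mult_iff)
  show "\<beta> t \<le> r"
  proof (rule ccontr)
    assume "\<not> \<beta> t \<le> r"
    then have "Q (\<beta> t) = 0" by (intro Q_above_reserve) simp
    with \<open>0 < Q (\<beta> t)\<close> show False by simp
  qed
qed

text \<open>Adding the two optimality inequalities shows that the higher value wins no more often.
  If it bid lower, it would also win no less often; then both bids win with the same positive
  probability and the lower bid is not optimal.\<close>

lemma bids_weakly_increasing:
  assumes t: "best_response t" "F f (fst t) < 1" "fst t < r" and t': "best_response t'"
    and less: "fst t < fst t'"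
  shows "\<beta> t \<le> \<beta> t'"
proof (rule ccontr)
  assume "\<not> \<beta> t \<le> \<beta> t'"
  then have b: "\<beta> t' < \<beta> t" by simp
  note pos = best_response_rational(2)[OF t]
  have 1: "Q (\<beta> t') * (\<beta> t' - fst t) \<le> Q (\<beta> t) * (\<beta> t - fst t)"
    using t(1) by (simp add: best_response_def)
  have 2: "Q (\<beta> t) * (\<beta> t - fst t') \<le> Q (\<beta> t') * (\<beta> t' - fst t')"
    using t' by (simp add: best_response_def)
  have "0 \<le> (Q (\<beta> t) - Q (\<beta> t')) * (fst t' - fst t)"
    using 1 2 by (simp add: algebra_simps)
  then have "Q (\<beta> t') \<le> Q (\<beta> t)" using less by (simp add: zero_le_mult_iff)
  with Q_antimono[of "\<beta> t'" "\<beta> t"] b have "Q (\<beta> t) = Q (\<beta> t')" by simp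
  with 2 pos have "\<beta> t \<le> \<beta> t'" by simp
  with b show False by simp
qed

text \<open>Optimality is known only almost everywhere, so a concrete type to argue with must be
  drawn from a set of positive mass.\<close>

lemma exists_type:
  assumes "AE t in T. R t" "B \<in> sets T" "0 < measure T B"
  shows "\<exists>t\<in>B. R t"
proof (rule ccontr)
  assume "\<not> (\<exists>t\<in>B. R t)"
  then have "AE t in T. t \<notin> B" using assms(1) by (auto elim!: eventually_mono)
  then have "emeasure T B = 0"
    using assms(2) by (subst (asm) AE_iff_measurable[OF assms(2)]) (auto simp: space_pair_measure)
  then show False using assms(3) by (simp add: measure_def)
qed

text \<open>If a positive mass of types bid \<open>c\<close>, undercutting by an arbitrarily small amount wins all of
  the ties at \<open>c\<close>.\<close>

lemma no_atoms:
  assumes "c \<le> r"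
  shows "AE t in T. \<beta> t \<noteq> c"
proof (rule ccontr)
  let ?A = "{t. \<beta> t = c}"
  have "Measurable.pred T (\<lambda>t. \<beta> t = c)" by measurable
  then have A: "?A \<in> sets T" by (simp add: pred_def space_pair_measure)
  assume "\<not> (AE t in T. \<beta> t \<noteq> c)"
  then have "emeasure T ?A \<noteq> 0"
    by (subst (asm) AE_iff_measurable[OF A]) (auto simp: space_pair_measure)
  then have \<kappa>: "0 < measure T ?A"
    by (simp add: T.P.emeasure_eq_measure zero_less_measure_iff)
  \<comment> \<open>Half the probability that all other sellers bid \<open>c\<close>: in that event
    bidding \<open>c\<close> wins with probability at most 1/2, undercutting wins surely.\<close>
  define k where "k = measure T ?A ^ (N - 1) / 2"
  have k: "0 < k" using \<kappa> by (simp add: k_def)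
  \<comment> \<open>Excluding the value \<open>c\<close> itself, a null event, leaves the chosen
    type a positive margin at the bid \<open>c\<close>.\<close>
  have "AE t in T. best_response t \<and> fst t \<noteq> c"
    using AE_best_response AE_value[OF AE_V_neq[of c]] by eventually_elim simp
  from exists_type[OF this A \<kappa>] obtain t where t: "\<beta> t = c" "best_response t" "fst t \<noteq> c" by blast
  then have v: "fst t < c" by (auto simp: best_response_def)
  have gap: "Q c + k \<le> Q b" if "b < c" for b
  proof -
    let ?B = "{\<tau> \<in> space (D {..<N}). \<forall>j\<in>{1..<N}. \<tau> j \<in> ?A}"
    have B: "?B \<in> sets (D {..<N})"
    proof (intro sets.sets_Collect_finite_All)
      fix j assume "j \<in> {1..<N}"
      then have [measurable]: "(\<lambda>\<tau>. \<beta> (\<tau> j)) \<in> borel_measurable (D {..<N})" by (intro bid_measurable) simp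
      show "{\<tau> \<in> space (D {..<N}). \<tau> j \<in> ?A} \<in> sets (D {..<N})" by simp
    qed simp
    have "measure (D {..<N}) ?B = (\<Prod>j\<in>{1..<N}. measure T ?A)"
      using A by (intro prob_sellers) auto
    then have m: "measure (D {..<N}) ?B = 2 * k" by (simp add: k_def)
    have "wp c \<tau> + indicator ?B \<tau> * (1 / 2) \<le> wp b \<tau>" for \<tau>
    proof (cases "\<tau> \<in> ?B")
      case True
      then have *: "\<beta> (\<tau> j) = c" if "j \<in> {..<N}" "j \<noteq> 0" for j using that by auto
      have "wp c \<tau> \<le> 1 / 2"
        unfolding wp_def using N2 by (intro win_prob_tie[of _ 1] *) auto
      moreover have "wp b \<tau> = 1"
        unfolding wp_def using N2 that assms by (intro win_prob_lowest) (auto simp: *)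
      ultimately show ?thesis using True by (simp only: indicator_simps)
    next
      case False
      then have "indicator ?B \<tau> = (0 :: real)" by (rule indicator_simps(2))
      moreover have "wp c \<tau> \<le> wp b \<tau>" unfolding wp_def using N2 that by (intro win_prob_raise) auto
      ultimately show ?thesis by (simp only: mult_zero_left add_0_right)
    qed
    note le = this
    have iB: "integrable (D {..<N}) (\<lambda>\<tau>. indicator ?B \<tau> * (1 / 2) :: real)"
      by (intro integrable_mult_left integrable_real_indicator B, simp add: D.emeasure_eq_measure)
    have "(\<integral>\<tau>. wp c \<tau> + indicator ?B \<tau> * (1 / 2) \<partial>D {..<N}) \<le> Q b"
      unfolding Q_def by (intro integral_mono wp_integrable Bochner_Integration.integrable_add iB le)
    also have "(\<integral>\<tau>. wp c \<tau> + indicator ?B \<tau> * (1 / 2) \<partial>D {..<N}) = Q c + measure (D {..<N}) ?B * (1 / 2)"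
      unfolding Q_def Bochner_Integration.integral_add[OF wp_integrable iB] by simp
    finally show ?thesis by (simp only: m)
  qed
  \<comment> \<open>Undercutting by \<open>e\<close> costs at most \<open>2 * e\<close>, hence at
    most half of the gain \<open>k * (c - fst t)\<close> under the second bound; the first keeps the
    margin positive.\<close>
  define e where "e = min ((c - fst t) / 2) (k * (c - fst t) / 4)"
  have e: "0 < e" "e \<le> (c - fst t) / 2" "e \<le> k * (c - fst t) / 4"
    unfolding e_def using v k by (simp_all only: min.cobounded1 min.cobounded2) simp
  have "(Q c + k) * (c - e - fst t) \<le> Q (c - e) * (c - e - fst t)"
    using gap[of "c - e"] e v by (intro mult_right_mono) auto
  also have "\<dots> \<le> Q c * (c - fst t)"
    using t by (simp add: best_response_def)
  finally have "k * (c - fst t) \<le> (Q c + k) * e" by (simp add: algebra_simps)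
  also have "\<dots> \<le> 2 * e"
  proof (intro mult_right_mono)
    show "Q c + k \<le> 2"
      using Q_le_1[of c] gap[of "c - 1"] Q_le_1[of "c - 1"] Q_nonneg[of c] by simp
  qed (use e in simp)
  also have "\<dots> \<le> k * (c - fst t) / 2" using e by simp
  finally show False using k v by (simp add: mult_le_0_iff)
qed

text \<open>Bids are compared only if the lower value is below the reserve; sellers with values at
  or above it cannot profit from winning, so their best responses need not increase.\<close>

definition ordered :: "real \<times> real \<Rightarrow> real \<times> real \<Rightarrow> bool" where
  "ordered t t' \<longleftrightarrow> fst t \<noteq> fst t'
     \<and> (fst t < fst t' \<longrightarrow> fst t < r \<longrightarrow> \<beta> t < \<beta> t')
     \<and> (fst t' < fst t \<longrightarrow> fst t' < r \<longrightarrow> \<beta> t' < \<beta> t)"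

lemma AE_F_less_1: "AE t in T. F f (fst t) < 1"
  by (rule AE_value[OF AE_V_F_less_1])

text \<open>For a bid up to \<open>r\<close>, weak monotonicity becomes strict because almost no
  type bids the same amount. A bid above \<open>r\<close> comes from a value of at least
  \<open>r\<close>, and any value below \<open>r\<close> bids at most \<open>r\<close>.\<close>

lemma AE_ordered: "AE t in T. AE t' in T. ordered t t'"
  using AE_best_response AE_F_less_1
proof eventually_elim
  case (elim t)
  show ?case
  proof (cases "\<beta> t \<le> r")
    case True
    show ?thesis
      using AE_best_response AE_F_less_1 no_atoms[OF True] AE_value[OF AE_V_neq[of "fst t"]]
    proof eventually_elim
      case (elim t')
      show ?case
        using elim \<open>best_response t\<close> \<open>F f (fst t) < 1\<close>
          bids_weakly_increasing[of t t'] bids_weakly_increasing[of t' t]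
        by (auto simp: ordered_def order.strict_iff_order)
    qed
  next
    case False
    then have "r \<le> fst t" using best_response_rational(1)[of t] elim by force
    show ?thesis
      using AE_best_response AE_F_less_1 AE_value[OF AE_V_neq[of "fst t"]]
    proof eventually_elim
      case (elim t')
      show ?case
        using elim \<open>r \<le> fst t\<close> False best_response_rational(1)[of t']
        by (auto simp: ordered_def)
    qed
  qed
qed

text \<open>Strictly ordered bids make winning equivalent to having the lowest value, so the winning
  probability on the equilibrium path is determined by F alone, even though the bid itself remains
  unknown.\<close>

lemma AE_Q_bid: "AE t in T. fst t < r \<longrightarrow> Q (\<beta> t) = (1 - F f (fst t)) ^ (N - 1)"
  using AE_ordered AE_best_response AE_F_less_1
proof eventually_elim
  case (elim t)
  show ?case
  proof
    assume v: "fst t < r"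
    let ?B = "{\<tau> \<in> space (D {..<N}). \<forall>j\<in>{1..<N}. fst t < vals \<tau> j}"
    have [measurable]: "?B \<in> sets (D {..<N})"
      by (intro sets.sets_Collect_finite_All) auto
    have "AE \<tau> in D {..<N}. wp (\<beta> t) \<tau> = indicator ?B \<tau>"
      using AE_others[OF elim(1)] AE_space
    proof eventually_elim
      case (elim \<tau>)
      show ?case
      proof (cases "\<tau> \<in> ?B")
        case True
        have "\<beta> t < \<beta> (\<tau> j)" if "j \<in> {..<N}" "j \<noteq> 0" for j
        proof -
          have "j \<in> {1..<N}" using that by simp
          then show ?thesis using True elim v by (auto simp: ordered_def)
        qed
        then have "wp (\<beta> t) \<tau> = 1"
          unfolding wp_def using best_response_rational(1)[OF \<open>best_response t\<close> \<open>F f (fst t) < 1\<close> v] N2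
          by (intro win_prob_lowest) auto
        then show ?thesis using True by (simp only: indicator_simps)
      next
        case False
        then obtain j where j: "j \<in> {1..<N}" "\<not> fst t < vals \<tau> j" using elim(2) by blast
        then have "\<beta> (\<tau> j) < \<beta> t" using elim(1) v by (force simp: ordered_def)
        then have "wp (\<beta> t) \<tau> = 0"
          unfolding wp_def using j by (intro win_prob_beaten[of j]) auto
        moreover have "indicator ?B \<tau> = (0 :: real)" using False by (rule indicator_simps(2))
        ultimately show ?thesis by (simp only:)
      qed
    qed
    then have "Q (\<beta> t) = (\<integral>\<tau>. indicator ?B \<tau> \<partial>D {..<N})"
      unfolding Q_def by (intro integral_cong_AE) auto
    also have "\<dots> = measure (D {..<N}) ?B" by simp
    also have "\<dots> = (1 - F f (fst t)) ^ card {1..<N}"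
      by (rule prob_values_greater) auto
    finally show "Q (\<beta> t) = (1 - F f (fst t)) ^ (N - 1)" by simp
  qed
qed

subsection \<open>Interim utilities\<close>

lemma utility_le:
  assumes "x \<le> r" shows "Q b * (b - x) \<le> r - x"
proof (cases "b \<le> r")
  case True
  have "Q b * (b - x) \<le> Q b * (r - x)" using True Q_nonneg by (intro mult_left_mono) auto
  also have "\<dots> \<le> 1 * (r - x)" using assms Q_le_1 by (intro mult_right_mono) auto
  finally show ?thesis by simp
next
  case False
  then show ?thesis using assms by (simp add: Q_above_reserve)
qed

lemma U_ge: "x \<le> r \<Longrightarrow> Q b * (b - x) \<le> U x"
  unfolding U_def by (intro cSUP_upper bdd_aboveI2[where M = "r - x"]) (auto intro: utility_le)

lemma U_le: "(\<And>b. Q b * (b - x) \<le> u) \<Longrightarrow> U x \<le> u"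
  unfolding U_def by (intro cSUP_least) auto

lemma U_best_response: "best_response t \<Longrightarrow> fst t \<le> r \<Longrightarrow> U (fst t) = Q (\<beta> t) * (\<beta> t - fst t)"
  by (intro antisym U_le U_ge) (auto simp: best_response_def)

text \<open>Convexity of \<open>U\<close> bounds its decrease to the right of \<open>x\<close> by the subgradient
  \<open>- Q (\<beta> t)\<close> at a type \<open>t\<close> with a lower value.\<close>

lemma U_decrement_le:
  assumes t: "best_response t" and x: "fst t < x" "x < y" "y \<le> r"
  shows "U x - U y \<le> Q (\<beta> t) * (y - x)"
proof -
  let ?v = "fst t"
  have Uv: "Q b * (b - ?v) \<le> U x + Q (\<beta> t) * (x - ?v)" for b
  proof -
    have "Q b * (b - ?v) \<le> Q (\<beta> t) * (\<beta> t - ?v)" using t by (simp add: best_response_def)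
    also have "\<dots> = Q (\<beta> t) * (\<beta> t - x) + Q (\<beta> t) * (x - ?v)" by (simp add: algebra_simps)
    also have "Q (\<beta> t) * (\<beta> t - x) \<le> U x" using x by (intro U_ge) simp
    finally show ?thesis by simp
  qed
  have "U x \<le> ((y - x) * (U x + Q (\<beta> t) * (x - ?v)) + (x - ?v) * U y) / (y - ?v)"
  proof (rule U_le)
    fix b
    \<comment> \<open>The point \<open>x\<close> is a convex combination of \<open>?v\<close> and
      \<open>y\<close>, and the payoff of a fixed bid is affine in the value.\<close>
    have "(y - ?v) * (Q b * (b - x)) = (y - x) * (Q b * (b - ?v)) + (x - ?v) * (Q b * (b - y))"
      by (simp add: algebra_simps)
    also have "\<dots> \<le> (y - x) * (U x + Q (\<beta> t) * (x - ?v)) + (x - ?v) * U y"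
      using x by (intro add_mono mult_left_mono Uv U_ge) auto
    finally show "Q b * (b - x) \<le> ((y - x) * (U x + Q (\<beta> t) * (x - ?v)) + (x - ?v) * U y) / (y - ?v)"
      using x by (simp add: pos_le_divide_eq mult.commute)
  qed
  then have "(x - ?v) * (U x - U y) \<le> (x - ?v) * (Q (\<beta> t) * (y - x))"
    using x by (simp add: pos_le_divide_eq algebra_simps)
  then show ?thesis using x by simp
qed

text \<open>\<open>AE_Q_bid\<close> says nothing about the single value \<open>x\<close>, and F may
  be flat just below it. So a level \<open>z\<close> below \<open>F f x\<close> is chosen: the
  values between a \<open>z\<close>-quantile \<open>a\<close> and \<open>x\<close> have mass
  \<open>F f x - z\<close>, hence contain a type to which \<open>U_decrement_le\<close> applies.
  Letting \<open>z\<close> tend to \<open>F f x\<close> gives the bound.\<close>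

lemma U_decrement:
  assumes x: "0 < x" "x < y" "y \<le> r"
  shows "U x - U y \<le> (1 - F f x) ^ (N - 1) * (y - x)"
proof (rule tendsto_lowerbound)
  show "((\<lambda>z. (1 - z) ^ (N - 1) * (y - x)) \<longlongrightarrow> (1 - F f x) ^ (N - 1) * (y - x)) (at_left (F f x))"
    by (intro tendsto_intros)
  have "U x - U y \<le> (1 - z) ^ (N - 1) * (y - x)" if z: "0 < z" "z < F f x" for z
  proof -
    obtain a where a: "0 \<le> a" "a \<le> x" "F f a = z"
      using IVT'[of "F f" 0 z x] z x F0 F_cont by auto
    let ?B = "{t. fst t \<in> {a<..<x}}"
    have "Measurable.pred T (\<lambda>t. fst t \<in> {a<..<x})" by measurable
    then have B: "?B \<in> sets T" by (simp add: pred_def space_pair_measure)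
    have Iio: "{..<x} = {..a} \<union> {a<..<x}" using a z by (cases "a = x") auto
    have "measure V {..<x} = measure V {..a} + measure V {a<..<x}"
      unfolding Iio by (rule V.finite_measure_Union) (simp_all add: disjoint_iff)
    then have pos: "0 < measure T ?B"
      using prob_value[of "{a<..<x}"] a z by (simp add: prob_less prob_le)
    have ae: "AE t in T. best_response t \<and> (fst t < r \<longrightarrow> Q (\<beta> t) = (1 - F f (fst t)) ^ (N - 1))"
      using AE_best_response AE_Q_bid by eventually_elim simp
    from exists_type[OF ae B pos] obtain t where "t \<in> ?B" and t': "best_response t"
      "fst t < r \<longrightarrow> Q (\<beta> t) = (1 - F f (fst t)) ^ (N - 1)" by blast
    then have t: "a < fst t" "fst t < x" by auto
    have "Q (\<beta> t) \<le> (1 - z) ^ (N - 1)"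
      using t t'(2) x q_antimono[of a "fst t" "N - 1"] a(3) by auto
    then have "Q (\<beta> t) * (y - x) \<le> (1 - z) ^ (N - 1) * (y - x)"
      using x by (intro mult_right_mono) auto
    with U_decrement_le[OF t'(1) t(2) x(2,3)] show ?thesis by linarith
  qed
  then show "\<forall>\<^sub>F z in at_left (F f x). U x - U y \<le> (1 - z) ^ (N - 1) * (y - x)"
    using F_pos[OF x(1)] by (subst eventually_at_left[of 0]) auto
qed simp

text \<open>Over a step from \<open>x\<close> to \<open>y\<close>, \<open>U\<close> falls by at most
  \<open>h x * (y - x)\<close> and \<open>rent\<close> by at least \<open>h y * (y - x)\<close> for
  the same decreasing \<open>h\<close>. The discrepancy vanishes under refinement, which replaces
  differentiation in the envelope argument.\<close>

lemma U_le_rent: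
  assumes "0 < v" "v \<le> r"
  shows "U v \<le> rent v"
proof -
  have "U v - rent v \<le> U r - rent r"
  proof (rule le_if_decrements_le[where h = "\<lambda>x. (1 - F f x) ^ (N - 1)", OF assms(2)])
    fix x y assume "v \<le> x" "x \<le> y" "y \<le> r"
    then show "(U x - rent x) - (U y - rent y) \<le> ((1 - F f x) ^ (N - 1) - (1 - F f y) ^ (N - 1)) * (y - x)"
      using U_decrement[of x y] rent_diff(2)[of x y] assms(1)
      by (cases "x = y") (auto simp: left_diff_distrib)
  qed
  \<comment> \<open>At value \<open>r\<close> a bid up to the reserve has no positive margin and a
    higher bid never wins.\<close>
  moreover have "U r \<le> 0" using utility_le[of r] by (intro U_le) simp
  ultimately show ?thesis by (simp add: rent_above)
qed

lemma AE_bid_rent: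
  "AE t in T. fst t < r \<longrightarrow> \<beta> t \<le> r \<and> (1 - F f (fst t)) ^ (N - 1) * (\<beta> t - fst t) \<le> rent (fst t)"
  using AE_Q_bid AE_best_response AE_F_less_1 AE_value[OF AE_V_pos]
proof eventually_elim
  case (elim t)
  then show ?case
    using best_response_rational(1)[of t] U_best_response[of t] U_le_rent[of "fst t"] by auto
qed

subsection \<open>Outcome of the first-price auction\<close>

text \<open>Resampling player \<open>i\<close> reduces the profile statement to the iterated one in
  \<open>AE_ordered\<close>.\<close>

lemma AE_ordered_profile:
  assumes "i < N" "j < N" "i \<noteq> j"
  shows "AE \<tau> in D {..N}. ordered (\<tau> i) (\<tau> j)"
proof (rule AE_resample)
  have "Measurable.pred ((borel \<Otimes>\<^sub>M borel) \<Otimes>\<^sub>M (borel \<Otimes>\<^sub>M borel)) (\<lambda>z. ordered (fst z) (snd z))"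
    unfolding ordered_def by measurable
  from measurable_compose[OF measurable_Pair[OF component_measurable[of i "{..N}"] component_measurable[of j "{..N}"]] this]
  show "Measurable.pred (D {..N}) (\<lambda>\<tau>. ordered (\<tau> i) (\<tau> j))" using assms by simp
  have "AE t in T. AE \<tau> in D {..N}. ordered t (\<tau> j)"
    using AE_ordered by eventually_elim (use assms in \<open>auto intro!: AE_seller\<close>)
  then show "AE t in tp i. AE \<tau> in D {..N}. ordered ((\<tau>(i := t)) i) ((\<tau>(i := t)) j)"
    using assms by simp
qed (use assms in auto)

text \<open>Gathers the almost sure properties of a type profile from which the outcome is computed
  deterministically.\<close>

definition regular :: "(nat \<Rightarrow> real \<times> real) \<Rightarrow> bool" where
  "regular \<tau> \<longleftrightarrow> (\<forall>i<N. 0 < vals \<tau> i \<and> vals \<tau> i \<noteq> r \<and> vals \<tau> i \<le> \<beta> (\<tau> i) \<and> (vals \<tau> i < r \<longrightarrow> \<beta> (\<tau> i) \<le> r))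
     \<and> (\<forall>i<N. \<forall>j<N. i \<noteq> j \<longrightarrow> ordered (\<tau> i) (\<tau> j))"

lemma AE_regular: "AE \<tau> in D {..N}. regular \<tau>"
proof -
  have "AE t in T. 0 < fst t \<and> fst t \<noteq> r \<and> fst t \<le> \<beta> t \<and> (fst t < r \<longrightarrow> \<beta> t \<le> r)"
    using AE_value[OF AE_V_pos] AE_value[OF AE_V_neq[of r]] AE_best_response AE_bid_rent
    by eventually_elim (auto simp: best_response_def)
  then have "AE \<tau> in D {..N}. \<forall>i\<in>{..<N}. 0 < vals \<tau> i \<and> vals \<tau> i \<noteq> r \<and> vals \<tau> i \<le> \<beta> (\<tau> i) \<and> (vals \<tau> i < r \<longrightarrow> \<beta> (\<tau> i) \<le> r)"
    by (intro eventually_ball_finite ballI AE_seller) auto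
  moreover have "AE \<tau> in D {..N}. \<forall>i\<in>{..<N}. \<forall>j\<in>{..<N} - {i}. ordered (\<tau> i) (\<tau> j)"
    by (intro eventually_ball_finite ballI AE_ordered_profile) auto
  ultimately show ?thesis by eventually_elim (auto simp: regular_def)
qed

text \<open>The allocation agrees with that of truthful bidding, hence is efficient subject to the
  reserve. Excluding values equal to \<open>r\<close> puts a lowest value within the reserve
  strictly below it, where \<open>ordered\<close> compares bids.\<close>

lemma regular_lowest_bidders:
  assumes "regular \<tau>"
  shows "lowest_bidders r {..<N} (\<lambda>i. \<beta> (\<tau> i)) = lowest_bidders r {..<N} (vals \<tau>)"
proof (intro set_eqI iffI)
  fix i assume i: "i \<in> lowest_bidders r {..<N} (\<lambda>i. \<beta> (\<tau> i))"
  then have i': "i < N" "\<beta> (\<tau> i) \<le> r" "\<And>j. j < N \<Longrightarrow> \<beta> (\<tau> i) \<le> \<beta> (\<tau> j)"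
    by (auto simp: lowest_bidders_def)
  have v: "vals \<tau> i \<le> r" using assms i' by (force simp: regular_def)
  have "vals \<tau> i \<le> vals \<tau> j" if j: "j < N" for j
  proof (rule ccontr)
    assume less: "\<not> vals \<tau> i \<le> vals \<tau> j"
    then have "i \<noteq> j" by auto
    then have "ordered (\<tau> j) (\<tau> i)" using assms i' j by (auto simp: regular_def)
    then have "\<beta> (\<tau> j) < \<beta> (\<tau> i)" using less v by (auto simp: ordered_def)
    with i'(3)[OF j] show False by simp
  qed
  with i' v show "i \<in> lowest_bidders r {..<N} (vals \<tau>)" by (auto simp: lowest_bidders_def)
next
  fix i assume i: "i \<in> lowest_bidders r {..<N} (vals \<tau>)"
  then have i': "i < N" "vals \<tau> i \<le> r" "\<And>j. j < N \<Longrightarrow> vals \<tau> i \<le> vals \<tau> j"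
    by (auto simp: lowest_bidders_def)
  then have v: "vals \<tau> i < r" "\<beta> (\<tau> i) \<le> r" using assms by (auto simp: regular_def order.strict_iff_order)
  have "\<beta> (\<tau> i) \<le> \<beta> (\<tau> j)" if j: "j < N" for j
  proof (cases "i = j")
    case False
    then have "ordered (\<tau> i) (\<tau> j)" using assms i' j by (auto simp: regular_def)
    then show ?thesis using i'(3)[OF j] v by (auto simp: ordered_def)
  qed simp
  with i' v show "i \<in> lowest_bidders r {..<N} (\<lambda>i. \<beta> (\<tau> i))" by (auto simp: lowest_bidders_def)
qed

lemma regular_outcome:
  assumes "regular \<tau>"
  shows "wins N r P \<tau> i = win_prob r {..<N} (vals \<tau>) i"
    and "i < N \<Longrightarrow> price N r P \<tau> i = \<beta> (\<tau> i)"
proof -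
  have R: "rejecting N P \<tau> = {..<N}"
    using assms by (intro rejecting_all) (auto simp: cutoff regular_def intro: less_imp_le)
  have "wins N r P \<tau> i = win_prob r {..<N} (\<lambda>i. \<beta> (\<tau> i)) i"
    unfolding wins_def R Let_def bidders_all by (rule fun_cong[OF win_prob_cong]) (simp add: bids_eq)
  then show "wins N r P \<tau> i = win_prob r {..<N} (vals \<tau>) i"
    by (simp add: win_prob_def regular_lowest_bidders[OF assms])
  show "i < N \<Longrightarrow> price N r P \<tau> i = \<beta> (\<tau> i)"
    by (simp add: price_def R pricing first_price_def bids_eq)
qed

text \<open>Payoffs integrate over all profiles, and replacing the integrand by its almost sure form
  needs measurability for every rejecting set, including those of probability zero. A set containing
  a seller has between 1 and \<open>N\<close> members, which is the range covered by the equilibrium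
  condition.\<close>

lemma bids_measurable:
  assumes "R \<subseteq> {..<N}" "k \<in> bidders N R"
  shows "(\<lambda>\<tau>. bids N P (card R) \<tau> k) \<in> borel_measurable (D {..N})"
proof (cases "k < N")
  case True
  then have "k \<in> R" using assms(2) by (auto simp: bidders_def split: if_splits)
  then have "card R \<in> {1..N}"
    using assms(1) card_mono[OF finite_lessThan assms(1)] finite_subset[OF assms(1)]
    by (auto simp: Suc_le_eq card_gt_0_iff)
  then have "case_prod (seller_bid P (card R)) \<in> borel_measurable (borel \<Otimes>\<^sub>M borel)"
    using bidding by (auto simp: fpa_bidding_equilibrium_def)
  from measurable_compose[OF component_measurable[of k "{..N}"] this] True
  show ?thesis by (simp add: bids_def split_beta')
next
  case False
  then have k: "k = N" "card R < N" using assms by (auto simp: bidders_def split: if_splits)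
  then have [measurable]: "speculator_bid P (card R) \<in> borel_measurable borel"
    using bidding by (auto simp: fpa_bidding_equilibrium_def)
  have [measurable]: "(\<lambda>\<tau>. \<tau> N) \<in> D {..N} \<rightarrow>\<^sub>M (borel \<Otimes>\<^sub>M borel)" by (rule component_measurable) simp
  show ?thesis using k by (simp add: bids_def)
qed

lemma wins_measurable: "(\<lambda>\<tau>. wins N r P \<tau> i) \<in> borel_measurable (D {..N})"
  and wins_price_measurable: "(\<lambda>\<tau>. wins N r P \<tau> i * price N r P \<tau> i) \<in> borel_measurable (D {..N})"
proof -
  have sub: "{..<N} \<subseteq> {..N}" by auto
  have fin: "finite (bidders N R)" if "R \<subseteq> {..<N}" for R
    using finite_subset[OF that] by (simp add: bidders_def)
  have wp: "(\<lambda>\<tau>. win_prob r (bidders N R) (bids N P (card R) \<tau>) i) \<in> borel_measurable (D {..N})"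
    if "R \<subseteq> {..<N}" for R
    using win_prob_measurable[OF fin[OF that] bids_measurable[OF that]] by simp
  show "(\<lambda>\<tau>. wins N r P \<tau> i) \<in> borel_measurable (D {..N})"
    unfolding wins_def rejecting_def Let_def cutoff
    by (rule rejecting_compose_measurable[OF sub, where h = "\<lambda>R \<tau>. win_prob r (bidders N R) (bids N P (card R) \<tau>) i"]) (rule wp)
  have "(\<lambda>\<tau>. win_prob r (bidders N R) (bids N P (card R) \<tau>) i * bids N P (card R) \<tau> i) \<in> borel_measurable (D {..N})"
    if "R \<subseteq> {..<N}" for R
  proof (cases "i \<in> bidders N R")
    case True
    then show ?thesis by (intro borel_measurable_times wp bids_measurable that)
  next
    case False
    then show ?thesis by (simp add: win_prob_outside)
  qed
  then show "(\<lambda>\<tau>. wins N r P \<tau> i * price N r P \<tau> i) \<in> borel_measurable (D {..N})"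
    unfolding wins_def price_def rejecting_def Let_def cutoff pricing first_price_def
    by (rule rejecting_compose_measurable[OF sub, where h = "\<lambda>R \<tau>. win_prob r (bidders N R) (bids N P (card R) \<tau>) i * bids N P (card R) \<tau> i"])
qed

definition seller_gain :: "nat \<Rightarrow> (nat \<Rightarrow> real \<times> real) \<Rightarrow> real" where
  "seller_gain i \<tau> = win_prob r {..<N} (vals \<tau>) i * (\<beta> (\<tau> i) - vals \<tau> i)"

text \<open>Without ties the winning probability is an indicator and factors into an event about the
  others and a function of the own type, ready for conditioning on the latter.\<close>

lemma regular_seller_gain:
  assumes "regular \<tau>" "i < N"
  shows "seller_gain i \<tau>
    = of_bool (\<forall>j\<in>{..<N} - {i}. vals \<tau> i < vals \<tau> j) * (of_bool (vals \<tau> i < r) * (\<beta> (\<tau> i) - vals \<tau> i))"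
    and "0 \<le> seller_gain i \<tau>" and "seller_gain i \<tau> \<le> r"
proof -
  have eq: "win_prob r {..<N} (vals \<tau>) i = of_bool (\<forall>j\<in>{..<N} - {i}. vals \<tau> i < vals \<tau> j) * of_bool (vals \<tau> i < r)"
  proof (cases "(\<forall>j\<in>{..<N} - {i}. vals \<tau> i < vals \<tau> j) \<and> vals \<tau> i < r")
    case True
    have "win_prob r {..<N} ((vals \<tau>)(i := vals \<tau> i)) i = 1"
      using True assms by (intro win_prob_lowest) auto
    moreover have "(vals \<tau>)(i := vals \<tau> i) = vals \<tau>" by auto
    ultimately have "win_prob r {..<N} (vals \<tau>) i = 1" by (simp only:)
    then show ?thesis using True by simp
  next
    case False
    have "i \<notin> lowest_bidders r {..<N} (vals \<tau>)"
    proof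
      assume "i \<in> lowest_bidders r {..<N} (vals \<tau>)"
      then have l: "vals \<tau> i \<le> r" "\<And>j. j < N \<Longrightarrow> vals \<tau> i \<le> vals \<tau> j" by (auto simp: lowest_bidders_def)
      have "vals \<tau> i \<noteq> r" "\<And>j. j < N \<Longrightarrow> j \<noteq> i \<Longrightarrow> vals \<tau> i \<noteq> vals \<tau> j"
        using assms by (auto simp: regular_def ordered_def)
      with l False show False by (metis DiffE lessThan_iff order_le_less singletonI)
    qed
    then show ?thesis using False by (auto simp: win_prob_def)
  qed
  show g: "seller_gain i \<tau>
    = of_bool (\<forall>j\<in>{..<N} - {i}. vals \<tau> i < vals \<tau> j) * (of_bool (vals \<tau> i < r) * (\<beta> (\<tau> i) - vals \<tau> i))"
    unfolding seller_gain_def eq by simp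
  have "0 < vals \<tau> i" "vals \<tau> i \<le> \<beta> (\<tau> i)" "vals \<tau> i < r \<longrightarrow> \<beta> (\<tau> i) \<le> r"
    using assms by (auto simp: regular_def)
  then show "0 \<le> seller_gain i \<tau>" "seller_gain i \<tau> \<le> r"
    unfolding g using r_pos by (auto split: split_of_bool)
qed

lemma seller_gain_measurable:
  assumes "i < N" shows "seller_gain i \<in> borel_measurable (D {..N})"
proof -
  have [measurable]: "(\<lambda>\<tau>. vals \<tau> i) \<in> borel_measurable (D {..N})" "(\<lambda>\<tau>. \<beta> (\<tau> i)) \<in> borel_measurable (D {..N})"
    using assms by (auto intro: value_measurable bid_measurable)
  have [measurable]: "(\<lambda>\<tau>. win_prob r {..<N} (vals \<tau>) i) \<in> borel_measurable (D {..N})"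
    by (rule win_prob_measurable) (auto intro: value_measurable)
  show ?thesis unfolding seller_gain_def[abs_def] by measurable
qed

lemma seller_gain_integrable:
  assumes "i < N" shows "integrable (D {..N}) (seller_gain i)"
proof (rule D.integrable_const_bound[OF _ seller_gain_measurable[OF assms]])
  show "AE \<tau> in D {..N}. norm (seller_gain i \<tau>) \<le> r"
    using AE_regular by eventually_elim (use regular_seller_gain[OF _ assms] in auto)
qed

lemma seller_payoff_eq:
  assumes i: "i < N"
  shows "seller_payoff f N r P i = (\<integral>\<tau>. seller_gain i \<tau> \<partial>D {..N})"
  unfolding seller_payoff_def cutoff
proof (rule integral_cong_AE)
  have [measurable]: "(\<lambda>\<tau>. vals \<tau> i) \<in> borel_measurable (D {..N})" using i by (auto intro: value_measurable)
  note [measurable] = wins_measurable[of i] wins_price_measurable[of i]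
  have eq: "wins N r P \<tau> i * (price N r P \<tau> i - vals \<tau> i)
    = wins N r P \<tau> i * price N r P \<tau> i - wins N r P \<tau> i * vals \<tau> i" for \<tau>
    by (simp add: right_diff_distrib)
  show "(\<lambda>\<tau>. if vals \<tau> i < 0 then offer P - vals \<tau> i
      else wins N r P \<tau> i * (price N r P \<tau> i - vals \<tau> i)) \<in> borel_measurable (D {..N})"
    unfolding eq by measurable
  show "AE \<tau> in D {..N}. (if vals \<tau> i < 0 then offer P - vals \<tau> i
      else wins N r P \<tau> i * (price N r P \<tau> i - vals \<tau> i)) = seller_gain i \<tau>"
    using AE_regular
  proof eventually_elim
    case (elim \<tau>)
    then have "0 < vals \<tau> i" using i by (simp add: regular_def)
    then show ?case using regular_outcome[OF elim] i by (simp add: seller_gain_def)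
  qed
qed (rule seller_gain_measurable[OF i])

text \<open>Given the own type, the others all have higher values with probability
  \<open>(1 - F f (fst t)) ^ (N - 1)\<close>, so the conditional payoff is the one bounded by
  \<open>AE_bid_rent\<close>; values of at least \<open>r\<close> contribute nothing.\<close>

lemma seller_payoff_le:
  assumes i: "i < N"
  shows "seller_payoff f N r P i \<le> (\<integral>t. rent (fst t) \<partial>T)"
proof -
  let ?O = "{..<N} - {i}"
  let ?k = "\<lambda>t. of_bool (fst t < r) * (\<beta> t - fst t)"
  let ?g = "\<lambda>\<tau>. of_bool (\<forall>j\<in>?O. vals \<tau> i < vals \<tau> j) * ?k (\<tau> i)"
  have [measurable]: "?g \<in> borel_measurable (D {..N})"
  proof -
    have [measurable]: "(\<lambda>\<tau>. vals \<tau> i) \<in> borel_measurable (D {..N})" "(\<lambda>\<tau>. \<beta> (\<tau> i)) \<in> borel_measurable (D {..N})"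
      using assms by (auto intro: value_measurable bid_measurable)
    have "Measurable.pred (D {..N}) (\<lambda>\<tau>. vals \<tau> i < vals \<tau> j)" if "j \<in> ?O" for j
    proof -
      have [measurable]: "(\<lambda>\<tau>. vals \<tau> j) \<in> borel_measurable (D {..N})" using that by (auto intro: value_measurable)
      show ?thesis by measurable
    qed
    then have [measurable]: "Measurable.pred (D {..N}) (\<lambda>\<tau>. \<forall>j\<in>?O. vals \<tau> i < vals \<tau> j)"
      by (intro pred_intros_finite) auto
    show ?thesis by measurable
  qed
  have ae: "AE \<tau> in D {..N}. seller_gain i \<tau> = ?g \<tau>"
    using AE_regular by eventually_elim (rule regular_seller_gain(1)[OF _ i])
  have int: "integrable (D {..N}) ?g"
    by (rule integrable_cong_AE_imp[OF seller_gain_integrable[OF i]]) (use ae in \<open>auto elim!: eventually_mono\<close>)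
  have inner: "(\<integral>\<tau>. ?g (\<tau>(i := t)) \<partial>D {..N}) = (1 - F f (fst t)) ^ (N - 1) * ?k t" for t
  proof -
    let ?B = "{\<tau> \<in> space (D {..N}). \<forall>j\<in>?O. fst t < vals \<tau> j}"
    have B: "?B \<in> sets (D {..N})" by (intro sets.sets_Collect_finite_All) auto
    have "(\<integral>\<tau>. ?g (\<tau>(i := t)) \<partial>D {..N}) = (\<integral>\<tau>. indicator ?B \<tau> * ?k t \<partial>D {..N})"
      by (intro Bochner_Integration.integral_cong refl) (simp add: indicator_def)
    also have "\<dots> = measure (D {..N}) ?B * ?k t" using B by simp
    also have "measure (D {..N}) ?B = (1 - F f (fst t)) ^ card ?O" by (rule prob_values_greater) auto
    finally show ?thesis using i by simp
  qed
  \<comment> \<open>Nonnegativity is recorded too, so that the rent dominates the integrand in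
    absolute value and gives integrability.\<close>
  have ae_rent: "AE t in T. 0 \<le> (1 - F f (fst t)) ^ (N - 1) * ?k t \<and> (1 - F f (fst t)) ^ (N - 1) * ?k t \<le> rent (fst t)"
    using AE_bid_rent AE_best_response
  proof eventually_elim
    case (elim t)
    have "0 \<le> (1 - F f (fst t)) ^ (N - 1) * (\<beta> t - fst t)"
      using elim by (intro mult_nonneg_nonneg zero_le_power) (auto simp: best_response_def)
    then show ?case using elim rent_nonneg[of "fst t"] by (auto split: split_of_bool)
  qed
  have "seller_payoff f N r P i = (\<integral>\<tau>. ?g \<tau> \<partial>D {..N})"
    unfolding seller_payoff_eq[OF i] using ae seller_gain_measurable[OF i] by (intro integral_cong_AE) auto
  also have "\<dots> = (\<integral>t. (1 - F f (fst t)) ^ (N - 1) * ?k t \<partial>T)"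
  proof -
    have "(\<integral>\<tau>. ?g \<tau> \<partial>D {..N}) = (\<integral>t. (\<integral>\<tau>. ?g (\<tau>(i := t)) \<partial>D {..N}) \<partial>tp i)"
      using i by (intro integral_resample int) auto
    then show ?thesis unfolding inner tp_seller[OF i] .
  qed
  also have "\<dots> \<le> (\<integral>t. rent (fst t) \<partial>T)"
  proof (rule integral_mono_AE[OF _ rent_type_integrable])
    show "integrable T (\<lambda>t. (1 - F f (fst t)) ^ (N - 1) * ?k t)"
    proof (rule Bochner_Integration.integrable_bound[OF rent_type_integrable])
      show "AE t in T. norm ((1 - F f (fst t)) ^ (N - 1) * ?k t) \<le> norm (rent (fst t))"
        using ae_rent by eventually_elim auto
    qed measurable
    show "AE t in T. (1 - F f (fst t)) ^ (N - 1) * ?k t \<le> rent (fst t)"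
      using ae_rent by eventually_elim auto
  qed
  finally show ?thesis .
qed

text \<open>With the speculator absent, the auctioneer keeps whatever surplus the sellers do not
  receive. An upper bound on seller payoffs therefore becomes a lower bound on his.\<close>

lemma auctioneer_payoff_eq:
  "auctioneer_payoff f N r w P
    = (\<integral>\<tau>. efficient_surplus w (vals \<tau>) \<partial>D {..N}) - (\<Sum>i<N. seller_payoff f N r P i)"
proof -
  have si: "integrable (D {..N}) (seller_gain i)" if "i \<in> {..<N}" for i
    using that by (intro seller_gain_integrable) simp
  note ss = Bochner_Integration.integrable_sum[OF si]
  have "auctioneer_payoff f N r w P = (\<integral>\<tau>. efficient_surplus w (vals \<tau>) - (\<Sum>i<N. seller_gain i \<tau>) \<partial>D {..N})"
    unfolding auctioneer_payoff_def
  proof (rule integral_cong_AE)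
    have eq: "wins N r P \<tau> i * (w - price N r P \<tau> i) = wins N r P \<tau> i * w - wins N r P \<tau> i * price N r P \<tau> i" for \<tau> i
      by (simp add: right_diff_distrib)
    show "(\<lambda>\<tau>. \<Sum>i\<in>{..N}. wins N r P \<tau> i * (w - price N r P \<tau> i)) \<in> borel_measurable (D {..N})"
      unfolding eq by (intro borel_measurable_sum borel_measurable_diff wins_price_measurable borel_measurable_times wins_measurable) simp
    show "(\<lambda>\<tau>. efficient_surplus w (vals \<tau>) - (\<Sum>i<N. seller_gain i \<tau>)) \<in> borel_measurable (D {..N})"
      using Bochner_Integration.integrable_diff[OF efficient_surplus_integrable ss] by (rule borel_measurable_integrable)
    show "AE \<tau> in D {..N}. (\<Sum>i\<in>{..N}. wins N r P \<tau> i * (w - price N r P \<tau> i))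
      = efficient_surplus w (vals \<tau>) - (\<Sum>i<N. seller_gain i \<tau>)"
      using AE_regular
    proof eventually_elim
      case (elim \<tau>)
      note outcome = regular_outcome[OF elim]
      have "(\<Sum>i\<in>{..N}. wins N r P \<tau> i * (w - price N r P \<tau> i))
        = (\<Sum>i<N. wins N r P \<tau> i * (w - price N r P \<tau> i))"
        by (simp add: lessThan_Suc_atMost[symmetric] outcome(1) win_prob_outside)
      also have "\<dots> = (\<Sum>i<N. win_prob r {..<N} (vals \<tau>) i * (w - vals \<tau> i) - seller_gain i \<tau>)"
        by (intro sum.cong refl) (simp add: outcome seller_gain_def algebra_simps)
      finally show ?case using sum_win_prob_value[OF N_pos, of r "vals \<tau>" w] by (simp only: sum_subtractf)
    qed
  qed
  also have "\<dots> = (\<integral>\<tau>. efficient_surplus w (vals \<tau>) \<partial>D {..N}) - (\<integral>\<tau>. (\<Sum>i<N. seller_gain i \<tau>) \<partial>D {..N})"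
    by (rule Bochner_Integration.integral_diff[OF efficient_surplus_integrable ss])
  also have "(\<integral>\<tau>. (\<Sum>i<N. seller_gain i \<tau>) \<partial>D {..N}) = (\<Sum>i<N. \<integral>\<tau>. seller_gain i \<tau> \<partial>D {..N})"
    by (rule Bochner_Integration.integral_sum[OF si])
  finally show ?thesis by (simp add: seller_payoff_eq)
qed

lemma total_surplus_eq: "total_surplus f N r w P = (\<integral>\<tau>. efficient_surplus w (vals \<tau>) \<partial>D {..N})"
  by (simp add: total_surplus_def auctioneer_payoff_eq speculator_payoff_0[OF cutoff])

text \<open>The two auctions meet at the benchmark: each first-price seller gets at most his
  expected rent and each second-price seller strictly more, while the auctioneer gets at least the
  surplus net of rents in the former and strictly less in the latter.\<close>

lemma comparison:
  assumes "spa_equilibrium f N r S"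
  shows "auctioneer_payoff f N r w P > auctioneer_payoff f N r w S \<and>
         total_surplus f N r w P > total_surplus f N r w S \<and>
         (\<forall>i<N. seller_payoff f N r P i < seller_payoff f N r S i)"
proof -
  obtain c where c: "0 < c" "c \<le> r" and S: "S = truthful_play c (c + rent c)"
    by (rule spa_equilibrium_speculation[OF assms])
  have "(\<Sum>i<N. seller_payoff f N r P i) \<le> (\<Sum>i<N. \<integral>t. rent (fst t) \<partial>T)"
    by (intro sum_mono seller_payoff_le) simp
  then have "auctioneer_payoff f N r w S < auctioneer_payoff f N r w P"
    using truthful_auctioneer_payoff_less[OF c, of w "c + rent c"] by (simp add: S auctioneer_payoff_eq)
  moreover have "total_surplus f N r w S < total_surplus f N r w P"
    using truthful_total_surplus_less[OF c] by (simp add: S total_surplus_eq)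
  moreover have "seller_payoff f N r P i < seller_payoff f N r S i" if "i < N" for i
    using seller_payoff_le[OF that] truthful_seller_payoff_greater[OF c refl that] by (simp add: S)
  ultimately show ?thesis by blast
qed

end

theorem corollary2:
  fixes f :: "real \<Rightarrow> real" and N :: nat and r w :: real and S P :: play
  assumes "N \<ge> 2"
    and "0 < r" and "r \<le> 1"
    and "f \<in> borel_measurable borel" and "\<And>x. 0 \<le> f x"
    and "prob_space (value_dist f)"
    and "F f 0 = 0" and "F f 1 = 1"
    and "\<And>v. v \<in> {0<..1} \<Longrightarrow> 0 < F f v"
    and "\<And>v. v \<in> {0<..r} \<Longrightarrow> fpa_profit f N r v < 0"
    and "spa_equilibrium f N r S"
    and "fpa_equilibrium f N r P"
  shows "auctioneer_payoff f N r w P > auctioneer_payoff f N r w S \<and>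
         total_surplus f N r w P > total_surplus f N r w S \<and>
         (\<forall>i<N. seller_payoff f N r P i < seller_payoff f N r S i)"
proof -
  interpret private_values f N r
    by (rule private_values.intro) (fact assms)+
  interpret first_price_equilibrium f N r P
    using assms(12) fpa_cutoff_0[OF assms(10,12)] by unfold_locales (simp_all add: fpa_equilibrium_def)
  show ?thesis by (rule comparison[OF assms(11)])
qed

end
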